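(* Let $\rho_1,\sigma_1\in H^2(-1,0)$ and $\rho_2,\sigma_2\in H^2(0,1)$ be uniformly positive, $q_1\in L^1(-1,0)$, $q_2\in L^1(0,1)$ nonnegative, $M>0$, and let $0<\lambda_1<\lambda_2<\cdots$ be the eigenvalues of the problem $$\begin{cases}-(\sigma_1u')'+q_1u=\lambda\rho_1u, & x\in(-1,0),\\ -(\sigma_2v')'+q_2v=\lambda\rho_2v, & x\in(0,1),\\ u(-1)=v(1)=0,\ u(0)=v(0),\\ \sigma_1(0)u'(0)-\sigma_2(0)v'(0)=\lambda Mu(0).\end{cases}$$ Then there exists a subsequence $(\lambda_{\varphi(n)})_{n\ge1}$ such that $$\sqrt{\lambda_{\varphi(n)+1}}-\sqrt{\lambda_{\varphi(n)}}=\mathcal O\Big(\frac1n\Big),$$ and there exists $\delta>0$ such that $\sqrt{\lambda_{n+2}}-\sqrt{\lambda_n}>2\delta$ for all $n\ge1$. *)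

theory Defs
  imports "HOL-Analysis.Analysis" "HOL-Library.Landau_Symbols"
begin

text \<open>Sobolev space H^2(a,b) on a bounded interval, via the continuous representative:
  f = f(a) + int g, g = g(a) + int h with h in L^2(a,b) (on a bounded interval
  h in L^2 iff h and h^2 are Lebesgue integrable).\<close>
definition H2_on :: "real \<Rightarrow> real \<Rightarrow> (real \<Rightarrow> real) \<Rightarrow> bool" where
  "H2_on a b f \<longleftrightarrow> (\<exists>g h.
      h absolutely_integrable_on {a..b} \<and>
      (\<lambda>x. (h x)\<^sup>2) absolutely_integrable_on {a..b} \<and>
      (\<forall>x\<in>{a..b}. g x = g a + integral {a..x} h) \<and>
      (\<forall>x\<in>{a..b}. f x = f a + integral {a..x} g))"

definition unif_pos_on :: "real \<Rightarrow> real \<Rightarrow> (real \<Rightarrow> real) \<Rightarrow> bool" where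
  "unif_pos_on a b f \<longleftrightarrow> (\<exists>c>0. \<forall>x\<in>{a..b}. c \<le> f x)"

text \<open>(u, w) solves  -(sigma u')' + q u = mu rho u  on (a,b) in the Caratheodory sense,
  where w = sigma u' is the quasi-derivative: u and w are absolutely continuous on [a,b],
  u' = w / sigma and w' = q u - mu rho u almost everywhere.\<close>
definition SL_sol :: "real \<Rightarrow> real \<Rightarrow> (real \<Rightarrow> real) \<Rightarrow> (real \<Rightarrow> real) \<Rightarrow> (real \<Rightarrow> real)
    \<Rightarrow> real \<Rightarrow> (real \<Rightarrow> real) \<Rightarrow> (real \<Rightarrow> real) \<Rightarrow> bool" where
  "SL_sol a b \<sigma> q \<rho> \<mu> u w \<longleftrightarrow>
     (\<lambda>t. w t / \<sigma> t) absolutely_integrable_on {a..b} \<and>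
     (\<lambda>t. q t * u t - \<mu> * \<rho> t * u t) absolutely_integrable_on {a..b} \<and>
     (\<forall>x\<in>{a..b}. u x = u a + integral {a..x} (\<lambda>t. w t / \<sigma> t)) \<and>
     (\<forall>x\<in>{a..b}. w x = w a + integral {a..x} (\<lambda>t. q t * u t - \<mu> * \<rho> t * u t))"

text \<open>mu is an eigenvalue of the transmission problem on (-1,0) and (0,1).
  sigma_1(0) u'(0) is the quasi-derivative w(0), sigma_2(0) v'(0) is z(0).\<close>
definition is_eigenvalue ::
  "(real \<Rightarrow> real) \<Rightarrow> (real \<Rightarrow> real) \<Rightarrow> (real \<Rightarrow> real) \<Rightarrow>
   (real \<Rightarrow> real) \<Rightarrow> (real \<Rightarrow> real) \<Rightarrow> (real \<Rightarrow> real) \<Rightarrow> real \<Rightarrow> real \<Rightarrow> bool" where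
  "is_eigenvalue \<sigma>1 q1 \<rho>1 \<sigma>2 q2 \<rho>2 M \<mu> \<longleftrightarrow>
     (\<exists>u w v z. SL_sol (-1) 0 \<sigma>1 q1 \<rho>1 \<mu> u w \<and> SL_sol 0 1 \<sigma>2 q2 \<rho>2 \<mu> v z \<and>
        u (-1) = 0 \<and> v 1 = 0 \<and> u 0 = v 0 \<and>
        w 0 - z 0 = \<mu> * M * u 0 \<and>
        ((\<exists>x\<in>{-1..0}. u x \<noteq> 0) \<or> (\<exists>x\<in>{0..1}. v x \<noteq> 0)))"

end

theory Submission
  imports Defs
begin

text \<open>
  Write \<open>\<lambda> = s\<^sup>2\<close>, reflect the right half onto \<open>[-1, 0]\<close> and solve each half from its Dirichlet end.
  With \<open>h = (\<rho>\<sigma>)\<^bsup>1/4\<^esup>\<close>, \<open>\<kappa> = (\<rho>/\<sigma>)\<^bsup>1/2\<^esup>\<close> and \<open>\<tau> = \<integral>\<kappa>\<close>, the pair \<open>(X, Y) = (h u, w / (s h))\<close> rotates with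
  phase \<open>s \<tau>\<close> up to lower order terms, and one integration by parts (where the second derivatives
  of \<open>\<rho>\<close> and \<open>\<sigma>\<close> enter) gives \<open>X = sin (s \<tau>) + O(1/s)\<close>, \<open>Y = cos (s \<tau>) + O(1/s)\<close>.

  The gap bound for every second eigenvalue: eigenfunctions are orthogonal for
  \<open>\<integral> \<rho>\<^sub>1 u u' + \<integral> \<rho>\<^sub>2 v v' + M u(0) u'(0)\<close>, the point term is \<open>O(1/s\<^sup>2)\<close>, and eigenfunctions for close \<open>s\<close>
  are nearly combinations of the same two functions. So three eigenvalues with close \<open>s\<close> would give
  three almost orthogonal unit vectors in a plane.

  The small gaps: a subsequence with gaps \<open>O(1/n)\<close> exists as soon as the gaps have lower limit zero.
  The characteristic function is \<open>m\<^sub>1 x' y + m\<^sub>2 y' x - s M x y\<close> with \<open>x \<approx> sin (s T\<^sub>1)\<close>, \<open>x' \<approx> cos (s T\<^sub>1)\<close>,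
  \<open>y \<approx> sin (s T\<^sub>2)\<close>, \<open>y' \<approx> cos (s T\<^sub>2)\<close>. By Dirichlet's approximation theorem there are arbitrarily large \<open>s\<close>
  near which both sines change sign; there the last term forces the same sign at both ends of a short
  interval, while at the last zero of \<open>min x y\<close> the sign is opposite (or both vanish), which produces two zeros.
\<close>

section \<open>Absolutely continuous functions\<close>

text \<open>Absolute continuity with the density \<open>f\<close> as an explicit argument. A
  differential equation that holds almost everywhere becomes a statement about indefinite integrals,
  and a calculus of densities replaces pointwise differentiation.\<close>

definition AC_on :: "real \<Rightarrow> real \<Rightarrow> (real \<Rightarrow> real) \<Rightarrow> (real \<Rightarrow> real) \<Rightarrow> bool" where
  "AC_on a b F f \<longleftrightarrow> f absolutely_integrable_on {a..b} \<and>
     (\<forall>x\<in>{a..b}. F x = F a + integral {a..x} f)"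

lemma AC_onD:
  assumes "AC_on a b F f"
  shows "f absolutely_integrable_on {a..b}" "f integrable_on {a..b}"
    and "x \<in> {a..b} \<Longrightarrow> F x = F a + integral {a..x} f"
  using assms set_lebesgue_integral_eq_integral(1) unfolding AC_on_def by blast+

lemma SL_sol_iff_AC_on:
  "SL_sol a b \<sigma> q \<rho> \<mu> u w \<longleftrightarrow>
    AC_on a b u (\<lambda>t. w t / \<sigma> t) \<and> AC_on a b w (\<lambda>t. q t * u t - \<mu> * \<rho> t * u t)"
  unfolding SL_sol_def AC_on_def by blast

lemma AC_on_integral:
  assumes "f absolutely_integrable_on {a..b}"
  shows "AC_on a b (\<lambda>x. integral {a..x} f) f"
  using assms by (auto simp: AC_on_def)

lemma AC_on_increment:
  assumes "AC_on a b F f" "a \<le> x" "x \<le> y" "y \<le> b"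
  shows "F y - F x = integral {x..y} f"
proof -
  have "f integrable_on {a..y}"
    by (rule integrable_on_subinterval[OF AC_onD(2)[OF assms(1)]]) (use assms in auto)
  hence "integral {a..x} f + integral {x..y} f = integral {a..y} f"
    using assms by (intro Henstock_Kurzweil_Integration.integral_combine) auto
  moreover have "F x = F a + integral {a..x} f" "F y = F a + integral {a..y} f"
    by (rule AC_onD(3)[OF assms(1)]; use assms(2-4) in simp)+
  ultimately show ?thesis by linarith
qed

lemma AC_on_continuous:
  assumes "AC_on a b F f"
  shows "continuous_on {a..b} F"
proof -
  have "continuous_on {a..b} (\<lambda>x. F a + integral {a..x} f)"
    by (intro continuous_intros indefinite_integral_continuous_1 AC_onD(2)[OF assms])
  then show ?thesis
    by (rule continuous_on_eq) (rule AC_onD(3)[OF assms, symmetric])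
qed

lemma AC_on_cong:
  assumes "AC_on a b F f" "\<And>x. x \<in> {a..b} \<Longrightarrow> F x = G x" "\<And>x. x \<in> {a..b} \<Longrightarrow> f x = g x"
  shows "AC_on a b G g"
proof -
  have "integral {a..x} f = integral {a..x} g" if "x \<in> {a..b}" for x
    using that assms(3) by (intro integral_cong) auto
  moreover have "g absolutely_integrable_on {a..b}"
    using AC_onD(1)[OF assms(1)] assms(3) by (metis (no_types, lifting) set_integrable_cong)
  moreover have "G x = G a + integral {a..x} f" if "x \<in> {a..b}" for x
    using AC_onD(3)[OF assms(1) that] assms(2)[of a] assms(2)[of x] that by simp
  ultimately show ?thesis unfolding AC_on_def by metis
qed

lemma AC_on_const: "AC_on a b (\<lambda>_. c) (\<lambda>_. 0)"
  by (simp add: AC_on_def)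

lemma AC_on_add:
  assumes "AC_on a b F f" "AC_on a b G g"
  shows "AC_on a b (\<lambda>x. F x + G x) (\<lambda>x. f x + g x)"
proof -
  have "integral {a..x} (\<lambda>t. f t + g t) = integral {a..x} f + integral {a..x} g" if "x \<in> {a..b}" for x
    using that by (intro Henstock_Kurzweil_Integration.integral_add
        integrable_on_subinterval[OF AC_onD(2)[OF assms(1)]]
        integrable_on_subinterval[OF AC_onD(2)[OF assms(2)]]) auto
  note int = this
  have "F x + G x = F a + G a + integral {a..x} (\<lambda>t. f t + g t)" if "x \<in> {a..b}" for x
    using AC_onD(3)[OF assms(1) that] AC_onD(3)[OF assms(2) that] int[OF that] by linarith
  then show ?thesis
    using AC_onD(1)[OF assms(1)] AC_onD(1)[OF assms(2)]
    unfolding AC_on_def by (blast intro: set_integral_add(1))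
qed

lemma AC_on_cmult:
  assumes "AC_on a b F f"
  shows "AC_on a b (\<lambda>x. c * F x) (\<lambda>x. c * f x)"
proof -
  have "c * F x = c * F a + integral {a..x} (\<lambda>x. c * f x)" if "x \<in> {a..b}" for x
    by (subst AC_onD(3)[OF assms that]) (simp add: distrib_left)
  then show ?thesis
    using set_integrable_mult_right[of c, OF AC_onD(1)[OF assms]] unfolding AC_on_def by blast
qed

lemma AC_on_diff:
  assumes "AC_on a b F f" "AC_on a b G g"
  shows "AC_on a b (\<lambda>x. F x - G x) (\<lambda>x. f x - g x)"
  using AC_on_add[OF assms(1) AC_on_cmult[OF assms(2), of "-1"]] by simp

section \<open>Product and chain rules for absolutely continuous functions\<close>

text \<open>The error \<open>H y - H x - integral {x..y} f\<close> is additive over adjacent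
  intervals, and so is its bound. A bound valid on all short intervals therefore passes to
  \<open>{a..z}\<close> by bisection, and letting \<epsilon> tend to 0 removes the error.\<close>

lemma AC_on_criterion:
  assumes f: "f absolutely_integrable_on {a..b}" and k: "k absolutely_integrable_on {a..b}"
    and loc: "\<And>\<epsilon>. \<epsilon> > 0 \<Longrightarrow> \<exists>\<delta>>0. \<forall>x y. a \<le> x \<and> x \<le> y \<and> y \<le> b \<and> y - x < \<delta> \<longrightarrow>
       \<bar>H y - H x - integral {x..y} f\<bar> \<le> \<epsilon> * integral {x..y} k"
  shows "AC_on a b H f"
  unfolding AC_on_def
proof (intro conjI ballI)
  fix z assume z: "z \<in> {a..b}"
  have fi: "f integrable_on {x..y}" "k integrable_on {x..y}" if "a \<le> x" "y \<le> b" for x y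
    using f k that set_lebesgue_integral_eq_integral(1)
    by (meson atLeastatMost_subset_iff integrable_on_subinterval)+
  have main: "\<bar>H z - H a - integral {a..z} f\<bar> \<le> \<epsilon> * integral {a..z} k" if e: "\<epsilon> > 0" for \<epsilon>
  proof -
    obtain \<delta> where d: "\<delta> > 0" "\<And>x y. a \<le> x \<and> x \<le> y \<and> y \<le> b \<and> y - x < \<delta> \<Longrightarrow>
       \<bar>H y - H x - integral {x..y} f\<bar> \<le> \<epsilon> * integral {x..y} k"
      using loc[OF e] by blast
    define P where "P = (\<lambda>x y. a \<le> x \<and> y \<le> b \<longrightarrow> \<bar>H y - H x - integral {x..y} f\<bar> \<le> \<epsilon> * integral {x..y} k)"
    have "a \<le> z" using z by simp
    then have "P a z"
    proof (induction rule: Bolzano)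
      case (trans x y w)
      show ?case unfolding P_def
      proof
        assume "a \<le> x \<and> w \<le> b"
        then have "\<bar>H y - H x - integral {x..y} f\<bar> \<le> \<epsilon> * integral {x..y} k"
          "\<bar>H w - H y - integral {y..w} f\<bar> \<le> \<epsilon> * integral {y..w} k"
          "integral {x..y} f + integral {y..w} f = integral {x..w} f"
          "integral {x..y} k + integral {y..w} k = integral {x..w} k"
          using trans fi[of x w]
          unfolding P_def by (auto intro!: Henstock_Kurzweil_Integration.integral_combine)
        then show "\<bar>H w - H x - integral {x..w} f\<bar> \<le> \<epsilon> * integral {x..w} k"
          by (smt (verit) distrib_left)
      qed
    next
      case (local x)
      show ?case using d unfolding P_def by (intro exI[of _ \<delta>]) auto
    qed
    then show ?thesis using z by (simp add: P_def)
  qed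
  have "\<bar>H z - H a - integral {a..z} f\<bar> \<le> 0 + e" if "e > 0" for e
  proof -
    \<comment> \<open>Adding 1 makes \<open>K\<close> positive, so that \<open>main\<close> can be
      applied with \<open>e / K\<close>.\<close>
    define K where "K = \<bar>integral {a..z} k\<bar> + 1"
    have "K > 0" by (simp add: K_def)
    have "\<bar>H z - H a - integral {a..z} f\<bar> \<le> (e / K) * integral {a..z} k"
      using that \<open>K > 0\<close> by (intro main) auto
    also have "\<dots> \<le> (e / K) * K"
      using that \<open>K > 0\<close> by (intro mult_left_mono) (auto simp: K_def)
    finally show ?thesis using \<open>K > 0\<close> by simp
  qed
  hence "\<bar>H z - H a - integral {a..z} f\<bar> \<le> 0"
    using field_le_epsilon by blast
  then show "H z = H a + integral {a..z} f" by simp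
qed (rule f)

lemma absolutely_integrable_continuous_mult:
  fixes f g :: "real \<Rightarrow> real"
  assumes "f absolutely_integrable_on {a..b}" "continuous_on {a..b} g"
  shows "(\<lambda>x. f x * g x) absolutely_integrable_on {a..b}" "(\<lambda>x. g x * f x) absolutely_integrable_on {a..b}"
proof -
  have "bounded (g ` {a..b})"
    by (intro compact_imp_bounded compact_continuous_image assms) auto
  moreover have "g \<in> borel_measurable (lebesgue_on {a..b})"
    by (intro continuous_imp_measurable_on_sets_lebesgue assms) auto
  ultimately have "(\<lambda>x. g x * f x) absolutely_integrable_on {a..b}"
    by (intro absolutely_integrable_bounded_measurable_product_real assms) auto
  then show "(\<lambda>x. f x * g x) absolutely_integrable_on {a..b}" "(\<lambda>x. g x * f x) absolutely_integrable_on {a..b}"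
    by (auto simp: mult.commute)
qed

lemma uniformly_continuous_on_interval:
  fixes F :: "real \<Rightarrow> real"
  assumes "continuous_on {a..b} F" "\<epsilon> > 0"
  obtains \<delta> where "\<delta> > 0" "\<And>s t. s \<in> {a..b} \<Longrightarrow> t \<in> {a..b} \<Longrightarrow> \<bar>s - t\<bar> < \<delta> \<Longrightarrow> \<bar>F s - F t\<bar> < \<epsilon>"
  using compact_uniformly_continuous[OF assms(1) compact_Icc] assms(2)
  unfolding uniformly_continuous_on_def dist_real_def by metis

lemma abs_integral_le:
  fixes f k :: "real \<Rightarrow> real"
  assumes "f absolutely_integrable_on S" "k absolutely_integrable_on S" "\<And>t. t \<in> S \<Longrightarrow> \<bar>f t\<bar> \<le> k t"
  shows "\<bar>integral S f\<bar> \<le> integral S k"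
  using integral_norm_bound_integral[of f S k] assms set_lebesgue_integral_eq_integral(1) by auto

lemma absolutely_integrable_abs_real:
  fixes f :: "real \<Rightarrow> real"
  shows "f absolutely_integrable_on S \<Longrightarrow> (\<lambda>t. \<bar>f t\<bar>) absolutely_integrable_on S"
  using absolutely_integrable_norm[where f = f] by (simp add: comp_def)

text \<open>On a short interval the increment of the product is exactly
  \<open>G y * (F y - F x) + F x * (G y - G x)\<close>. Replacing \<open>G t\<close> and
  \<open>F t\<close> in the density by these frozen endpoint values costs at most \<epsilon> times
  \<open>\<bar>f t\<bar> + \<bar>g t\<bar>\<close>, by uniform continuity.\<close>

lemma AC_on_mult:
  assumes F: "AC_on a b F f" and G: "AC_on a b G g"
  shows "AC_on a b (\<lambda>x. F x * G x) (\<lambda>x. f x * G x + F x * g x)"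
proof (rule AC_on_criterion[where k = "\<lambda>x. \<bar>f x\<bar> + \<bar>g x\<bar>"])
  note cF = AC_on_continuous[OF F] and cG = AC_on_continuous[OF G]
  note fi = AC_onD(1)[OF F] and gi = AC_onD(1)[OF G]
  show i1: "(\<lambda>x. f x * G x + F x * g x) absolutely_integrable_on {a..b}"
    by (intro set_integral_add absolutely_integrable_continuous_mult cF cG fi gi)
  show i2: "(\<lambda>x. \<bar>f x\<bar> + \<bar>g x\<bar>) absolutely_integrable_on {a..b}"
    by (intro set_integral_add absolutely_integrable_abs_real fi gi)
  fix \<epsilon> :: real assume e: "\<epsilon> > 0"
  obtain d1 where d1: "d1 > 0" "\<And>s t. s \<in> {a..b} \<Longrightarrow> t \<in> {a..b} \<Longrightarrow> \<bar>s - t\<bar> < d1 \<Longrightarrow> \<bar>F s - F t\<bar> < \<epsilon>"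
    using uniformly_continuous_on_interval[OF cF e] by blast
  obtain d2 where d2: "d2 > 0" "\<And>s t. s \<in> {a..b} \<Longrightarrow> t \<in> {a..b} \<Longrightarrow> \<bar>s - t\<bar> < d2 \<Longrightarrow> \<bar>G s - G t\<bar> < \<epsilon>"
    using uniformly_continuous_on_interval[OF cG e] by blast
  have "\<bar>F y * G y - F x * G x - integral {x..y} (\<lambda>t. f t * G t + F t * g t)\<bar>
      \<le> \<epsilon> * integral {x..y} (\<lambda>t. \<bar>f t\<bar> + \<bar>g t\<bar>)"
    if xy: "a \<le> x" "x \<le> y" "y \<le> b" "y - x < min d1 d2" for x y
  proof -
    have sub: "{x..y} \<subseteq> {a..b}" using xy by auto
    have sl: "{x..y} \<in> sets lebesgue" by auto
    note ai = set_integrable_subset[OF _ sl sub]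
    have fi': "f absolutely_integrable_on {x..y}" and gi': "g absolutely_integrable_on {x..y}"
      and i1': "(\<lambda>x. f x * G x + F x * g x) absolutely_integrable_on {x..y}"
      and i2': "(\<lambda>x. \<bar>f x\<bar> + \<bar>g x\<bar>) absolutely_integrable_on {x..y}"
      using ai fi gi i1 i2 by blast+
    have m: "(\<lambda>t. G y * f t + F x * g t) absolutely_integrable_on {x..y}"
      using fi' gi' by (intro set_integral_add set_integrable_mult_right) auto
    have "F y * G y - F x * G x = G y * (F y - F x) + F x * (G y - G x)"
      by (simp add: algebra_simps)
    also have "\<dots> = G y * integral {x..y} f + F x * integral {x..y} g"
      using AC_on_increment[OF F] AC_on_increment[OF G] xy by auto
    also have "\<dots> = integral {x..y} (\<lambda>t. G y * f t + F x * g t)"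
      using fi' gi' set_lebesgue_integral_eq_integral(1)
      by (subst Henstock_Kurzweil_Integration.integral_add) auto
    finally have "F y * G y - F x * G x - integral {x..y} (\<lambda>t. f t * G t + F t * g t)
      = integral {x..y} (\<lambda>t. (G y * f t + F x * g t) - (f t * G t + F t * g t))"
      using m i1' set_lebesgue_integral_eq_integral(1)
      by (subst Henstock_Kurzweil_Integration.integral_diff) auto
    also have "\<bar>\<dots>\<bar> \<le> integral {x..y} (\<lambda>t. \<epsilon> * (\<bar>f t\<bar> + \<bar>g t\<bar>))"
    proof (rule abs_integral_le)
      fix t assume t: "t \<in> {x..y}"
      have "(G y * f t + F x * g t) - (f t * G t + F t * g t) = (G y - G t) * f t + (F x - F t) * g t"
        by (simp add: algebra_simps)
      also have "\<bar>\<dots>\<bar> \<le> \<bar>G y - G t\<bar> * \<bar>f t\<bar> + \<bar>F x - F t\<bar> * \<bar>g t\<bar>"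
        by (metis abs_mult abs_triangle_ineq)
      also have "\<dots> \<le> \<epsilon> * \<bar>f t\<bar> + \<epsilon> * \<bar>g t\<bar>"
        using d1(2)[of x t] d2(2)[of y t] t xy by (intro add_mono mult_right_mono) auto
      finally show "\<bar>(G y * f t + F x * g t) - (f t * G t + F t * g t)\<bar> \<le> \<epsilon> * (\<bar>f t\<bar> + \<bar>g t\<bar>)"
        by (simp add: algebra_simps)
    qed (use m i1' i2' in auto)
    finally show ?thesis by simp
  qed
  then show "\<exists>\<delta>>0. \<forall>x y. a \<le> x \<and> x \<le> y \<and> y \<le> b \<and> y - x < \<delta> \<longrightarrow>
    \<bar>F y * G y - F x * G x - integral {x..y} (\<lambda>t. f t * G t + F t * g t)\<bar>
      \<le> \<epsilon> * integral {x..y} (\<lambda>t. \<bar>f t\<bar> + \<bar>g t\<bar>)"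
    using d1(1) d2(1) by (intro exI[of _ "min d1 d2"]) auto
qed

text \<open>The mean value theorem gives \<open>\<phi> (F y) - \<phi> (F x) = \<phi>' (F \<xi>) * (F
  y - F x)\<close>, and on a short interval \<open>\<phi>' (F t)\<close> is uniformly close to
  \<open>\<phi>' (F \<xi>)\<close>. The derivative is assumed on the range of \<open>F\<close>
  alone, which admits roots and reciprocals of positive functions.\<close>

lemma AC_on_compose:
  assumes F: "AC_on a b F f"
    and der: "\<And>y. y \<in> F ` {a..b} \<Longrightarrow> (\<phi> has_real_derivative \<phi>' y) (at y)"
    and cont: "continuous_on (F ` {a..b}) \<phi>'"
  shows "AC_on a b (\<lambda>x. \<phi> (F x)) (\<lambda>x. \<phi>' (F x) * f x)"
proof (rule AC_on_criterion[where k = "\<lambda>x. \<bar>f x\<bar>"])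
  note cF = AC_on_continuous[OF F] and fi = AC_onD(1)[OF F]
  have cP: "continuous_on {a..b} (\<lambda>x. \<phi>' (F x))"
    by (rule continuous_on_compose2[OF cont cF]) auto
  show i1: "(\<lambda>x. \<phi>' (F x) * f x) absolutely_integrable_on {a..b}"
    by (intro absolutely_integrable_continuous_mult cP fi)
  show i2: "(\<lambda>x. \<bar>f x\<bar>) absolutely_integrable_on {a..b}"
    by (intro absolutely_integrable_abs_real fi)
  fix \<epsilon> :: real assume e: "\<epsilon> > 0"
  obtain d where d: "d > 0" "\<And>s t. s \<in> {a..b} \<Longrightarrow> t \<in> {a..b} \<Longrightarrow> \<bar>s - t\<bar> < d \<Longrightarrow> \<bar>\<phi>' (F s) - \<phi>' (F t)\<bar> < \<epsilon>"
    using uniformly_continuous_on_interval[OF cP e] by blast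
  have "\<bar>\<phi> (F y) - \<phi> (F x) - integral {x..y} (\<lambda>t. \<phi>' (F t) * f t)\<bar> \<le> \<epsilon> * integral {x..y} (\<lambda>t. \<bar>f t\<bar>)"
    if xy: "a \<le> x" "x \<le> y" "y \<le> b" "y - x < d" for x y
  proof -
    have sub: "{x..y} \<subseteq> {a..b}" using xy by auto
    have sl: "{x..y} \<in> sets lebesgue" by auto
    note ai = set_integrable_subset[OF _ sl sub]
    have fi': "f absolutely_integrable_on {x..y}"
      and i1': "(\<lambda>x. \<phi>' (F x) * f x) absolutely_integrable_on {x..y}"
      and i2': "(\<lambda>x. \<bar>f x\<bar>) absolutely_integrable_on {x..y}"
      using ai fi i1 i2 by blast+
    have conn: "connected (F ` {x..y})"
      by (intro connected_continuous_image continuous_on_subset[OF cF sub]) auto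
    \<comment> \<open>The image of \<open>{x..y}\<close> is connected, so every value between
      \<open>F x\<close> and \<open>F y\<close> is attained. Hence \<phi> is differentiable in
      between, and the mean value point is some \<open>F \<xi>\<close>.\<close>
    have ivl: "{min (F x) (F y)..max (F x) (F y)} \<subseteq> F ` {x..y}"
      using connected_contains_Icc[OF conn, of "F x" "F y"]
        connected_contains_Icc[OF conn, of "F y" "F x"] xy by (auto simp: min_def max_def)
    have "\<exists>\<xi>\<in>{x..y}. \<phi> (F y) - \<phi> (F x) = \<phi>' (F \<xi>) * (F y - F x)"
    proof (cases "F x = F y")
      case True
      then show ?thesis using xy by (intro bexI[of _ x]) auto
    next
      case False
      define lo hi where "lo = min (F x) (F y)" and "hi = max (F x) (F y)"
      have "lo < hi" using False by (auto simp: lo_def hi_def)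
      moreover have "(\<phi> has_real_derivative \<phi>' y) (at y)" if "lo \<le> y" "y \<le> hi" for y
        using that ivl sub by (intro der) (auto simp: lo_def hi_def)
      ultimately obtain z where z: "lo < z" "z < hi" "\<phi> hi - \<phi> lo = (hi - lo) * \<phi>' z"
        using MVT2[of lo hi \<phi> \<phi>'] by blast
      then have "z \<in> F ` {x..y}" using ivl by (auto simp: lo_def hi_def)
      then obtain \<xi> where "\<xi> \<in> {x..y}" "z = F \<xi>" by blast
      then show ?thesis
        using z(3) False by (intro bexI[of _ \<xi>]) (auto simp: lo_def hi_def min_def max_def algebra_simps split: if_splits)
    qed
    then obtain \<xi> where xi: "\<xi> \<in> {x..y}" "\<phi> (F y) - \<phi> (F x) = \<phi>' (F \<xi>) * (F y - F x)" by blast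
    have "\<phi> (F y) - \<phi> (F x) - integral {x..y} (\<lambda>t. \<phi>' (F t) * f t)
       = integral {x..y} (\<lambda>t. \<phi>' (F \<xi>) * f t) - integral {x..y} (\<lambda>t. \<phi>' (F t) * f t)"
      using xi(2) AC_on_increment[OF F xy(1-3)] by simp
    also have "\<dots> = integral {x..y} (\<lambda>t. \<phi>' (F \<xi>) * f t - \<phi>' (F t) * f t)"
      using fi' i1' set_lebesgue_integral_eq_integral(1)
      by (subst Henstock_Kurzweil_Integration.integral_diff) auto
    also have "\<bar>\<dots>\<bar> \<le> integral {x..y} (\<lambda>t. \<epsilon> * \<bar>f t\<bar>)"
    proof (rule abs_integral_le)
      fix t assume t: "t \<in> {x..y}"
      have "\<bar>\<phi>' (F \<xi>) * f t - \<phi>' (F t) * f t\<bar> = \<bar>\<phi>' (F \<xi>) - \<phi>' (F t)\<bar> * \<bar>f t\<bar>"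
        by (simp add: abs_mult left_diff_distrib flip: abs_mult)
      also have "\<dots> \<le> \<epsilon> * \<bar>f t\<bar>"
        using d(2)[of \<xi> t] t xi(1) xy by (intro mult_right_mono) (auto simp: abs_less_iff)
      finally show "\<bar>\<phi>' (F \<xi>) * f t - \<phi>' (F t) * f t\<bar> \<le> \<epsilon> * \<bar>f t\<bar>" .
    qed (use fi' i1' i2' in \<open>auto intro!: set_integral_diff(1)\<close>)
    finally show ?thesis by simp
  qed
  then show "\<exists>\<delta>>0. \<forall>x y. a \<le> x \<and> x \<le> y \<and> y \<le> b \<and> y - x < \<delta> \<longrightarrow>
    \<bar>\<phi> (F y) - \<phi> (F x) - integral {x..y} (\<lambda>t. \<phi>' (F t) * f t)\<bar> \<le> \<epsilon> * integral {x..y} (\<lambda>t. \<bar>f t\<bar>)"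
    using d(1) by (intro exI[of _ d]) auto
qed

section \<open>Integral estimates and Gronwall's inequality\<close>

lemma AC_on_increment_le:
  assumes "AC_on a b F f" "m absolutely_integrable_on {a..b}" "x \<in> {a..b}" "\<And>t. t \<in> {a..x} \<Longrightarrow> f t \<le> m t"
  shows "F x - F a \<le> integral {a..x} m"
proof -
  have "m integrable_on {a..b}" using assms(2) set_lebesgue_integral_eq_integral(1) by blast
  moreover have "{a..x} \<subseteq> {a..b}" using assms(3) by auto
  ultimately have "m integrable_on {a..x}" "f integrable_on {a..x}"
    using AC_onD(2)[OF assms(1)] integrable_on_subinterval by blast+
  then show ?thesis
    using integral_le[of f "{a..x}" m] AC_onD(3)[OF assms(1,3)] assms(4) by auto
qed

lemma integral_initial_segment_le:
  fixes m :: "real \<Rightarrow> real"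
  assumes "m absolutely_integrable_on {a..b}" "x \<in> {a..b}" "\<And>t. t \<in> {a..b} \<Longrightarrow> 0 \<le> m t"
  shows "integral {a..x} m \<le> integral {a..b} m" "0 \<le> integral {a..x} m"
proof -
  have "m integrable_on {a..b}" using assms(1) set_lebesgue_integral_eq_integral(1) by blast
  moreover have "{a..x} \<subseteq> {a..b}" using assms(2) by auto
  ultimately have "m integrable_on {a..x}" using integrable_on_subinterval by blast
  then show "integral {a..x} m \<le> integral {a..b} m" "0 \<le> integral {a..x} m"
    using integral_subset_le[OF \<open>{a..x} \<subseteq> {a..b}\<close> _ \<open>m integrable_on {a..b}\<close>] assms
    by (auto intro!: Henstock_Kurzweil_Integration.integral_nonneg)
qed

lemma AC_on_abs_increment_le:
  assumes "AC_on a b F f" "m absolutely_integrable_on {a..b}" "x \<in> {a..b}" "\<And>t. t \<in> {a..b} \<Longrightarrow> \<bar>f t\<bar> \<le> m t"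
  shows "\<bar>F x - F a\<bar> \<le> integral {a..b} m"
proof -
  have "F x - F a \<le> integral {a..x} m"
    using assms(3,4) by (intro AC_on_increment_le[OF assms(1-3)]) (fastforce simp: abs_le_iff)
  moreover have "(- F x) - (- F a) \<le> integral {a..x} m"
    using assms(3,4) AC_on_cmult[OF assms(1), of "-1"]
    by (intro AC_on_increment_le[OF _ assms(2,3)]) (fastforce simp: abs_le_iff)+
  moreover have "0 \<le> m t" if "t \<in> {a..b}" for t using assms(4)[OF that] by linarith
  ultimately show ?thesis
    using integral_initial_segment_le(1)[OF assms(2,3)] by fastforce
qed

text \<open>With \<open>K\<close> the indefinite integral of \<open>k\<close>, the integrating
  factor \<open>exp (- K x)\<close> absorbs the term \<open>k t * E t\<close>. The remaining
  \<open>m t * exp (- K t)\<close> is at most \<open>m t\<close>, because \<open>K\<close> is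
  nonnegative.\<close>

lemma AC_on_gronwall:
  assumes E: "AC_on a b E e" and k: "k absolutely_integrable_on {a..b}" and m: "m absolutely_integrable_on {a..b}"
    and pos: "\<And>t. t \<in> {a..b} \<Longrightarrow> 0 \<le> k t" "\<And>t. t \<in> {a..b} \<Longrightarrow> 0 \<le> m t"
    and le: "\<And>t. t \<in> {a..b} \<Longrightarrow> e t \<le> k t * E t + m t"
    and x: "x \<in> {a..b}" and Ea: "0 \<le> E a"
  shows "E x \<le> (E a + integral {a..b} m) * exp (integral {a..b} k)"
proof -
  define K where "K = (\<lambda>x. integral {a..x} k)"
  have "AC_on a b K k" unfolding K_def by (rule AC_on_integral[OF k])
  then have "AC_on a b (\<lambda>x. -1 * K x) (\<lambda>x. -1 * k x)" by (rule AC_on_cmult)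
  then have "AC_on a b (\<lambda>x. exp (-1 * K x)) (\<lambda>x. exp (-1 * K x) * (-1 * k x))"
    by (rule AC_on_compose) (simp_all add: DERIV_exp continuous_on_exp)
  from AC_on_mult[OF E this]
  have AC: "AC_on a b (\<lambda>x. E x * exp (-1 * K x)) (\<lambda>x. e x * exp (-1 * K x) + E x * (exp (-1 * K x) * (-1 * k x)))" .
  have "E x * exp (-1 * K x) - E a * exp (-1 * K a) \<le> integral {a..x} m"
  proof (rule AC_on_increment_le[OF AC m x])
    fix t assume t: "t \<in> {a..x}"
    then have t': "t \<in> {a..b}" using x by auto
    have "e t * exp (-1 * K t) + E t * (exp (-1 * K t) * (-1 * k t)) = (e t - k t * E t) * exp (- K t)"
      by (simp add: algebra_simps)
    also have "\<dots> \<le> m t * exp (- K t)"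
      using le[OF t'] by (intro mult_right_mono) auto
    also have "\<dots> \<le> m t * 1"
      using pos[OF t'] integral_initial_segment_le(2)[OF k t' pos(1)]
      by (intro mult_left_mono) (auto simp: K_def)
    finally show "e t * exp (-1 * K t) + E t * (exp (-1 * K t) * (-1 * k t)) \<le> m t" by simp
  qed
  moreover have "K a = 0" by (simp add: K_def)
  ultimately have 1: "E x * exp (- K x) \<le> E a + integral {a..b} m"
    using integral_initial_segment_le(1)[OF m x pos(2)] by simp
  have "E x = (E x * exp (- K x)) * exp (K x)" by (simp add: exp_minus field_simps)
  also have "\<dots> \<le> (E a + integral {a..b} m) * exp (K x)"
    using 1 by (intro mult_right_mono) auto
  also have "\<dots> \<le> (E a + integral {a..b} m) * exp (integral {a..b} k)"
    using integral_initial_segment_le[OF k x pos(1)] Ea integral_initial_segment_le[OF m x pos(2)]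
    by (intro mult_left_mono) (auto simp: K_def)
  finally show ?thesis .
qed

section \<open>Linear Caratheodory systems\<close>

text \<open>With \<open>K\<close> the indefinite integral of \<open>k\<close>, the integrand is the
  density of \<open>exp (2 * K) / 2\<close>. This computes the contraction factor in the existence
  proof below.\<close>

lemma integral_weighted_exp:
  fixes k :: "real \<Rightarrow> real"
  assumes k: "k absolutely_integrable_on {a..b}" and x: "x \<in> {a..b}"
  shows "integral {a..x} (\<lambda>t. exp (2 * integral {a..t} k) * k t) = (exp (2 * integral {a..x} k) - 1) / 2"
proof -
  have "AC_on a b (\<lambda>x. integral {a..x} k) k" by (rule AC_on_integral[OF k])
  then have "AC_on a b (\<lambda>x. exp (2 * integral {a..x} k) / 2) (\<lambda>x. exp (2 * integral {a..x} k) * k x)"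
    by (rule AC_on_compose[where \<phi> = "\<lambda>y. exp (2 * y) / 2" and \<phi>' = "\<lambda>y. exp (2 * y)"])
      (auto intro!: derivative_eq_intros continuous_intros)
  from AC_onD(3)[OF this x] show ?thesis by (simp add: field_simps)
qed

text \<open>Picard iteration in a weighted supremum norm: the integral equations are written for
  \<open>(u, w)\<close> divided by a growing exponential \<open>e\<close>. The weight makes the
  operator a contraction on the whole interval at once, whatever the size of the
  coefficients.\<close>

lemma linear_system_exists:
  fixes p c :: "real \<Rightarrow> real"
  assumes p: "p absolutely_integrable_on {a..b}" and c: "c absolutely_integrable_on {a..b}" and ab: "a \<le> b"
  obtains u w where "AC_on a b u (\<lambda>t. p t * w t)" "AC_on a b w (\<lambda>t. c t * u t)" "u a = u0" "w a = w0"
proof -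
  define k where "k = (\<lambda>t. \<bar>p t\<bar> + \<bar>c t\<bar>)"
  have k: "k absolutely_integrable_on {a..b}"
    unfolding k_def by (intro set_integral_add absolutely_integrable_abs_real p c)
  \<comment> \<open>The factor 2 in the exponent makes the integral of \<open>e * k\<close> at most
    \<open>e / 2\<close>, hence the contraction factor 1/2.\<close>
  define e where "e = (\<lambda>x. exp (2 * integral {a..x} k))"
  have e_pos: "e x > 0" for x by (simp add: e_def)
  have ce: "continuous_on {a..b} e"
    unfolding e_def using AC_on_continuous[OF AC_on_integral[OF k]] by (intro continuous_intros)
  define J1 where "J1 = (\<lambda>(y::real \<Rightarrow>\<^sub>C (real \<times> real)) x. u0 + integral {a..x} (\<lambda>t. p t * (e t * snd (y t))))"
  define J2 where "J2 = (\<lambda>(y::real \<Rightarrow>\<^sub>C (real \<times> real)) x. w0 + integral {a..x} (\<lambda>t. c t * (e t * fst (y t))))"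
  define J where "J = (\<lambda>y x. (J1 y x / e x, J2 y x / e x))"
  have i1: "(\<lambda>t. p t * (e t * snd (y t))) absolutely_integrable_on {a..b}" for y :: "real \<Rightarrow>\<^sub>C (real \<times> real)"
    by (intro absolutely_integrable_continuous_mult p continuous_intros ce) auto
  have i2: "(\<lambda>t. c t * (e t * fst (y t))) absolutely_integrable_on {a..b}" for y :: "real \<Rightarrow>\<^sub>C (real \<times> real)"
    by (intro absolutely_integrable_continuous_mult c continuous_intros ce) auto
  have AC1: "AC_on a b (J1 y) (\<lambda>t. p t * (e t * snd (y t)))" for y
    using AC_on_add[OF AC_on_const AC_on_integral[OF i1], of u0 y] by (simp add: J1_def)
  have AC2: "AC_on a b (J2 y) (\<lambda>t. c t * (e t * fst (y t)))" for y
    using AC_on_add[OF AC_on_const AC_on_integral[OF i2], of w0 y] by (simp add: J2_def)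
  have cJ: "continuous_on {a..b} (J y)" for y
    unfolding J_def using e_pos
    by (intro continuous_intros AC_on_continuous[OF AC1] AC_on_continuous[OF AC2] ce) (auto simp: less_imp_neq[symmetric])
  \<comment> \<open>Clamping to \<open>{a..b}\<close> extends \<open>J y\<close> to a bounded
    continuous function on the whole line, so Banach's fixed point theorem applies in the complete
    type of such functions.\<close>
  define cl where "cl = (\<lambda>x. max a (min b x))"
  have cl: "cl x \<in> {a..b}" for x using ab by (auto simp: cl_def)
  have cl_id: "cl x = x" if "x \<in> {a..b}" for x using that by (auto simp: cl_def)
  have ccl: "continuous_on UNIV cl" unfolding cl_def by (intro continuous_intros)
  have bc: "(\<lambda>x. J y (cl x)) \<in> bcontfun" for y
  proof -
    have "continuous_on UNIV (\<lambda>x. J y (cl x))"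
      by (rule continuous_on_compose2[OF cJ ccl]) (use cl in auto)
    moreover have "bounded (J y ` {a..b})"
      by (intro compact_imp_bounded compact_continuous_image cJ) auto
    then have "bounded (range (\<lambda>x. J y (cl x)))"
      by (rule bounded_subset) (use cl in auto)
    ultimately show ?thesis by (auto simp: bcontfun_def)
  qed
  define T where "T = (\<lambda>y. Bcontfun (\<lambda>x. J y (cl x)))"
  have T: "apply_bcontfun (T y) x = J y (cl x)" for y x
    using bc by (simp add: T_def Bcontfun_inverse)
  have lip: "dist (T y) (T z) \<le> (1/2) * dist y z" for y z
  proof (rule dist_bound)
    fix x0
    define x where "x = cl x0"
    have x: "x \<in> {a..b}" unfolding x_def by (rule cl)
    define D where "D = dist y z"
    have D: "\<bar>fst (y t) - fst (z t)\<bar> \<le> D" "\<bar>snd (y t) - snd (z t)\<bar> \<le> D" for t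
    proof -
      have "dist (y t) (z t) \<le> D" unfolding D_def by (rule dist_bounded)
      then show "\<bar>fst (y t) - fst (z t)\<bar> \<le> D" "\<bar>snd (y t) - snd (z t)\<bar> \<le> D"
        using dist_fst_le[of "y t" "z t"] dist_snd_le[of "y t" "z t"] by (auto simp: dist_real_def)
    qed
    have D0: "D \<ge> 0" by (simp add: D_def)
    have pe: "(\<lambda>t. D * (e t * \<bar>p t\<bar>)) absolutely_integrable_on {a..b}"
      and ce': "(\<lambda>t. D * (e t * \<bar>c t\<bar>)) absolutely_integrable_on {a..b}"
      by (intro set_integrable_mult_right absolutely_integrable_continuous_mult absolutely_integrable_abs_real p c ce)+
    have sub: "{a..x} \<subseteq> {a..b}" "{a..x} \<in> sets lebesgue" using x by auto
    note ai = set_integrable_subset[OF _ sub(2) sub(1)]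
    have d1: "\<bar>J1 y x - J1 z x\<bar> \<le> integral {a..x} (\<lambda>t. D * (e t * \<bar>p t\<bar>))"
    proof -
      have "J1 y x - J1 z x = integral {a..x} (\<lambda>t. p t * (e t * snd (y t)) - p t * (e t * snd (z t)))"
        unfolding J1_def using ai[OF i1] set_lebesgue_integral_eq_integral(1)
        by (subst Henstock_Kurzweil_Integration.integral_diff) auto
      also have "\<bar>\<dots>\<bar> \<le> integral {a..x} (\<lambda>t. D * (e t * \<bar>p t\<bar>))"
      proof (rule abs_integral_le)
        fix t
        have "\<bar>p t * (e t * snd (y t)) - p t * (e t * snd (z t))\<bar> = (e t * \<bar>p t\<bar>) * \<bar>snd (y t) - snd (z t)\<bar>"
          using e_pos[of t] by (simp add: abs_mult flip: right_diff_distrib)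
        also have "\<dots> \<le> (e t * \<bar>p t\<bar>) * D"
          using e_pos[of t] by (intro mult_left_mono D) auto
        finally show "\<bar>p t * (e t * snd (y t)) - p t * (e t * snd (z t))\<bar> \<le> D * (e t * \<bar>p t\<bar>)" by (simp add: mult.commute)
      qed (intro set_integral_diff ai i1 pe)+
      finally show ?thesis .
    qed
    have d2: "\<bar>J2 y x - J2 z x\<bar> \<le> integral {a..x} (\<lambda>t. D * (e t * \<bar>c t\<bar>))"
    proof -
      have "J2 y x - J2 z x = integral {a..x} (\<lambda>t. c t * (e t * fst (y t)) - c t * (e t * fst (z t)))"
        unfolding J2_def using ai[OF i2] set_lebesgue_integral_eq_integral(1)
        by (subst Henstock_Kurzweil_Integration.integral_diff) auto
      also have "\<bar>\<dots>\<bar> \<le> integral {a..x} (\<lambda>t. D * (e t * \<bar>c t\<bar>))"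
      proof (rule abs_integral_le)
        fix t
        have "\<bar>c t * (e t * fst (y t)) - c t * (e t * fst (z t))\<bar> = (e t * \<bar>c t\<bar>) * \<bar>fst (y t) - fst (z t)\<bar>"
          using e_pos[of t] by (simp add: abs_mult flip: right_diff_distrib)
        also have "\<dots> \<le> (e t * \<bar>c t\<bar>) * D"
          using e_pos[of t] by (intro mult_left_mono D) auto
        finally show "\<bar>c t * (e t * fst (y t)) - c t * (e t * fst (z t))\<bar> \<le> D * (e t * \<bar>c t\<bar>)" by (simp add: mult.commute)
      qed (intro set_integral_diff ai i2 ce')+
      finally show ?thesis .
    qed
    have "dist (J y x) (J z x) \<le> \<bar>J1 y x / e x - J1 z x / e x\<bar> + \<bar>J2 y x / e x - J2 z x / e x\<bar>"
      using norm_Pair_le[of "J1 y x / e x - J1 z x / e x" "J2 y x / e x - J2 z x / e x"]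
      by (simp add: J_def dist_norm)
    also have "\<dots> = (\<bar>J1 y x - J1 z x\<bar> + \<bar>J2 y x - J2 z x\<bar>) / e x"
      using e_pos[of x] by (simp add: abs_div add_divide_distrib flip: diff_divide_distrib)
    also have "\<dots> \<le> (integral {a..x} (\<lambda>t. D * (e t * \<bar>p t\<bar>)) + integral {a..x} (\<lambda>t. D * (e t * \<bar>c t\<bar>))) / e x"
      using e_pos[of x] d1 d2 by (intro divide_right_mono) auto
    also have "integral {a..x} (\<lambda>t. D * (e t * \<bar>p t\<bar>)) + integral {a..x} (\<lambda>t. D * (e t * \<bar>c t\<bar>))
        = integral {a..x} (\<lambda>t. D * (e t * \<bar>p t\<bar>) + D * (e t * \<bar>c t\<bar>))"
      using ai[OF pe] ai[OF ce'] set_lebesgue_integral_eq_integral(1)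
      by (subst Henstock_Kurzweil_Integration.integral_add) blast+
    also have "\<dots> = D * integral {a..x} (\<lambda>t. e t * k t)"
      by (simp add: k_def algebra_simps flip: Henstock_Kurzweil_Integration.integral_mult_right)
    also have "\<dots> = D * ((e x - 1) / 2)"
      using integral_weighted_exp[OF k x] by (simp add: e_def)
    also have "D * ((e x - 1) / 2) / e x \<le> 1/2 * D"
    proof -
      have "D * ((e x - 1) / 2) \<le> (1/2 * D) * e x" using D0 by (simp add: algebra_simps)
      then show ?thesis using e_pos[of x] by (simp add: pos_divide_le_eq)
    qed
    finally show "dist (T y x0) (T z x0) \<le> (1/2) * dist y z"
      by (simp add: T x_def D_def)
  qed
  then obtain y where y: "T y = y"
    using banach_fix_type[of "1/2" T] by auto
  define u where "u = (\<lambda>x. e x * fst (y x))"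
  define w where "w = (\<lambda>x. e x * snd (y x))"
  have "u x = J1 y x" "w x = J2 y x" if "x \<in> {a..b}" for x
    using T[of y x] e_pos[of x] unfolding y cl_id[OF that] by (auto simp: J_def u_def w_def)
  then have eq: "J1 y x = u x" "J2 y x = w x" if "x \<in> {a..b}" for x using that by simp_all
  show thesis
  proof
    show "AC_on a b u (\<lambda>t. p t * w t)"
      by (rule AC_on_cong[OF AC1 eq(1)]) (simp_all add: w_def)
    show "AC_on a b w (\<lambda>t. c t * u t)"
      by (rule AC_on_cong[OF AC2 eq(2)]) (simp_all add: u_def)
    show "u a = u0" "w a = w0"
      using eq[of a] ab by (simp_all add: J1_def J2_def)
  qed
qed

section \<open>High-frequency asymptotics\<close>

text \<open>The coefficients that the Liouville transformation leaves: \<open>\<kappa>\<close> is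
  the phase speed, \<open>g\<close> the logarithmic derivative of the amplitude factor,
  \<open>Q\<close> the rescaled potential. The factorisation of \<open>g\<close> into an absolutely
  continuous \<open>G\<close> and the phase speed is what permits an integration by parts against
  the phase.\<close>

locale oscillator =
  fixes a b :: real and \<kappa> g Q G G' :: "real \<Rightarrow> real"
  assumes ab: "a < b"
    and kappa_cont: "continuous_on {a..b} \<kappa>" and kappa_pos: "\<And>x. x \<in> {a..b} \<Longrightarrow> 0 < \<kappa> x"
    and g_cont: "continuous_on {a..b} g"
    and Q_int: "Q absolutely_integrable_on {a..b}"
    and G_AC: "AC_on a b G G'" and g_eq: "\<And>x. x \<in> {a..b} \<Longrightarrow> g x = G x * \<kappa> x"
begin

definition sys :: "real \<Rightarrow> (real \<Rightarrow> real) \<Rightarrow> (real \<Rightarrow> real) \<Rightarrow> bool" where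
  "sys s X Y \<longleftrightarrow> AC_on a b X (\<lambda>t. s * \<kappa> t * Y t + g t * X t) \<and>
     AC_on a b Y (\<lambda>t. - s * \<kappa> t * X t - g t * Y t + Q t / s * X t)"

definition \<tau> :: "real \<Rightarrow> real" where
  "\<tau> x = integral {a..x} \<kappa>"

lemma kappa_int: "\<kappa> absolutely_integrable_on {a..b}"
  by (rule absolutely_integrable_continuous_real[OF kappa_cont])

lemma g_int: "g absolutely_integrable_on {a..b}"
  by (rule absolutely_integrable_continuous_real[OF g_cont])

lemma tau_AC: "AC_on a b \<tau> \<kappa>"
  unfolding \<tau>_def[abs_def] by (rule AC_on_integral[OF kappa_int])

lemma tau_pos: "0 < \<tau> b"
proof -
  obtain c where c: "c \<in> {a..b}" "\<And>x. x \<in> {a..b} \<Longrightarrow> \<kappa> c \<le> \<kappa> x"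
    using continuous_attains_inf[of "{a..b}" \<kappa>] kappa_cont ab by auto
  have "\<kappa> c * (b - a) = integral {a..b} (\<lambda>_. \<kappa> c)" using ab by simp
  also have "\<dots> \<le> \<tau> b" unfolding \<tau>_def
    using c kappa_int set_lebesgue_integral_eq_integral(1) by (intro integral_le) auto
  finally show ?thesis using kappa_pos[OF c(1)] ab
    by (smt (verit) mult_pos_pos)
qed

lemma sys_diff_cmult:
  assumes "sys s X Y" "sys s Z V"
  shows "sys s (\<lambda>t. X t - c * Z t) (\<lambda>t. Y t - c * V t)"
  unfolding sys_def
proof
  show "AC_on a b (\<lambda>t. X t - c * Z t) (\<lambda>t. s * \<kappa> t * (Y t - c * V t) + g t * (X t - c * Z t))"
    by (rule AC_on_cong[OF AC_on_diff[OF _ AC_on_cmult]])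
      (use assms in \<open>auto simp: sys_def algebra_simps\<close>)
  show "AC_on a b (\<lambda>t. Y t - c * V t) (\<lambda>t. - s * \<kappa> t * (X t - c * Z t) - g t * (Y t - c * V t) + Q t / s * (X t - c * Z t))"
    by (rule AC_on_cong[OF AC_on_diff[OF _ AC_on_cmult]])
      (use assms in \<open>auto simp: sys_def algebra_simps\<close>)
qed

lemma sq_sum_AC:
  assumes "AC_on a b X x" "AC_on a b Y y"
  shows "AC_on a b (\<lambda>t. (X t)\<^sup>2 + (Y t)\<^sup>2) (\<lambda>t. 2 * X t * x t + 2 * Y t * y t)"
  by (rule AC_on_cong[OF AC_on_add[OF AC_on_mult[OF assms(1) assms(1)] AC_on_mult[OF assms(2) assms(2)]]])
    (auto simp: power2_eq_square)

text \<open>In the derivative of \<open>X\<^sup>2 + Y\<^sup>2\<close> the terms with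
  \<open>s * \<kappa>\<close> cancel, as they generate a rotation. For \<open>s \<ge> 1\<close> the
  rest is at most \<open>2 * \<bar>g\<bar> + \<bar>Q\<bar>\<close> times the energy, so Gronwall
  gives a constant uniform in \<open>s\<close>.\<close>

lemma energy_bound:
  "\<exists>C\<ge>1. \<forall>s X Y x. s \<ge> 1 \<longrightarrow> sys s X Y \<longrightarrow> x \<in> {a..b} \<longrightarrow> (X x)\<^sup>2 + (Y x)\<^sup>2 \<le> C\<^sup>2 * ((X a)\<^sup>2 + (Y a)\<^sup>2)"
proof -
  define k where "k = (\<lambda>t. 2 * \<bar>g t\<bar> + \<bar>Q t\<bar>)"
  have k: "k absolutely_integrable_on {a..b}"
    unfolding k_def by (intro set_integral_add set_integrable_mult_right absolutely_integrable_abs_real g_int Q_int)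
  have k0: "0 \<le> k t" for t by (simp add: k_def)
  \<comment> \<open>Half of the Gronwall exponent, because \<open>C\<close> enters squared.\<close>
  define C where "C = exp (integral {a..b} k / 2)"
  have C2: "C\<^sup>2 = exp (integral {a..b} k)"
    unfolding C_def power2_eq_square by (simp flip: exp_add)
  have "(X x)\<^sup>2 + (Y x)\<^sup>2 \<le> C\<^sup>2 * ((X a)\<^sup>2 + (Y a)\<^sup>2)"
    if s: "s \<ge> 1" and sys: "sys s X Y" and x: "x \<in> {a..b}" for s X Y x
  proof -
    have "(X x)\<^sup>2 + (Y x)\<^sup>2 \<le> ((X a)\<^sup>2 + (Y a)\<^sup>2 + integral {a..b} (\<lambda>_. 0)) * exp (integral {a..b} k)"
    proof (rule AC_on_gronwall[OF sq_sum_AC _ _ _ _ _ x])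
      show "AC_on a b X (\<lambda>t. s * \<kappa> t * Y t + g t * X t)"
        "AC_on a b Y (\<lambda>t. - s * \<kappa> t * X t - g t * Y t + Q t / s * X t)"
        using sys by (auto simp: sys_def)
      fix t
      have "2 * X t * (s * \<kappa> t * Y t + g t * X t) + 2 * Y t * (- s * \<kappa> t * X t - g t * Y t + Q t / s * X t)
        = 2 * g t * ((X t)\<^sup>2 - (Y t)\<^sup>2) + (Q t / s) * (2 * X t * Y t)"
        by (simp add: algebra_simps power2_eq_square)
      also have "\<dots> \<le> 2 * \<bar>g t\<bar> * ((X t)\<^sup>2 + (Y t)\<^sup>2) + \<bar>Q t\<bar> * ((X t)\<^sup>2 + (Y t)\<^sup>2)"
      proof (rule add_mono)
        have "2 * g t * ((X t)\<^sup>2 - (Y t)\<^sup>2) \<le> \<bar>2 * g t\<bar> * \<bar>(X t)\<^sup>2 - (Y t)\<^sup>2\<bar>"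
          by (metis abs_ge_self abs_mult)
        also have "\<dots> \<le> \<bar>2 * g t\<bar> * ((X t)\<^sup>2 + (Y t)\<^sup>2)"
          by (intro mult_left_mono) (auto simp: abs_le_iff)
        finally show "2 * g t * ((X t)\<^sup>2 - (Y t)\<^sup>2) \<le> 2 * \<bar>g t\<bar> * ((X t)\<^sup>2 + (Y t)\<^sup>2)" by (simp add: abs_mult)
        have "(Q t / s) * (2 * X t * Y t) \<le> \<bar>Q t / s\<bar> * \<bar>2 * X t * Y t\<bar>"
          by (metis abs_ge_self abs_mult)
        also have "\<dots> \<le> \<bar>Q t\<bar> * ((X t)\<^sup>2 + (Y t)\<^sup>2)"
        proof (rule mult_mono)
          show "\<bar>Q t / s\<bar> \<le> \<bar>Q t\<bar>" using s by (simp add: divide_le_eq mult_left_le[of "\<bar>Q t\<bar>"] mult_le_cancel_left1)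
          show "\<bar>2 * X t * Y t\<bar> \<le> (X t)\<^sup>2 + (Y t)\<^sup>2"
            using sum_squares_bound[of "X t" "Y t"] sum_squares_bound[of "X t" "- Y t"] by (auto simp: abs_le_iff)
        qed auto
        finally show "(Q t / s) * (2 * X t * Y t) \<le> \<bar>Q t\<bar> * ((X t)\<^sup>2 + (Y t)\<^sup>2)" .
      qed
      finally show "2 * X t * (s * \<kappa> t * Y t + g t * X t) + 2 * Y t * (- s * \<kappa> t * X t - g t * Y t + Q t / s * X t)
        \<le> k t * ((X t)\<^sup>2 + (Y t)\<^sup>2) + 0" by (simp add: k_def algebra_simps)
    qed (use k k0 in auto)
    then show ?thesis by (simp add: C2 mult.commute)
  qed
  moreover have "C \<ge> 1"
    using integral_initial_segment_le(2)[OF k, of b] ab k0 by (auto simp: C_def)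
  ultimately show ?thesis by blast
qed

text \<open>The initial values are those of sine and cosine at phase 0, with which the solutions are
  compared later.\<close>

definition nsys :: "real \<Rightarrow> (real \<Rightarrow> real) \<Rightarrow> (real \<Rightarrow> real) \<Rightarrow> bool" where
  "nsys s X Y \<longleftrightarrow> s \<ge> 1 \<and> sys s X Y \<and> X a = 0 \<and> Y a = 1"

lemma nsys_bound:
  "\<exists>C\<ge>1. \<forall>s X Y x. nsys s X Y \<longrightarrow> x \<in> {a..b} \<longrightarrow> \<bar>X x\<bar> \<le> C \<and> \<bar>Y x\<bar> \<le> C"
proof -
  obtain C where C: "C \<ge> 1" "\<And>s X Y x. s \<ge> 1 \<Longrightarrow> sys s X Y \<Longrightarrow> x \<in> {a..b} \<Longrightarrow> (X x)\<^sup>2 + (Y x)\<^sup>2 \<le> C\<^sup>2 * ((X a)\<^sup>2 + (Y a)\<^sup>2)"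
    using energy_bound by blast
  have "\<bar>X x\<bar> \<le> C \<and> \<bar>Y x\<bar> \<le> C" if "nsys s X Y" "x \<in> {a..b}" for s X Y x
  proof -
    have "(X x)\<^sup>2 + (Y x)\<^sup>2 \<le> C\<^sup>2" using C(2)[of s X Y x] that by (simp add: nsys_def)
    then have "(X x)\<^sup>2 \<le> C\<^sup>2" "(Y x)\<^sup>2 \<le> C\<^sup>2"
      by (smt (verit) zero_le_power2)+
    then show ?thesis using C(1) by (simp add: abs_le_square_iff[symmetric])
  qed
  then show ?thesis using C(1) by blast
qed

text \<open>The difference of the two solutions satisfies the system for \<open>s\<close> with a
  forcing from the mismatches \<open>s - r\<close> and \<open>1 / s - 1 / r\<close>, both at most
  \<open>\<bar>s - r\<bar>\<close> in size for parameters at least 1. Since the initial values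
  agree, Gronwall leaves only the forcing.\<close>

lemma nsys_lipschitz:
  "\<exists>L>0. \<forall>s r X Y Z V x. nsys s X Y \<longrightarrow> nsys r Z V \<longrightarrow> x \<in> {a..b} \<longrightarrow>
     \<bar>X x - Z x\<bar> \<le> L * \<bar>s - r\<bar> \<and> \<bar>Y x - V x\<bar> \<le> L * \<bar>s - r\<bar>"
proof -
  obtain C where C: "C \<ge> 1" "\<And>s X Y x. nsys s X Y \<Longrightarrow> x \<in> {a..b} \<Longrightarrow> \<bar>X x\<bar> \<le> C \<and> \<bar>Y x\<bar> \<le> C"
    using nsys_bound by blast
  define k where "k = (\<lambda>t. 2 * \<bar>g t\<bar> + 2 * \<bar>Q t\<bar> + \<kappa> t)"
  have k: "k absolutely_integrable_on {a..b}"
    unfolding k_def by (intro set_integral_add set_integrable_mult_right absolutely_integrable_abs_real g_int Q_int kappa_int)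
  have k0: "0 \<le> k t" if "t \<in> {a..b}" for t using kappa_pos[OF that] by (simp add: k_def)
  define m where "m = (\<lambda>t. 2 * \<kappa> t + \<bar>Q t\<bar>)"
  have m: "m absolutely_integrable_on {a..b}"
    unfolding m_def by (intro set_integral_add set_integrable_mult_right absolutely_integrable_abs_real Q_int kappa_int)
  have m0: "0 \<le> m t" if "t \<in> {a..b}" for t using kappa_pos[OF that] by (simp add: m_def)
  have I0: "0 \<le> integral {a..b} m"
    using integral_initial_segment_le(2)[OF m, of b] ab m0 by auto
  \<comment> \<open>The root undoes the squares in the energy; adding 1 turns nonnegativity of the
    radicand into \<open>L > 0\<close>.\<close>
  define L where "L = sqrt (C\<^sup>2 * integral {a..b} m * exp (integral {a..b} k)) + 1"
  have L2: "C\<^sup>2 * integral {a..b} m * exp (integral {a..b} k) \<le> L\<^sup>2"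
  proof -
    have "0 \<le> C\<^sup>2 * integral {a..b} m * exp (integral {a..b} k)" using I0 by auto
    then have "C\<^sup>2 * integral {a..b} m * exp (integral {a..b} k) = (sqrt (C\<^sup>2 * integral {a..b} m * exp (integral {a..b} k)))\<^sup>2" by simp
    also have "\<dots> \<le> L\<^sup>2" unfolding L_def using I0 by (intro power_mono) auto
    finally show ?thesis .
  qed
  have Lpos: "L > 0" unfolding L_def using I0 by (auto intro!: add_nonneg_pos)
  have "\<bar>X x - Z x\<bar> \<le> L * \<bar>s - r\<bar> \<and> \<bar>Y x - V x\<bar> \<le> L * \<bar>s - r\<bar>"
    if sX: "nsys s X Y" and rZ: "nsys r Z V" and x: "x \<in> {a..b}" for s r X Y Z V x
  proof -
    define d where "d = \<bar>s - r\<bar>"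
    have s1: "s \<ge> 1" and r1: "r \<ge> 1" using sX rZ by (auto simp: nsys_def)
    have inv: "\<bar>1 / s - 1 / r\<bar> \<le> d"
    proof -
      have "\<bar>1 / s - 1 / r\<bar> = d / (s * r)"
        using s1 r1 by (simp add: d_def field_simps abs_minus_commute abs_div)
      also have "\<dots> \<le> d / 1" using s1 r1 by (intro divide_left_mono) (auto simp: d_def intro: mult_ge1_I)
      finally show ?thesis by simp
    qed
    define D E where "D = (\<lambda>t. X t - Z t)" and "E = (\<lambda>t. Y t - V t)"
    have D: "AC_on a b D (\<lambda>t. (s * \<kappa> t * Y t + g t * X t) - (r * \<kappa> t * V t + g t * Z t))"
      unfolding D_def by (rule AC_on_diff) (use sX rZ in \<open>auto simp: nsys_def sys_def\<close>)
    have E: "AC_on a b E (\<lambda>t. (- s * \<kappa> t * X t - g t * Y t + Q t / s * X t) - (- r * \<kappa> t * Z t - g t * V t + Q t / r * Z t))"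
      unfolding E_def by (rule AC_on_diff) (use sX rZ in \<open>auto simp: nsys_def sys_def\<close>)
    have dm: "(\<lambda>t. (d\<^sup>2 * C\<^sup>2) * m t) absolutely_integrable_on {a..b}"
      by (intro set_integrable_mult_right m)
    have Da: "D a = 0" and Ea: "E a = 0" using sX rZ by (auto simp: D_def E_def nsys_def)
    have "(D x)\<^sup>2 + (E x)\<^sup>2 \<le> ((D a)\<^sup>2 + (E a)\<^sup>2 + integral {a..b} (\<lambda>t. (d\<^sup>2 * C\<^sup>2) * m t)) * exp (integral {a..b} k)"
    proof (rule AC_on_gronwall[OF sq_sum_AC[OF D E] k dm k0 _ _ x])
      show "0 \<le> (d\<^sup>2 * C\<^sup>2) * m t" if "t \<in> {a..b}" for t using m0[OF that] by auto
      show "0 \<le> (D a)\<^sup>2 + (E a)\<^sup>2" by simp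
      fix t assume t: "t \<in> {a..b}"
      have CZ: "\<bar>Z t\<bar> \<le> C" "\<bar>V t\<bar> \<le> C" using C(2)[OF rZ t] by auto
      note kp = kappa_pos[OF t]
      \<comment> \<open>Regrouped so that the mismatch of parameters multiplies only
        \<open>Z\<close> and \<open>V\<close>, which are bounded by \<open>C\<close>. The inequality
        \<open>2 * u * v \<le> u\<^sup>2 + v\<^sup>2\<close> then separates each forcing term from
        the energy.\<close>
      have "2 * D t * ((s * \<kappa> t * Y t + g t * X t) - (r * \<kappa> t * V t + g t * Z t))
          + 2 * E t * ((- s * \<kappa> t * X t - g t * Y t + Q t / s * X t) - (- r * \<kappa> t * Z t - g t * V t + Q t / r * Z t))
        = 2 * g t * ((D t)\<^sup>2 - (E t)\<^sup>2) + (Q t / s) * (2 * D t * E t)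
          + \<kappa> t * (2 * ((s - r) * V t) * D t) + \<kappa> t * (2 * ((r - s) * Z t) * E t)
          + Q t * (2 * ((1 / s - 1 / r) * Z t) * E t)"
        using s1 r1 unfolding D_def E_def by (simp add: field_simps power2_eq_square)
      also have "\<dots> \<le> 2 * \<bar>g t\<bar> * ((D t)\<^sup>2 + (E t)\<^sup>2) + \<bar>Q t\<bar> * ((D t)\<^sup>2 + (E t)\<^sup>2)
          + \<kappa> t * (d\<^sup>2 * C\<^sup>2 + (D t)\<^sup>2) + \<kappa> t * (d\<^sup>2 * C\<^sup>2 + (E t)\<^sup>2)
          + \<bar>Q t\<bar> * (d\<^sup>2 * C\<^sup>2 + (E t)\<^sup>2)"
      proof (intro add_mono)
        have "2 * g t * ((D t)\<^sup>2 - (E t)\<^sup>2) \<le> \<bar>2 * g t\<bar> * \<bar>(D t)\<^sup>2 - (E t)\<^sup>2\<bar>"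
          by (metis abs_ge_self abs_mult)
        also have "\<dots> \<le> \<bar>2 * g t\<bar> * ((D t)\<^sup>2 + (E t)\<^sup>2)"
          by (intro mult_left_mono) (auto simp: abs_le_iff)
        finally show "2 * g t * ((D t)\<^sup>2 - (E t)\<^sup>2) \<le> 2 * \<bar>g t\<bar> * ((D t)\<^sup>2 + (E t)\<^sup>2)" by (simp add: abs_mult)
        have "(Q t / s) * (2 * D t * E t) \<le> \<bar>Q t / s\<bar> * \<bar>2 * D t * E t\<bar>"
          by (metis abs_ge_self abs_mult)
        also have "\<dots> \<le> \<bar>Q t\<bar> * ((D t)\<^sup>2 + (E t)\<^sup>2)"
        proof (rule mult_mono)
          show "\<bar>Q t / s\<bar> \<le> \<bar>Q t\<bar>" using s1 by (simp add: divide_le_eq mult_left_le[of "\<bar>Q t\<bar>"] mult_le_cancel_left1)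
          show "\<bar>2 * D t * E t\<bar> \<le> (D t)\<^sup>2 + (E t)\<^sup>2"
            using sum_squares_bound[of "D t" "E t"] sum_squares_bound[of "D t" "- E t"] by (auto simp: abs_le_iff)
        qed auto
        finally show "(Q t / s) * (2 * D t * E t) \<le> \<bar>Q t\<bar> * ((D t)\<^sup>2 + (E t)\<^sup>2)" .
        have sq: "(c * z)\<^sup>2 \<le> d\<^sup>2 * C\<^sup>2" if "\<bar>c\<bar> \<le> d" "\<bar>z\<bar> \<le> C" for c z
        proof -
          have "\<bar>c * z\<bar> \<le> d * C" unfolding abs_mult using that by (intro mult_mono) auto
          then have "\<bar>c * z\<bar>\<^sup>2 \<le> (d * C)\<^sup>2" by (intro power_mono) auto
          then show ?thesis by (simp add: power_mult_distrib)
        qed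
        show "\<kappa> t * (2 * ((s - r) * V t) * D t) \<le> \<kappa> t * (d\<^sup>2 * C\<^sup>2 + (D t)\<^sup>2)"
          using kp sum_squares_bound[of "(s - r) * V t" "D t"] sq[OF _ CZ(2), of "s - r"]
          by (intro mult_left_mono) (auto simp: d_def)
        show "\<kappa> t * (2 * ((r - s) * Z t) * E t) \<le> \<kappa> t * (d\<^sup>2 * C\<^sup>2 + (E t)\<^sup>2)"
          using kp sum_squares_bound[of "(r - s) * Z t" "E t"] sq[OF _ CZ(1), of "r - s"]
          by (intro mult_left_mono) (auto simp: d_def abs_minus_commute)
        have "Q t * (2 * ((1 / s - 1 / r) * Z t) * E t) \<le> \<bar>Q t\<bar> * \<bar>2 * ((1 / s - 1 / r) * Z t) * E t\<bar>"
          by (metis abs_ge_self abs_mult)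
        also have "\<dots> \<le> \<bar>Q t\<bar> * (d\<^sup>2 * C\<^sup>2 + (E t)\<^sup>2)"
        proof (intro mult_left_mono)
          have "\<bar>2 * ((1 / s - 1 / r) * Z t) * E t\<bar> \<le> ((1 / s - 1 / r) * Z t)\<^sup>2 + (E t)\<^sup>2"
            using sum_squares_bound[of "(1 / s - 1 / r) * Z t" "E t"] sum_squares_bound[of "(1 / s - 1 / r) * Z t" "- E t"]
            by (auto simp: abs_le_iff)
          then show "\<bar>2 * ((1 / s - 1 / r) * Z t) * E t\<bar> \<le> d\<^sup>2 * C\<^sup>2 + (E t)\<^sup>2"
            using sq[OF inv CZ(1)] by linarith
        qed auto
        finally show "Q t * (2 * ((1 / s - 1 / r) * Z t) * E t) \<le> \<bar>Q t\<bar> * (d\<^sup>2 * C\<^sup>2 + (E t)\<^sup>2)" .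
      qed
      also have "\<dots> \<le> k t * ((D t)\<^sup>2 + (E t)\<^sup>2) + (d\<^sup>2 * C\<^sup>2) * m t"
        by (simp add: k_def m_def algebra_simps)
      finally show "2 * D t * ((s * \<kappa> t * Y t + g t * X t) - (r * \<kappa> t * V t + g t * Z t))
          + 2 * E t * ((- s * \<kappa> t * X t - g t * Y t + Q t / s * X t) - (- r * \<kappa> t * Z t - g t * V t + Q t / r * Z t))
          \<le> k t * ((D t)\<^sup>2 + (E t)\<^sup>2) + (d\<^sup>2 * C\<^sup>2) * m t" .
    qed
    also have "\<dots> = d\<^sup>2 * (C\<^sup>2 * integral {a..b} m * exp (integral {a..b} k))"
      by (simp add: Da Ea)
    also have "\<dots> \<le> d\<^sup>2 * L\<^sup>2" using L2 by (intro mult_left_mono) auto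
    finally have "(D x)\<^sup>2 + (E x)\<^sup>2 \<le> (L * d)\<^sup>2" by (simp add: power_mult_distrib mult.commute)
    then have "(D x)\<^sup>2 \<le> (L * d)\<^sup>2" "(E x)\<^sup>2 \<le> (L * d)\<^sup>2"
      by (smt (verit) zero_le_power2)+
    moreover have "L * d \<ge> 0" using Lpos by (simp add: d_def)
    ultimately have "\<bar>D x\<bar> \<le> L * d" "\<bar>E x\<bar> \<le> L * d"
      using abs_le_square_iff[of "D x" "L * d"] abs_le_square_iff[of "E x" "L * d"] by simp_all
    then show ?thesis by (simp add: D_def E_def d_def)
  qed
  then show ?thesis using Lpos by blast
qed

end

section \<open>Phase asymptotics by one integration by parts\<close>

context oscillator
begin

text \<open>The correction \<open>G R / (2 s)\<close> cancels the only part \<open>g (X cos \<theta> + Y sin \<theta>)\<close> of the derivative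
  that is not \<open>O(1/s)\<close>.\<close>

lemma rotated_AC:
  fixes c :: real
  assumes sys: "sys s X Y" and s: "s \<ge> 1"
  defines "\<theta> \<equiv> \<lambda>t. s * \<tau> t + c"
  defines "R \<equiv> \<lambda>t. X t * sin (\<theta> t) - Y t * cos (\<theta> t)"
  shows "AC_on a b (\<lambda>t. (X t * cos (\<theta> t) - Y t * sin (\<theta> t)) - 1 / (2 * s) * (G t * R t))
    (\<lambda>t. - (Q t / s * X t * sin (\<theta> t)) - 1 / (2 * s) * (G' t * R t
        + G t * (g t * (X t * sin (\<theta> t) + Y t * cos (\<theta> t)) - Q t / s * X t * cos (\<theta> t))))"
proof -
  have X: "AC_on a b X (\<lambda>t. s * \<kappa> t * Y t + g t * X t)"
    and Y: "AC_on a b Y (\<lambda>t. - s * \<kappa> t * X t - g t * Y t + Q t / s * X t)"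
    using sys by (auto simp: sys_def)
  have cos: "AC_on a b (\<lambda>t. cos (\<theta> t)) (\<lambda>t. - sin (\<theta> t) * s * \<kappa> t)"
    unfolding \<theta>_def
    by (rule AC_on_compose[OF tau_AC, of "\<lambda>y. cos (s * y + c)" "\<lambda>y. - sin (s * y + c) * s"])
      (auto intro!: derivative_eq_intros continuous_intros)
  have sin: "AC_on a b (\<lambda>t. sin (\<theta> t)) (\<lambda>t. cos (\<theta> t) * s * \<kappa> t)"
    unfolding \<theta>_def
    by (rule AC_on_compose[OF tau_AC, of "\<lambda>y. sin (s * y + c)" "\<lambda>y. cos (s * y + c) * s"])
      (auto intro!: derivative_eq_intros continuous_intros)
  have R: "AC_on a b R (\<lambda>t. ((s * \<kappa> t * Y t + g t * X t) * sin (\<theta> t) + X t * (cos (\<theta> t) * s * \<kappa> t))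
      - ((- s * \<kappa> t * X t - g t * Y t + Q t / s * X t) * cos (\<theta> t) + Y t * (- sin (\<theta> t) * s * \<kappa> t)))"
    unfolding R_def by (intro AC_on_diff AC_on_mult X Y sin cos)
  note AC = AC_on_diff[OF AC_on_diff[OF AC_on_mult[OF X cos] AC_on_mult[OF Y sin]]
      AC_on_cmult[OF AC_on_mult[OF G_AC R], of "1 / (2 * s)"]]
  show ?thesis
  proof (rule AC_on_cong[OF AC refl])
    fix t assume t: "t \<in> {a..b}"
    show "(s * \<kappa> t * Y t + g t * X t) * cos (\<theta> t) + X t * (- sin (\<theta> t) * s * \<kappa> t)
       - ((- s * \<kappa> t * X t - g t * Y t + Q t / s * X t) * sin (\<theta> t) + Y t * (cos (\<theta> t) * s * \<kappa> t))
       - 1 / (2 * s) * (G' t * R t + G t *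
        ((s * \<kappa> t * Y t + g t * X t) * sin (\<theta> t) + X t * (cos (\<theta> t) * s * \<kappa> t)
         - ((- s * \<kappa> t * X t - g t * Y t + Q t / s * X t) * cos (\<theta> t) + Y t * (- sin (\<theta> t) * s * \<kappa> t))))
      = - (Q t / s * X t * sin (\<theta> t)) - 1 / (2 * s) * (G' t * R t
        + G t * (g t * (X t * sin (\<theta> t) + Y t * cos (\<theta> t)) - Q t / s * X t * cos (\<theta> t)))"
    proof -
      \<comment> \<open>An algebraic identity, with \<open>C\<close>, \<open>S\<close>,
        \<open>q\<close>, \<open>z\<close> standing for cosine, sine, \<open>Q t / s\<close> and
        \<open>G' t * R t\<close>. The derivative of \<open>R\<close> contains
        \<open>2 * s * \<kappa> t * (X t * C + Y t * S)\<close>, and \<open>G t / (2 * s)\<close>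
        times this is exactly the \<open>g\<close> term to be cancelled.\<close>
      have alg: "w * C + X t * (- S * s * \<kappa> t) - (v * S + Y t * (C * s * \<kappa> t))
          - 1 / (2 * s) * (z + G t * (w * S + X t * (C * s * \<kappa> t) - (v * C + Y t * (- S * s * \<kappa> t))))
        = - (q * X t * S) - 1 / (2 * s) * (z + G t * (g t * (X t * S + Y t * C) - q * X t * C))"
        if "w = s * \<kappa> t * Y t + g t * X t" "v = - s * \<kappa> t * X t - g t * Y t + q * X t" for w v z q C S
      proof -
        have "w * S + X t * (C * s * \<kappa> t) - (v * C + Y t * (- S * s * \<kappa> t))
          = 2 * s * (\<kappa> t * (X t * C + Y t * S)) + (g t * (X t * S + Y t * C) - q * X t * C)"
          unfolding that by (simp add: algebra_simps)
        moreover have "1 / (2 * s) * (z + G t * (2 * s * y + y')) = G t * y + 1 / (2 * s) * (z + G t * y')" for y y'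
          using s by (simp add: field_simps)
        moreover have "w * C + X t * (- S * s * \<kappa> t) - (v * S + Y t * (C * s * \<kappa> t))
          = G t * (\<kappa> t * (X t * C + Y t * S)) - q * X t * S"
          unfolding that g_eq[OF t] by (simp add: algebra_simps)
        ultimately show ?thesis by simp
      qed
      show ?thesis by (rule alg) (rule refl)+
    qed
  qed
qed

text \<open>For the corrected quantity of \<open>rotated_AC\<close> both the density and the
  correction are of order \<open>1 / s\<close>, with constants from the uniform bound on
  \<open>X\<close> and \<open>Y\<close>. The estimate is uniform in the phase shift
  \<open>c\<close>, so it covers every component of the rotated vector.\<close>

lemma rotated_increment:
  "\<exists>K>0. \<forall>s X Y c x. nsys s X Y \<longrightarrow> x \<in> {a..b} \<longrightarrow>
     \<bar>(X x * cos (s * \<tau> x + c) - Y x * sin (s * \<tau> x + c)) - (X a * cos (s * \<tau> a + c) - Y a * sin (s * \<tau> a + c))\<bar> \<le> K / s"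
proof -
  obtain C where C: "C \<ge> 1" "\<And>s X Y x. nsys s X Y \<Longrightarrow> x \<in> {a..b} \<Longrightarrow> \<bar>X x\<bar> \<le> C \<and> \<bar>Y x\<bar> \<le> C"
    using nsys_bound by blast
  have cG: "continuous_on {a..b} G" by (rule AC_on_continuous[OF G_AC])
  obtain H where H: "H > 0" "\<And>x. x \<in> {a..b} \<Longrightarrow> \<bar>G x\<bar> \<le> H"
  proof -
    have "bounded (G ` {a..b})" by (intro compact_imp_bounded compact_continuous_image cG) auto
    then show thesis using that unfolding bounded_pos by auto
  qed
  define m where "m = (\<lambda>t. C * (\<bar>Q t\<bar> + \<bar>G' t\<bar> + H * \<bar>g t\<bar> + H * \<bar>Q t\<bar>))"
  have m: "m absolutely_integrable_on {a..b}"
    unfolding m_def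
    by (intro set_integral_add set_integrable_mult_right absolutely_integrable_abs_real g_int Q_int AC_onD(1)[OF G_AC])
  have m0: "0 \<le> m t" for t using C(1) H(1) by (auto simp: m_def intro!: mult_nonneg_nonneg add_nonneg_nonneg)
  have I0: "0 \<le> integral {a..b} m"
    using integral_initial_segment_le(2)[OF m, of b] ab m0 by auto
  \<comment> \<open>The integral of the majorant, plus the correction at the two ends, each at most
    \<open>H * C / s\<close>.\<close>
  define K where "K = integral {a..b} m + 2 * (H * C)"
  have K: "K > 0" unfolding K_def using I0 H(1) C(1) by (intro add_nonneg_pos) auto
  have "\<bar>(X x * cos (s * \<tau> x + c) - Y x * sin (s * \<tau> x + c)) - (X a * cos (s * \<tau> a + c) - Y a * sin (s * \<tau> a + c))\<bar> \<le> K / s"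
    if ns: "nsys s X Y" and x: "x \<in> {a..b}" for s X Y c x
  proof -
    have s: "s \<ge> 1" and sys: "sys s X Y" using ns by (auto simp: nsys_def)
    define \<theta> where "\<theta> = (\<lambda>t. s * \<tau> t + c)"
    define R where "R = (\<lambda>t. X t * sin (\<theta> t) - Y t * cos (\<theta> t))"
    define A where "A = (\<lambda>t. X t * cos (\<theta> t) - Y t * sin (\<theta> t))"
    have trig: "\<bar>z * sin y\<bar> \<le> \<bar>z\<bar>" "\<bar>z * cos y\<bar> \<le> \<bar>z\<bar>" for y z :: real
      by (simp_all add: abs_mult mult_left_le)
    have R: "\<bar>R t\<bar> \<le> 2 * C" if "t \<in> {a..b}" for t
      using C(2)[OF ns that] trig(1)[of "X t" "\<theta> t"] trig(2)[of "Y t" "\<theta> t"] unfolding R_def by linarith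
    have AC: "AC_on a b (\<lambda>t. A t - 1 / (2 * s) * (G t * R t))
    (\<lambda>t. - (Q t / s * X t * sin (\<theta> t)) - 1 / (2 * s) * (G' t * R t
        + G t * (g t * (X t * sin (\<theta> t) + Y t * cos (\<theta> t)) - Q t / s * X t * cos (\<theta> t))))"
      unfolding A_def R_def \<theta>_def by (rule rotated_AC[OF sys s])
    have "\<bar>(A x - 1 / (2 * s) * (G x * R x)) - (A a - 1 / (2 * s) * (G a * R a))\<bar> \<le> integral {a..b} (\<lambda>t. 1 / s * m t)"
    proof (rule AC_on_abs_increment_le[OF AC _ x])
      show "(\<lambda>t. 1 / s * m t) absolutely_integrable_on {a..b}" by (intro set_integrable_mult_right m)
      fix t assume t: "t \<in> {a..b}"
      have CX: "\<bar>X t\<bar> \<le> C" "\<bar>Y t\<bar> \<le> C" using C(2)[OF ns t] by auto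
      have QX: "\<bar>Q t * X t * y\<bar> \<le> \<bar>Q t\<bar> * C" if "\<bar>y\<bar> \<le> 1" for y
      proof -
        have "\<bar>Q t * X t * y\<bar> = \<bar>Q t\<bar> * (\<bar>X t\<bar> * \<bar>y\<bar>)" by (simp add: abs_mult)
        also have "\<dots> \<le> \<bar>Q t\<bar> * (C * 1)" using CX that by (intro mult_left_mono mult_mono) auto
        finally show ?thesis by simp
      qed
      have 1: "\<bar>Q t * X t * sin (\<theta> t)\<bar> \<le> \<bar>Q t\<bar> * C" by (rule QX) simp
      have 2: "\<bar>G' t * R t\<bar> \<le> \<bar>G' t\<bar> * (2 * C)" unfolding abs_mult by (intro mult_left_mono R t) auto
      have 3: "\<bar>g t * (X t * sin (\<theta> t) + Y t * cos (\<theta> t))\<bar> \<le> \<bar>g t\<bar> * (2 * C)"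
        unfolding abs_mult[of "g t"] using CX trig(1)[of "X t" "\<theta> t"] trig(2)[of "Y t" "\<theta> t"]
        by (intro mult_left_mono) linarith+
      have 4: "\<bar>Q t / s * X t * cos (\<theta> t)\<bar> \<le> \<bar>Q t\<bar> * C"
      proof -
        have "\<bar>Q t / s * X t * cos (\<theta> t)\<bar> = \<bar>Q t * X t * cos (\<theta> t)\<bar> / s" using s by (simp add: abs_mult abs_div)
        also have "\<dots> \<le> \<bar>Q t * X t * cos (\<theta> t)\<bar> / 1" using s by (intro divide_left_mono) auto
        also have "\<dots> \<le> \<bar>Q t\<bar> * C" using QX[of "cos (\<theta> t)"] by simp
        finally show ?thesis .
      qed
      have 5: "\<bar>G t * (g t * (X t * sin (\<theta> t) + Y t * cos (\<theta> t)) - Q t / s * X t * cos (\<theta> t))\<bar>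
        \<le> H * (\<bar>g t\<bar> * (2 * C) + \<bar>Q t\<bar> * C)"
        unfolding abs_mult[of "G t"] using H(1) H(2)[OF t] 3 4 by (intro mult_mono) linarith+
      have alg: "\<bar>- (y / s * z * v) - 1 / (2 * s) * w\<bar> \<le> 1 / s * (\<bar>y * z * v\<bar> + 1 / 2 * \<bar>w\<bar>)" for y z v w :: real
      proof -
        have "- (y / s * z * v) - 1 / (2 * s) * w = 1 / s * (- (y * z * v) - 1 / 2 * w)"
          using s by (simp add: field_simps)
        also have "\<bar>\<dots>\<bar> = 1 / s * \<bar>- (y * z * v) - 1 / 2 * w\<bar>"
          using s by (subst abs_mult) simp
        also have "\<dots> \<le> 1 / s * (\<bar>y * z * v\<bar> + 1 / 2 * \<bar>w\<bar>)"
          using s by (intro mult_left_mono) (linarith, simp)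
        finally show ?thesis .
      qed
      have "\<bar>- (Q t / s * X t * sin (\<theta> t)) - 1 / (2 * s) * (G' t * R t
        + G t * (g t * (X t * sin (\<theta> t) + Y t * cos (\<theta> t)) - Q t / s * X t * cos (\<theta> t)))\<bar>
        \<le> 1 / s * (\<bar>Q t * X t * sin (\<theta> t)\<bar> + 1 / 2 * \<bar>G' t * R t
        + G t * (g t * (X t * sin (\<theta> t) + Y t * cos (\<theta> t)) - Q t / s * X t * cos (\<theta> t))\<bar>)"
        by (rule alg)
      also have "\<dots> \<le> 1 / s * (\<bar>Q t\<bar> * C + 1 / 2 * (\<bar>G' t\<bar> * (2 * C) + H * (\<bar>g t\<bar> * (2 * C) + \<bar>Q t\<bar> * C)))"
      proof (intro mult_left_mono add_mono)
        show "\<bar>G' t * R t + G t * (g t * (X t * sin (\<theta> t) + Y t * cos (\<theta> t)) - Q t / s * X t * cos (\<theta> t))\<bar>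
          \<le> \<bar>G' t\<bar> * (2 * C) + H * (\<bar>g t\<bar> * (2 * C) + \<bar>Q t\<bar> * C)"
          by (rule order_trans[OF abs_triangle_ineq add_mono[OF 2 5]])
      qed (use s 1 in auto)
      also have "\<dots> \<le> 1 / s * m t"
      proof (intro mult_left_mono)
        have "0 \<le> H * \<bar>Q t\<bar> * C" using H(1) C(1) by simp
        moreover have "m t - (\<bar>Q t\<bar> * C + 1 / 2 * (\<bar>G' t\<bar> * (2 * C) + H * (\<bar>g t\<bar> * (2 * C) + \<bar>Q t\<bar> * C))) = H * \<bar>Q t\<bar> * C / 2"
          by (simp add: m_def field_simps)
        ultimately show "\<bar>Q t\<bar> * C + 1 / 2 * (\<bar>G' t\<bar> * (2 * C) + H * (\<bar>g t\<bar> * (2 * C) + \<bar>Q t\<bar> * C)) \<le> m t"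
          by linarith
      qed (use s in auto)
      finally show "\<bar>- (Q t / s * X t * sin (\<theta> t)) - 1 / (2 * s) * (G' t * R t
        + G t * (g t * (X t * sin (\<theta> t) + Y t * cos (\<theta> t)) - Q t / s * X t * cos (\<theta> t)))\<bar> \<le> 1 / s * m t" .
    qed
    also have "integral {a..b} (\<lambda>t. 1 / s * m t) = 1 / s * integral {a..b} m" by (rule Henstock_Kurzweil_Integration.integral_mult_right)
    finally have 1: "\<bar>(A x - 1 / (2 * s) * (G x * R x)) - (A a - 1 / (2 * s) * (G a * R a))\<bar> \<le> 1 / s * integral {a..b} m" .
    have 2: "\<bar>1 / (2 * s) * (G t * R t)\<bar> \<le> 1 / s * (H * C)" if t: "t \<in> {a..b}" for t
    proof -
      have "\<bar>1 / (2 * s) * (G t * R t)\<bar> = 1 / (2 * s) * (\<bar>G t\<bar> * \<bar>R t\<bar>)" using s by (simp add: abs_mult)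
      also have "\<dots> \<le> 1 / (2 * s) * (H * (2 * C))"
        using s H R[OF t] t by (intro mult_left_mono mult_mono) auto
      finally show ?thesis by simp
    qed
    have aa: "a \<in> {a..b}" using ab by auto
    have tri: "\<bar>y - z\<bar> \<le> i + e + e" if "\<bar>(y - p) - (z - r)\<bar> \<le> i" "\<bar>p\<bar> \<le> e" "\<bar>r\<bar> \<le> e" for y z p r i e :: real
      using that by linarith
    have "\<bar>A x - A a\<bar> \<le> 1 / s * integral {a..b} m + 1 / s * (H * C) + 1 / s * (H * C)"
      by (rule tri[OF 1 2[OF x] 2[OF aa]])
    also have "\<dots> = K / s" by (simp add: K_def add_divide_distrib)
    finally show ?thesis by (simp add: A_def \<theta>_def)
  qed
  then show ?thesis using K by blast
qed

text \<open>The shifts \<open>c = 0\<close> and \<open>c = - (pi / 2)\<close> give both components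
  of \<open>(X, Y)\<close> rotated back by the phase. They stay within \<open>K / s\<close> of their
  initial values 0 and 1, and undoing the rotation costs a factor 2.\<close>

lemma nsys_asymptotics:
  "\<exists>K>0. \<forall>s X Y x. nsys s X Y \<longrightarrow> x \<in> {a..b} \<longrightarrow>
     \<bar>X x - sin (s * \<tau> x)\<bar> \<le> K / s \<and> \<bar>Y x - cos (s * \<tau> x)\<bar> \<le> K / s"
proof -
  obtain K where K: "K > 0" "\<And>s X Y c x. nsys s X Y \<Longrightarrow> x \<in> {a..b} \<Longrightarrow>
     \<bar>(X x * cos (s * \<tau> x + c) - Y x * sin (s * \<tau> x + c)) - (X a * cos (s * \<tau> a + c) - Y a * sin (s * \<tau> a + c))\<bar> \<le> K / s"
    using rotated_increment by blast
  have "\<bar>X x - sin (s * \<tau> x)\<bar> \<le> (2 * K) / s \<and> \<bar>Y x - cos (s * \<tau> x)\<bar> \<le> (2 * K) / s"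
    if ns: "nsys s X Y" and x: "x \<in> {a..b}" for s X Y x
  proof -
    define \<theta> where "\<theta> = s * \<tau> x"
    define A where "A = X x * cos \<theta> - Y x * sin \<theta>"
    define B where "B = X x * sin \<theta> + Y x * cos \<theta> - 1"
    have ini: "X a = 0" "Y a = 1" "\<tau> a = 0" using ns by (auto simp: nsys_def \<tau>_def)
    have A: "\<bar>A\<bar> \<le> K / s" using K(2)[OF ns x, of 0] by (simp add: ini A_def \<theta>_def)
    have B: "\<bar>B\<bar> \<le> K / s" using K(2)[OF ns x, of "- (pi / 2)"]
      by (simp add: ini B_def \<theta>_def cos_diff sin_diff)
    have trig: "\<bar>z * sin y\<bar> \<le> \<bar>z\<bar>" "\<bar>z * cos y\<bar> \<le> \<bar>z\<bar>" for y z :: real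
      by (simp_all add: abs_mult mult_left_le)
    have sc: "sin \<theta> * sin \<theta> = 1 - cos \<theta> * cos \<theta>"
      using sin_cos_squared_add[of \<theta>] by (simp add: power2_eq_square)
    have "X x - sin \<theta> = A * cos \<theta> + B * sin \<theta>" "Y x - cos \<theta> = B * cos \<theta> - A * sin \<theta>"
      unfolding A_def B_def using sc by algebra+
    then have "\<bar>X x - sin \<theta>\<bar> \<le> 2 * (K / s)" "\<bar>Y x - cos \<theta>\<bar> \<le> 2 * (K / s)"
      using A B trig(1)[of A \<theta>] trig(2)[of A \<theta>] trig(1)[of B \<theta>] trig(2)[of B \<theta>] by linarith+
    then show ?thesis by (simp add: \<theta>_def)
  qed
  then show ?thesis using K(1) by (intro exI[of _ "2 * K"]) auto
qed

text \<open>Up to an error \<open>2 * K / s\<close>, \<open>(X t)\<^sup>2\<close> is at least the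
  squared sine of the phase, whose mean in the variable \<open>\<tau> t\<close> is about 1/2. For
  large \<open>s\<close> the errors take away at most half of \<open>\<tau> b / 2\<close>.\<close>

lemma nsys_mass_lower_bound:
  "\<exists>S\<ge>1. \<forall>s X Y. nsys s X Y \<longrightarrow> s \<ge> S \<longrightarrow> \<tau> b / 4 \<le> integral {a..b} (\<lambda>t. \<kappa> t * (X t)\<^sup>2)"
proof -
  obtain K where K: "K > 0" "\<And>s X Y x. nsys s X Y \<Longrightarrow> x \<in> {a..b} \<Longrightarrow> \<bar>X x - sin (s * \<tau> x)\<bar> \<le> K / s"
    using nsys_asymptotics by blast
  \<comment> \<open>Chosen so that the losses \<open>1 / (4 * s)\<close> and
    \<open>2 * K / s * \<tau> b\<close> together are at most \<open>\<tau> b / 4\<close>.\<close>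
  define S where "S = max 1 ((1 + 8 * K * \<tau> b) / \<tau> b)"
  have "\<tau> b / 4 \<le> integral {a..b} (\<lambda>t. \<kappa> t * (X t)\<^sup>2)" if ns: "nsys s X Y" and s: "s \<ge> S" for s X Y
  proof -
    have s1: "s \<ge> 1" using s by (simp add: S_def)
    have sb: "1 + 8 * K * \<tau> b \<le> s * \<tau> b"
      using s tau_pos by (simp add: S_def pos_divide_le_eq mult.commute)
    \<comment> \<open>An antiderivative of \<open>(sin (s * y))\<^sup>2 - 2 * K / s\<close>;
      composition with \<open>\<tau>\<close> performs the substitution.\<close>
    define F where "F = (\<lambda>y. y / 2 - sin (2 * s * y) / (4 * s) - 2 * K / s * y)"
    have dF: "(F has_real_derivative (sin (s * y))\<^sup>2 - 2 * K / s) (at y)" for y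
    proof -
      have "(F has_real_derivative 1 / 2 - cos (2 * s * y) * (2 * s) / (4 * s) - 2 * K / s) (at y)"
        unfolding F_def using s1 by (auto intro!: derivative_eq_intros)
      moreover have "cos (2 * s * y) = 1 - 2 * (sin (s * y))\<^sup>2"
        using cos_double_sin[of "s * y"] by (simp add: mult.assoc)
      then have "1 / 2 - cos (2 * s * y) * (2 * s) / (4 * s) - 2 * K / s = (sin (s * y))\<^sup>2 - 2 * K / s"
        using s1 by (simp add: diff_divide_distrib)
      ultimately show ?thesis by simp
    qed
    have "AC_on a b (\<lambda>t. F (\<tau> t)) (\<lambda>t. ((sin (s * \<tau> t))\<^sup>2 - 2 * K / s) * \<kappa> t)"
      by (rule AC_on_compose[OF tau_AC dF]) (intro continuous_intros)
    moreover have cX: "continuous_on {a..b} X"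
      using ns by (auto simp: nsys_def sys_def intro: AC_on_continuous)
    moreover have "((sin (s * \<tau> t))\<^sup>2 - 2 * K / s) * \<kappa> t \<le> \<kappa> t * (X t)\<^sup>2" if t: "t \<in> {a..b}" for t
    proof -
      define e where "e = X t - sin (s * \<tau> t)"
      have e: "\<bar>e\<bar> \<le> K / s" using K(2)[OF ns t] by (simp add: e_def)
      have "\<bar>sin (s * \<tau> t) * e\<bar> \<le> 1 * \<bar>e\<bar>" unfolding abs_mult by (intro mult_right_mono) auto
      then have "- (2 * K / s) \<le> 2 * (sin (s * \<tau> t) * e)" using e by (auto simp: abs_le_iff)
      moreover have "(X t)\<^sup>2 = (sin (s * \<tau> t))\<^sup>2 + 2 * (sin (s * \<tau> t) * e) + e\<^sup>2"
        by (simp add: e_def power2_eq_square algebra_simps)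
      moreover have "0 \<le> e\<^sup>2" by simp
      ultimately have "(sin (s * \<tau> t))\<^sup>2 - 2 * K / s \<le> (X t)\<^sup>2" by linarith
      then show ?thesis using kappa_pos[OF t] by (simp add: mult.commute)
    qed
    moreover have "(\<lambda>t. \<kappa> t * (X t)\<^sup>2) absolutely_integrable_on {a..b}"
      by (intro absolutely_integrable_continuous_real continuous_intros kappa_cont cX)
    ultimately have "F (\<tau> b) - F (\<tau> a) \<le> integral {a..b} (\<lambda>t. \<kappa> t * (X t)\<^sup>2)"
      using ab by (intro AC_on_increment_le) auto
    moreover have "F (\<tau> a) = 0" by (simp add: F_def \<tau>_def)
    moreover have "\<tau> b / 4 \<le> F (\<tau> b)"
    proof -
      have "sin (2 * s * \<tau> b) / (4 * s) \<le> 1 / (4 * s)" using s1 by (intro divide_right_mono) auto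
      moreover have "1 / (4 * s) + 2 * K / s * \<tau> b = (1 + 8 * K * \<tau> b) / (4 * s)" using s1 by (simp add: field_simps)
      moreover have "(1 + 8 * K * \<tau> b) / (4 * s) \<le> \<tau> b / 4" using s1 sb by (simp add: field_simps)
      ultimately show ?thesis unfolding F_def by linarith
    qed
    ultimately show ?thesis by simp
  qed
  then show ?thesis by (intro exI[of _ S]) (auto simp: S_def)
qed

end

section \<open>The Liouville transformation\<close>

lemma AC_on_inverse:
  assumes "AC_on a b F f" "\<And>x. x \<in> {a..b} \<Longrightarrow> F x > 0"
  shows "AC_on a b (\<lambda>x. 1 / F x) (\<lambda>x. - (1 / (F x)\<^sup>2) * f x)"
proof (rule AC_on_compose[OF assms(1), where \<phi> = "\<lambda>y. 1 / y" and \<phi>' = "\<lambda>y. - (1 / y\<^sup>2)"])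
  show "((\<lambda>y. 1 / y) has_real_derivative - (1 / y\<^sup>2)) (at y)" if "y \<in> F ` {a..b}" for y
  proof -
    have "y > 0" using that assms(2) by auto
    then show ?thesis by (auto intro!: derivative_eq_intros simp: power2_eq_square)
  qed
  show "continuous_on (F ` {a..b}) (\<lambda>y. - (1 / y\<^sup>2))"
    using assms(2) by (intro continuous_intros) force
qed

lemma AC_on_sqrt:
  assumes "AC_on a b F f" "\<And>x. x \<in> {a..b} \<Longrightarrow> F x > 0"
  shows "AC_on a b (\<lambda>x. sqrt (F x)) (\<lambda>x. inverse (sqrt (F x)) / 2 * f x)"
proof (rule AC_on_compose[OF assms(1)])
  show "(sqrt has_real_derivative inverse (sqrt y) / 2) (at y)" if "y \<in> F ` {a..b}" for y
    using that assms(2) by (auto intro: DERIV_real_sqrt)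
  show "continuous_on (F ` {a..b}) (\<lambda>y. inverse (sqrt y) / 2)"
    using assms(2) by (intro continuous_intros) force+
qed

lemma H2_on_AC:
  assumes "H2_on a b f"
  obtains f' f'' where "AC_on a b f f'" "AC_on a b f' f''"
proof -
  obtain g h where gh: "h absolutely_integrable_on {a..b}"
      "\<forall>x\<in>{a..b}. g x = g a + integral {a..x} h" "\<forall>x\<in>{a..b}. f x = f a + integral {a..x} g"
    using assms unfolding H2_on_def by blast
  then have g: "AC_on a b g h" unfolding AC_on_def by blast
  have "g absolutely_integrable_on {a..b}"
    by (intro absolutely_integrable_continuous_real AC_on_continuous[OF g])
  then have "AC_on a b f g" using gh(3) unfolding AC_on_def by blast
  then show thesis using that g by blast
qed

text \<open>Lagrange's identity: in the derivative of \<open>u z - v w\<close> the terms with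
  \<sigma> and \<open>q\<close> cancel, and the Dirichlet condition removes the value at
  \<open>a\<close>.\<close>

lemma wronskian:
  assumes "SL_sol a b \<sigma> q \<rho> \<mu> u w" "SL_sol a b \<sigma> q \<rho> \<nu> v z" "a \<le> b" "u a = 0" "v a = 0"
  shows "u b * z b - v b * w b = (\<mu> - \<nu>) * integral {a..b} (\<lambda>t. \<rho> t * u t * v t)"
proof -
  have "AC_on a b u (\<lambda>t. w t / \<sigma> t)" "AC_on a b w (\<lambda>t. q t * u t - \<mu> * \<rho> t * u t)"
    "AC_on a b v (\<lambda>t. z t / \<sigma> t)" "AC_on a b z (\<lambda>t. q t * v t - \<nu> * \<rho> t * v t)"
    using assms(1,2) by (auto simp: SL_sol_iff_AC_on)
  note AC = AC_on_diff[OF AC_on_mult[OF this(1) this(4)] AC_on_mult[OF this(3) this(2)]]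
  have AC: "AC_on a b (\<lambda>x. u x * z x - v x * w x) (\<lambda>x. (\<mu> - \<nu>) * (\<rho> x * u x * v x))"
    by (rule AC_on_cong[OF AC]) (auto simp: algebra_simps)
  from AC_onD(3)[OF AC, of b] show ?thesis using assms(3-5) by simp
qed

section \<open>Solutions from the Dirichlet end of one half\<close>

text \<open>What the spectral argument uses of one half. Here \<open>h\<close> is the amplitude
  factor at the matching point \<open>b\<close> and \<open>T\<close> the total phase.
  \<open>mass_close\<close> compares mixed integrals for parameters near \<open>p\<close> with the
  integral at \<open>p\<close>, so that almost orthogonality can be tested in one fixed inner
  product.\<close>

locale fundamental_family =
  fixes a b :: real and \<sigma> q \<rho> :: "real \<Rightarrow> real" and U W :: "real \<Rightarrow> real \<Rightarrow> real"
    and h T C c S :: real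
  assumes params: "a < b" "h > 0" "T > 0" "C > 0" "c > 0" "S \<ge> 1"
    and sol: "s \<ge> S \<Longrightarrow> SL_sol a b \<sigma> q \<rho> (s\<^sup>2) (U s) (W s)" "s \<ge> S \<Longrightarrow> U s a = 0"
    and unique: "s \<ge> S \<Longrightarrow> SL_sol a b \<sigma> q \<rho> (s\<^sup>2) u w \<Longrightarrow> u a = 0 \<Longrightarrow>
        \<exists>\<alpha>. \<forall>x\<in>{a..b}. u x = \<alpha> * U s x \<and> w x = \<alpha> * W s x"
    and U_asymp: "s \<ge> S \<Longrightarrow> \<bar>h * U s b - sin (s * T)\<bar> \<le> C / s"
    and W_asymp: "s \<ge> S \<Longrightarrow> \<bar>W s b / (s * h) - cos (s * T)\<bar> \<le> C / s"
    and U_cont: "continuous_on {S..} (\<lambda>s. U s b)" and W_cont: "continuous_on {S..} (\<lambda>s. W s b)"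
    and mass_close: "s \<ge> S \<Longrightarrow> r \<ge> S \<Longrightarrow> p \<ge> S \<Longrightarrow>
        \<bar>integral {a..b} (\<lambda>t. \<rho> t * U s t * U r t) - integral {a..b} (\<lambda>t. \<rho> t * U p t * U p t)\<bar>
          \<le> C * (\<bar>s - p\<bar> + \<bar>r - p\<bar>)"
    and mass_lower: "s \<ge> S \<Longrightarrow> c \<le> integral {a..b} (\<lambda>t. \<rho> t * U s t * U s t)"

text \<open>Weakening the constants lets the two halves share \<open>C\<close>, \<open>c\<close> and
  \<open>S\<close>.\<close>

lemma fundamental_family_mono:
  assumes "fundamental_family a b \<sigma> q \<rho> U W h T C c S" "C \<le> C'" "0 < c'" "c' \<le> c" "S \<le> S'"
  shows "fundamental_family a b \<sigma> q \<rho> U W h T C' c' S'"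
proof -
  interpret fundamental_family a b \<sigma> q \<rho> U W h T C c S by (rule assms(1))
  have mono: "C / s \<le> C' / s" if "s \<ge> S'" for s
    using that assms(2,5) params by (intro divide_right_mono) auto
  show ?thesis
  proof
    show "\<bar>h * U s b - sin (s * T)\<bar> \<le> C' / s" "\<bar>W s b / (s * h) - cos (s * T)\<bar> \<le> C' / s" if "s \<ge> S'" for s
      using U_asymp[of s] W_asymp[of s] mono[OF that] that assms(5) by linarith+
    show "\<bar>integral {a..b} (\<lambda>t. \<rho> t * U s t * U r t) - integral {a..b} (\<lambda>t. \<rho> t * U p t * U p t)\<bar>
          \<le> C' * (\<bar>s - p\<bar> + \<bar>r - p\<bar>)" if "s \<ge> S'" "r \<ge> S'" "p \<ge> S'" for s r p
      using mass_close[of s r p] that assms(5) mult_right_mono[OF assms(2), of "\<bar>s - p\<bar> + \<bar>r - p\<bar>"] by linarith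
    show "c' \<le> integral {a..b} (\<lambda>t. \<rho> t * U s t * U s t)" if "s \<ge> S'" for s
      using mass_lower[of s] that assms(4,5) by linarith
    show "continuous_on {S'..} (\<lambda>s. U s b)" "continuous_on {S'..} (\<lambda>s. W s b)"
      using assms(5) by (auto intro!: continuous_on_subset[OF U_cont] continuous_on_subset[OF W_cont])
    show "SL_sol a b \<sigma> q \<rho> (s\<^sup>2) (U s) (W s)" "U s a = 0" if "s \<ge> S'" for s
      using sol[of s] that assms(5) by auto
    show "\<exists>\<alpha>. \<forall>x\<in>{a..b}. u x = \<alpha> * U s x \<and> w x = \<alpha> * W s x"
      if "s \<ge> S'" "SL_sol a b \<sigma> q \<rho> (s\<^sup>2) u w" "u a = 0" for s u w
      using unique[of s u w] that assms(5) by auto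
  qed (use assms params in auto)
qed

text \<open>Solved for the unknowns, the last two equations read
  \<open>h = (\<rho> \<sigma>)^(1/4)\<close> and
  \<open>\<kappa> = (\<rho> / \<sigma>)^(1/2)\<close>, and \<open>g\<close> is the logarithmic
  derivative of \<open>h\<close>. The implicit form keeps roots out of the later
  computations.\<close>

definition liouville_form ::
  "real \<Rightarrow> real \<Rightarrow> (real \<Rightarrow> real) \<Rightarrow> (real \<Rightarrow> real) \<Rightarrow> (real \<Rightarrow> real) \<Rightarrow> (real \<Rightarrow> real) \<Rightarrow>
   (real \<Rightarrow> real) \<Rightarrow> (real \<Rightarrow> real) \<Rightarrow> (real \<Rightarrow> real) \<Rightarrow> bool" where
  "liouville_form a b \<rho> \<sigma> h g \<kappa> G G' \<longleftrightarrow>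
     AC_on a b h (\<lambda>x. g x * h x) \<and> AC_on a b G G' \<and> continuous_on {a..b} \<kappa> \<and> continuous_on {a..b} g \<and>
     (\<forall>x\<in>{a..b}. h x > 0 \<and> \<kappa> x > 0 \<and> g x = G x * \<kappa> x \<and> \<rho> x = \<kappa> x * (h x)\<^sup>2 \<and> \<sigma> x = (h x)\<^sup>2 / \<kappa> x)"

text \<open>The logarithmic derivative of \<open>(\<rho> \<sigma>)^(1/4)\<close> is a quarter of the
  sum of those of \<rho> and \<sigma>. It involves first derivatives only, which are absolutely
  continuous by \<open>H2_on\<close>; hence so is \<open>G = g / \<kappa>\<close>, and its density
  contains the second derivatives.\<close>

lemma liouville_form_exists:
  fixes \<rho> \<sigma> :: "real \<Rightarrow> real"
  assumes \<rho>: "H2_on a b \<rho>" "\<forall>x\<in>{a..b}. \<rho> x > 0" and \<sigma>: "H2_on a b \<sigma>" "\<forall>x\<in>{a..b}. \<sigma> x > 0"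
  shows "\<exists>h g \<kappa> G G'. liouville_form a b \<rho> \<sigma> h g \<kappa> G G'"
proof -
  note rp = bspec[OF \<rho>(2)] and sp = bspec[OF \<sigma>(2)]
  obtain r1 r2 where r: "AC_on a b \<rho> r1" "AC_on a b r1 r2" using H2_on_AC[OF \<rho>(1)] by blast
  obtain s1 s2 where s: "AC_on a b \<sigma> s1" "AC_on a b s1 s2" using H2_on_AC[OF \<sigma>(1)] by blast
  define h where "h = (\<lambda>x. (\<rho> x * \<sigma> x) powr (1/4))"
  define \<kappa> where "\<kappa> = (\<lambda>x. sqrt (\<rho> x / \<sigma> x))"
  define g where "g = (\<lambda>x. (r1 x / \<rho> x + s1 x / \<sigma> x) / 4)"
  define G where "G = (\<lambda>x. 1/4 * ((r1 x * (1 / \<rho> x) + s1 x * (1 / \<sigma> x)) * sqrt (\<sigma> x * (1 / \<rho> x))))"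
  note c = AC_on_continuous[OF r(1)] AC_on_continuous[OF r(2)] AC_on_continuous[OF s(1)] AC_on_continuous[OF s(2)]
  have ne: "\<rho> x \<noteq> 0" "\<sigma> x \<noteq> 0" if "x \<in> {a..b}" for x using rp[OF that] sp[OF that] by auto
  have P: "AC_on a b (\<lambda>x. \<rho> x * \<sigma> x) (\<lambda>x. r1 x * \<sigma> x + \<rho> x * s1 x)" by (rule AC_on_mult[OF r(1) s(1)])
  have P0: "y > 0" if "y \<in> (\<lambda>x. \<rho> x * \<sigma> x) ` {a..b}" for y using that rp sp by auto
  have h': "AC_on a b h (\<lambda>x. 1/4 * (\<rho> x * \<sigma> x) powr (1/4 - 1) * (r1 x * \<sigma> x + \<rho> x * s1 x))"
    unfolding h_def
  proof (rule AC_on_compose[OF P, where \<phi> = "\<lambda>y. y powr (1/4)" and \<phi>' = "\<lambda>y. 1/4 * y powr (1/4 - 1)"])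
    show "((\<lambda>y. y powr (1/4)) has_real_derivative 1/4 * y powr (1/4 - 1)) (at y)"
      if "y \<in> (\<lambda>x. \<rho> x * \<sigma> x) ` {a..b}" for y
      by (rule has_real_derivative_powr[OF P0[OF that]])
    show "continuous_on ((\<lambda>x. \<rho> x * \<sigma> x) ` {a..b}) (\<lambda>y. 1/4 * y powr (1/4 - 1))"
      using P0 by (intro continuous_intros) force
  qed
  have h2: "(h x)\<^sup>2 = sqrt (\<rho> x * \<sigma> x)" if "x \<in> {a..b}" for x
  proof -
    have "\<rho> x * \<sigma> x > 0" using rp[OF that] sp[OF that] by simp
    then show ?thesis by (simp add: h_def power2_eq_square powr_half_sqrt flip: powr_add)
  qed
  have p1: "\<rho> x = \<kappa> x * (h x)\<^sup>2" and p2: "\<sigma> x = (h x)\<^sup>2 / \<kappa> x" and p3: "g x = G x * \<kappa> x" and p4: "\<kappa> x > 0"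
    if x: "x \<in> {a..b}" for x
  proof -
    note pos = rp[OF x] sp[OF x]
    show k0: "\<kappa> x > 0" using pos by (simp add: \<kappa>_def)
    have "\<kappa> x * (h x)\<^sup>2 = sqrt (\<rho> x / \<sigma> x * (\<rho> x * \<sigma> x))" unfolding h2[OF x] \<kappa>_def by (simp only: real_sqrt_mult)
    also have "\<rho> x / \<sigma> x * (\<rho> x * \<sigma> x) = (\<rho> x)\<^sup>2" using pos by (simp add: power2_eq_square)
    finally show "\<rho> x = \<kappa> x * (h x)\<^sup>2" using pos by simp
    have "(h x)\<^sup>2 / \<kappa> x = sqrt ((\<rho> x * \<sigma> x) / (\<rho> x / \<sigma> x))" unfolding h2[OF x] \<kappa>_def by (simp only: real_sqrt_divide)
    also have "(\<rho> x * \<sigma> x) / (\<rho> x / \<sigma> x) = (\<sigma> x)\<^sup>2" using pos by (simp add: power2_eq_square)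
    finally show "\<sigma> x = (h x)\<^sup>2 / \<kappa> x" using pos by simp
    have "sqrt (\<sigma> x * (1 / \<rho> x)) * \<kappa> x = sqrt ((\<sigma> x * (1 / \<rho> x)) * (\<rho> x / \<sigma> x))" unfolding \<kappa>_def by (simp only: real_sqrt_mult)
    also have "(\<sigma> x * (1 / \<rho> x)) * (\<rho> x / \<sigma> x) = 1" using pos by simp
    finally have "sqrt (\<sigma> x * (1 / \<rho> x)) * \<kappa> x = 1" by simp
    moreover have "G x * \<kappa> x = g x * (sqrt (\<sigma> x * (1 / \<rho> x)) * \<kappa> x)" by (simp add: G_def g_def)
    ultimately show "g x = G x * \<kappa> x" by simp
  qed
  show ?thesis
    unfolding liouville_form_def
  \<comment> \<open>The witness for \<open>G'\<close> is left open and is fixed by the density that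
    the calculus rules produce for \<open>G\<close>.\<close>
  proof (rule exI[of _ h], rule exI[of _ g], rule exI[of _ \<kappa>], rule exI[of _ G], rule exI, intro conjI ballI)
    show "AC_on a b h (\<lambda>x. g x * h x)"
    proof (rule AC_on_cong[OF h' refl])
      fix x assume x: "x \<in> {a..b}"
      note pos = rp[OF x] sp[OF x]
      have "(\<rho> x * \<sigma> x) powr (1/4 - 1) = h x / (\<rho> x * \<sigma> x)"
        unfolding h_def powr_diff using pos by simp
      then have "1/4 * (\<rho> x * \<sigma> x) powr (1/4 - 1) * (r1 x * \<sigma> x + \<rho> x * s1 x)
        = 1/4 * (h x / (\<rho> x * \<sigma> x)) * (r1 x * \<sigma> x + \<rho> x * s1 x)" by (simp only:)
      also have "\<dots> = g x * h x" using pos by (simp add: g_def field_simps)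
      finally show "1/4 * (\<rho> x * \<sigma> x) powr (1/4 - 1) * (r1 x * \<sigma> x + \<rho> x * s1 x) = g x * h x" .
    qed
    show "h x > 0" if "x \<in> {a..b}" for x using ne[OF that] by (simp add: h_def)
    show "continuous_on {a..b} \<kappa>" unfolding \<kappa>_def using ne by (intro continuous_intros c) auto
    show "continuous_on {a..b} g" unfolding g_def using ne by (intro continuous_intros c) auto
    have "AC_on a b (\<lambda>x. \<sigma> x * (1 / \<rho> x)) (\<lambda>x. s1 x * (1 / \<rho> x) + \<sigma> x * (- (1 / (\<rho> x)\<^sup>2) * r1 x))"
      by (intro AC_on_mult AC_on_inverse s r rp)
    from AC_on_sqrt[OF this]
    show "AC_on a b G (\<lambda>x. 1/4 * (((r2 x * (1 / \<rho> x) + r1 x * (- (1 / (\<rho> x)\<^sup>2) * r1 x))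
        + (s2 x * (1 / \<sigma> x) + s1 x * (- (1 / (\<sigma> x)\<^sup>2) * s1 x))) * sqrt (\<sigma> x * (1 / \<rho> x))
        + (r1 x * (1 / \<rho> x) + s1 x * (1 / \<sigma> x)) * (inverse (sqrt (\<sigma> x * (1 / \<rho> x))) / 2 *
            (s1 x * (1 / \<rho> x) + \<sigma> x * (- (1 / (\<rho> x)\<^sup>2) * r1 x)))))"
      unfolding G_def using rp sp
      by (intro AC_on_cmult AC_on_mult AC_on_add AC_on_inverse s r) auto
  qed (use p1 p2 p3 p4 in auto)
qed

text \<open>If \<open>(u, w)\<close> solves the equation, then \<open>(h u, w / (s h))\<close>
  solves the oscillator system, so the bounds on \<open>sys\<close> and \<open>nsys\<close>
  transfer. The choice \<open>u a = 0\<close>, \<open>w a = s * h a\<close> makes the transformed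
  initial pair \<open>(0, 1)\<close>.\<close>

lemma fundamental_family_exists:
  fixes \<rho> \<sigma> q :: "real \<Rightarrow> real"
  assumes ab: "a < b" and \<rho>: "H2_on a b \<rho>" "unif_pos_on a b \<rho>" and \<sigma>: "H2_on a b \<sigma>" "unif_pos_on a b \<sigma>"
    and q: "q absolutely_integrable_on {a..b}"
  obtains U W h T C c S where "fundamental_family a b \<sigma> q \<rho> U W h T C c S"
proof -
  have pos: "\<rho> x > 0" "\<sigma> x > 0" if "x \<in> {a..b}" for x
    using \<rho>(2) \<sigma>(2) that unfolding unif_pos_on_def by force+
  then have "\<forall>x\<in>{a..b}. \<rho> x > 0" "\<forall>x\<in>{a..b}. \<sigma> x > 0" by blast+
  then obtain h g \<kappa> G G' where form: "liouville_form a b \<rho> \<sigma> h g \<kappa> G G'"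
    using liouville_form_exists[OF \<rho>(1) _ \<sigma>(1)] by blast
  have h_AC: "AC_on a b h (\<lambda>x. g x * h x)" and kg: "continuous_on {a..b} \<kappa>" "continuous_on {a..b} g" "AC_on a b G G'"
    using form by (auto simp: liouville_form_def)
  have h0: "h x > 0" and kap0: "\<kappa> x > 0" and gG: "g x = G x * \<kappa> x" and rho: "\<rho> x = \<kappa> x * (h x)\<^sup>2"
    and sig: "\<sigma> x = (h x)\<^sup>2 / \<kappa> x" if "x \<in> {a..b}" for x
    using form that unfolding liouville_form_def by blast+
  define Q where "Q = (\<lambda>x. q x * (1 / (h x)\<^sup>2))"
  have hne: "h x \<noteq> 0" if "x \<in> {a..b}" for x using h0[OF that] by simp
  have Q: "Q absolutely_integrable_on {a..b}"
    unfolding Q_def using hne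
    by (intro absolutely_integrable_continuous_mult q continuous_intros AC_on_continuous[OF h_AC]) auto
  interpret oscillator a b \<kappa> g Q G G'
    by unfold_locales (use ab kg kap0 gG Q in auto)
  have aI: "a \<in> {a..b}" and bI: "b \<in> {a..b}" using ab by auto
  have to_sys: "sys s (\<lambda>x. h x * u x) (\<lambda>x. 1 / s * (w x * (1 / h x)))"
    if SL: "SL_sol a b \<sigma> q \<rho> (s\<^sup>2) u w" and s: "s \<ge> 1" for s u w
  proof -
    have u: "AC_on a b u (\<lambda>t. w t / \<sigma> t)" and w: "AC_on a b w (\<lambda>t. q t * u t - s\<^sup>2 * \<rho> t * u t)"
      using SL by (auto simp: SL_sol_iff_AC_on)
    show ?thesis unfolding sys_def
    proof
      show "AC_on a b (\<lambda>x. h x * u x) (\<lambda>t. s * \<kappa> t * (1 / s * (w t * (1 / h t))) + g t * (h t * u t))"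
      proof (rule AC_on_cong[OF AC_on_mult[OF h_AC u] refl])
        fix t assume t: "t \<in> {a..b}"
        have "h t * (w t / \<sigma> t) = \<kappa> t * (w t * (1 / h t))"
          unfolding sig[OF t] using h0[OF t] kap0[OF t] by (simp add: power2_eq_square)
        then show "g t * h t * u t + h t * (w t / \<sigma> t) = s * \<kappa> t * (1 / s * (w t * (1 / h t))) + g t * (h t * u t)"
          using s by simp
      qed
      show "AC_on a b (\<lambda>x. 1 / s * (w x * (1 / h x)))
         (\<lambda>t. - s * \<kappa> t * (h t * u t) - g t * (1 / s * (w t * (1 / h t))) + Q t / s * (h t * u t))"
      proof (rule AC_on_cong[OF AC_on_cmult[OF AC_on_mult[OF w AC_on_inverse[OF h_AC h0]]] refl])
        fix t assume t: "t \<in> {a..b}"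
        show "1 / s * ((q t * u t - s\<^sup>2 * \<rho> t * u t) * (1 / h t) + w t * (- (1 / (h t)\<^sup>2) * (g t * h t)))
          = - s * \<kappa> t * (h t * u t) - g t * (1 / s * (w t * (1 / h t))) + Q t / s * (h t * u t)"
          unfolding rho[OF t] Q_def using h0[OF t] s by (simp add: field_simps power2_eq_square)
      qed
    qed
  qed
  define P where "P = (\<lambda>s u w. SL_sol a b \<sigma> q \<rho> (s\<^sup>2) u w \<and> u a = 0 \<and> w a = s * h a)"
  have "\<exists>u w. P s u w" for s
  proof -
    have cs: "continuous_on {a..b} \<rho>" "continuous_on {a..b} \<sigma>"
      using H2_on_AC[OF \<rho>(1)] H2_on_AC[OF \<sigma>(1)] AC_on_continuous by metis+
    have "(\<lambda>t. 1 / \<sigma> t) absolutely_integrable_on {a..b}"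
      using pos(2) by (intro absolutely_integrable_continuous_real continuous_intros cs) force
    moreover have "(\<lambda>t. q t - s\<^sup>2 * \<rho> t) absolutely_integrable_on {a..b}"
      by (intro set_integral_diff q absolutely_integrable_continuous_real continuous_intros cs)
    ultimately obtain u w where "AC_on a b u (\<lambda>t. 1 / \<sigma> t * w t)" "AC_on a b w (\<lambda>t. (q t - s\<^sup>2 * \<rho> t) * u t)"
      "u a = 0" "w a = s * h a"
      using ab by (auto intro: linear_system_exists[where p = "\<lambda>t. 1 / \<sigma> t" and c = "\<lambda>t. q t - s\<^sup>2 * \<rho> t" and ?u0.0 = 0 and ?w0.0 = "s * h a"])
    then have "SL_sol a b \<sigma> q \<rho> (s\<^sup>2) u w" by (simp add: SL_sol_iff_AC_on left_diff_distrib)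
    then show ?thesis using \<open>u a = 0\<close> \<open>w a = s * h a\<close> unfolding P_def by blast
  qed
  then obtain U W where "\<And>s. P s (U s) (W s)" by metis
  then have UW: "SL_sol a b \<sigma> q \<rho> (s\<^sup>2) (U s) (W s)" "U s a = 0" "W s a = s * h a" for s
    unfolding P_def by blast+
  define X where "X = (\<lambda>s x. h x * U s x)"
  define Y where "Y = (\<lambda>s x. 1 / s * (W s x * (1 / h x)))"
  have ns: "nsys s (X s) (Y s)" if "s \<ge> 1" for s
    using to_sys[OF UW(1) that] that UW(2)[of s] UW(3)[of s] hne[OF aI] by (simp add: nsys_def X_def Y_def)
  have mass: "integral {a..b} (\<lambda>t. \<rho> t * U s t * U r t) = integral {a..b} (\<lambda>t. \<kappa> t * X s t * X r t)" for s r
    using rho by (intro integral_cong) (auto simp: X_def power2_eq_square)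
  obtain C1 where C1: "C1 \<ge> 1" "\<And>s X Y x. nsys s X Y \<Longrightarrow> x \<in> {a..b} \<Longrightarrow> \<bar>X x\<bar> \<le> C1"
    using nsys_bound by blast
  obtain L where L: "L > 0" "\<And>s r X Y Z V x. nsys s X Y \<Longrightarrow> nsys r Z V \<Longrightarrow> x \<in> {a..b} \<Longrightarrow>
     \<bar>X x - Z x\<bar> \<le> L * \<bar>s - r\<bar> \<and> \<bar>Y x - V x\<bar> \<le> L * \<bar>s - r\<bar>"
    using nsys_lipschitz by blast
  obtain K where K: "K > 0" "\<And>s X Y x. nsys s X Y \<Longrightarrow> x \<in> {a..b} \<Longrightarrow>
     \<bar>X x - sin (s * \<tau> x)\<bar> \<le> K / s \<and> \<bar>Y x - cos (s * \<tau> x)\<bar> \<le> K / s"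
    using nsys_asymptotics by blast
  obtain S where S: "S \<ge> 1" "\<And>s X Y. nsys s X Y \<Longrightarrow> s \<ge> S \<Longrightarrow> \<tau> b / 4 \<le> integral {a..b} (\<lambda>t. \<kappa> t * (X t)\<^sup>2)"
    using nsys_mass_lower_bound by blast
  define C where "C = max K (\<tau> b * C1 * L)"
  have Lcont: "continuous_on {S..} f" if "\<And>s r. s \<ge> S \<Longrightarrow> r \<ge> S \<Longrightarrow> \<bar>f s - f r\<bar> \<le> L * \<bar>s - r\<bar>" for f :: "real \<Rightarrow> real"
    using that L(1) by (intro lipschitz_on_continuous_on[of L] lipschitz_onI) (auto simp: dist_real_def)
  have cX: "continuous_on {S..} (\<lambda>s. X s b)" and cY: "continuous_on {S..} (\<lambda>s. Y s b)"
    using L(2)[OF ns ns bI] S(1) by (auto intro!: Lcont)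
  have "fundamental_family a b \<sigma> q \<rho> U W (h b) (\<tau> b) C (\<tau> b / 4) S"
  proof
    show "a < b" "h b > 0" "\<tau> b > 0" "C > 0" "\<tau> b / 4 > 0" "S \<ge> 1"
      using ab h0[OF bI] tau_pos K(1) S(1) by (auto simp: C_def)
    fix s assume s: "s \<ge> S"
    then have s1: "s \<ge> 1" using S(1) by simp
    show "SL_sol a b \<sigma> q \<rho> (s\<^sup>2) (U s) (W s)" "U s a = 0" using UW by auto
    have KC: "K / s \<le> C / s" using s1 by (intro divide_right_mono) (auto simp: C_def)
    show "\<bar>h b * U s b - sin (s * \<tau> b)\<bar> \<le> C / s"
      using K(2)[OF ns[OF s1] bI] KC by (simp add: X_def)
    show "\<bar>W s b / (s * h b) - cos (s * \<tau> b)\<bar> \<le> C / s"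
      using K(2)[OF ns[OF s1] bI] KC by (simp add: Y_def)
    show "\<tau> b / 4 \<le> integral {a..b} (\<lambda>t. \<rho> t * U s t * U s t)"
      using S(2)[OF ns[OF s1] s] unfolding mass by (simp add: power2_eq_square mult.assoc)
    show "\<exists>\<alpha>. \<forall>x\<in>{a..b}. u x = \<alpha> * U s x \<and> w x = \<alpha> * W s x"
      if SL: "SL_sol a b \<sigma> q \<rho> (s\<^sup>2) u w" and ua: "u a = 0" for u w
    proof -
      \<comment> \<open>Matches the second initial value, so the difference starts at zero and the
        energy bound keeps it zero.\<close>
      define \<alpha> where "\<alpha> = w a / (s * h a)"
      have diff: "sys s (\<lambda>t. h t * u t - \<alpha> * X s t) (\<lambda>t. 1 / s * (w t * (1 / h t)) - \<alpha> * Y s t)"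
        by (rule sys_diff_cmult[OF to_sys[OF SL s1]]) (use ns[OF s1] in \<open>simp add: nsys_def\<close>)
      obtain B where B: "\<And>s X Y x. s \<ge> 1 \<Longrightarrow> sys s X Y \<Longrightarrow> x \<in> {a..b} \<Longrightarrow> (X x)\<^sup>2 + (Y x)\<^sup>2 \<le> B\<^sup>2 * ((X a)\<^sup>2 + (Y a)\<^sup>2)"
        using energy_bound by blast
      have "u x = \<alpha> * U s x \<and> w x = \<alpha> * W s x" if x: "x \<in> {a..b}" for x
      proof -
        have "X s a = 0" "Y s a = 1" using ns[OF s1] by (auto simp: nsys_def)
        then have "(h x * u x - \<alpha> * X s x)\<^sup>2 + (1 / s * (w x * (1 / h x)) - \<alpha> * Y s x)\<^sup>2 \<le> 0"
          using B[OF s1 diff x] ua by (simp add: \<alpha>_def)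
        then have "h x * u x - \<alpha> * X s x = 0" "1 / s * (w x * (1 / h x)) - \<alpha> * Y s x = 0"
          by (auto simp: sum_power2_le_zero_iff)
        then show ?thesis using s1 h0[OF x] by (simp add: X_def Y_def field_simps)
      qed
      then show ?thesis by blast
    qed
    show "\<bar>integral {a..b} (\<lambda>t. \<rho> t * U s t * U r t) - integral {a..b} (\<lambda>t. \<rho> t * U p t * U p t)\<bar>
          \<le> C * (\<bar>s - p\<bar> + \<bar>r - p\<bar>)" if r: "r \<ge> S" and p: "p \<ge> S" for r p
    proof -
      have r1: "r \<ge> 1" and p1: "p \<ge> 1" using r p S(1) by auto
      define D where "D = C1 * L * (\<bar>s - p\<bar> + \<bar>r - p\<bar>)"
      have ct: "continuous_on {a..b} (X z)" if "z \<ge> 1" for z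
        using ns[OF that] by (auto simp: nsys_def sys_def intro: AC_on_continuous)
      have i1: "(\<lambda>t. \<kappa> t * X s t * X r t) absolutely_integrable_on {a..b}"
        "(\<lambda>t. \<kappa> t * X p t * X p t) absolutely_integrable_on {a..b}"
        by (intro absolutely_integrable_continuous_real continuous_intros kappa_cont ct s1 r1 p1)+
      have "integral {a..b} (\<lambda>t. \<kappa> t * X s t * X r t) - integral {a..b} (\<lambda>t. \<kappa> t * X p t * X p t)
        = integral {a..b} (\<lambda>t. \<kappa> t * X s t * X r t - \<kappa> t * X p t * X p t)"
        using i1 set_lebesgue_integral_eq_integral(1) by (subst Henstock_Kurzweil_Integration.integral_diff) auto
      also have "\<bar>\<dots>\<bar> \<le> integral {a..b} (\<lambda>t. D * \<kappa> t)"
      proof (rule abs_integral_le)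
        fix t assume t: "t \<in> {a..b}"
        have "\<kappa> t * X s t * X r t - \<kappa> t * X p t * X p t = \<kappa> t * ((X s t - X p t) * X r t + X p t * (X r t - X p t))"
          by (simp add: algebra_simps)
        also have "\<bar>\<dots>\<bar> = \<kappa> t * \<bar>(X s t - X p t) * X r t + X p t * (X r t - X p t)\<bar>"
          using kappa_pos[OF t] by (simp add: abs_mult)
        also have "\<dots> \<le> \<kappa> t * D"
        proof (intro mult_left_mono)
          have "\<bar>(X s t - X p t) * X r t\<bar> \<le> (L * \<bar>s - p\<bar>) * C1"
            unfolding abs_mult using L(2)[OF ns[OF s1] ns[OF p1] t] C1(2)[OF ns[OF r1] t] L(1)
            by (intro mult_mono) auto
          moreover have "\<bar>X p t * (X r t - X p t)\<bar> \<le> C1 * (L * \<bar>r - p\<bar>)"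
            unfolding abs_mult using L(2)[OF ns[OF r1] ns[OF p1] t] C1 ns[OF p1] t
            by (intro mult_mono) auto
          ultimately show "\<bar>(X s t - X p t) * X r t + X p t * (X r t - X p t)\<bar> \<le> D"
            unfolding D_def by (simp add: algebra_simps)
        qed (use kappa_pos[OF t] in auto)
        finally show "\<bar>\<kappa> t * X s t * X r t - \<kappa> t * X p t * X p t\<bar> \<le> D * \<kappa> t" by (simp add: mult.commute)
      qed (intro set_integral_diff i1 set_integrable_mult_right kappa_int)+
      also have "\<dots> = (\<tau> b * C1 * L) * (\<bar>s - p\<bar> + \<bar>r - p\<bar>)" by (simp add: \<tau>_def D_def)
      also have "\<dots> \<le> C * (\<bar>s - p\<bar> + \<bar>r - p\<bar>)" by (intro mult_right_mono) (auto simp: C_def)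
      finally show ?thesis unfolding mass .
    qed
  next
    have "continuous_on {S..} (\<lambda>s. X s b / h b)" using hne[OF bI] by (intro continuous_intros cX) auto
    then show "continuous_on {S..} (\<lambda>s. U s b)" using hne[OF bI] by (simp add: X_def)
    have "continuous_on {S..} (\<lambda>s. s * (h b * Y s b))" by (intro continuous_intros cY)
    then show "continuous_on {S..} (\<lambda>s. W s b)"
      using hne[OF bI] S(1) by (subst continuous_on_cong[OF refl, of _ _ "\<lambda>s. s * (h b * Y s b)"]) (auto simp: Y_def)
  qed
  then show thesis by (rule that)
qed

section \<open>Almost orthogonal vectors and close zeros\<close>

text \<open>In the inner product with weights \<open>c1\<close>, \<open>c2\<close> the Gram matrix
  has diagonal entries at least \<open>c\<close> and off-diagonal entries at most
  \<open>c / 3\<close> in absolute value. Such a matrix is strictly diagonally dominant, yet the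
  Gram determinant of three vectors in a plane is zero.\<close>

lemma no_three_almost_orthogonal:
  fixes x1 y1 x2 y2 x3 y3 c1 c2 c :: real
  assumes c: "0 < c" "c \<le> c1" "c \<le> c2"
    and n: "x1\<^sup>2 + y1\<^sup>2 = 1" "x2\<^sup>2 + y2\<^sup>2 = 1" "x3\<^sup>2 + y3\<^sup>2 = 1"
    and o12: "\<bar>c1 * (x1 * x2) + c2 * (y1 * y2)\<bar> \<le> c / 3"
    and o13: "\<bar>c1 * (x1 * x3) + c2 * (y1 * y3)\<bar> \<le> c / 3"
    and o23: "\<bar>c1 * (x2 * x3) + c2 * (y2 * y3)\<bar> \<le> c / 3"
  shows False
proof -
  define N where "N = (\<lambda>x y. c1 * x\<^sup>2 + c2 * y\<^sup>2 :: real)"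
  have N: "c \<le> N x y" if "x\<^sup>2 + y\<^sup>2 = 1" for x y
  proof -
    have "c = c * x\<^sup>2 + c * y\<^sup>2" using that by (simp flip: distrib_left)
    also have "\<dots> \<le> N x y" unfolding N_def using c by (intro add_mono mult_right_mono) auto
    finally show ?thesis .
  qed
  define n1 n2 n3 where "n1 = N x1 y1" and "n2 = N x2 y2" and "n3 = N x3 y3"
  have nc: "c \<le> n1" "c \<le> n2" "c \<le> n3" using N n by (auto simp: n1_def n2_def n3_def)
  define d12 d13 d23 where "d12 = c1 * (x1 * x2) + c2 * (y1 * y2)" and "d13 = c1 * (x1 * x3) + c2 * (y1 * y3)"
    and "d23 = c1 * (x2 * x3) + c2 * (y2 * y3)"
  have sq: "d12\<^sup>2 \<le> (c/3)\<^sup>2" "d13\<^sup>2 \<le> (c/3)\<^sup>2" "d23\<^sup>2 \<le> (c/3)\<^sup>2"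
    using o12 o13 o23 c by (auto simp: d12_def d13_def d23_def simp flip: abs_le_square_iff)
  have "\<bar>d12 * d23 * d13\<bar> \<le> c/3 * (c/3) * (c/3)"
    unfolding abs_mult using o12 o13 o23 c by (intro mult_mono) (auto simp: d12_def d13_def d23_def)
  then have d: "- (d12 * d23 * d13) \<le> c/3 * (c/3) * (c/3)" by linarith
  \<comment> \<open>The Gram determinant of three vectors in the plane vanishes.\<close>
  have gram: "n1 * n2 * n3 + 2 * (d12 * d23 * d13) = n1 * d23\<^sup>2 + n2 * d13\<^sup>2 + n3 * d12\<^sup>2"
    unfolding n1_def n2_def n3_def N_def d12_def d13_def d23_def by algebra
  have "n1 * d23\<^sup>2 + n2 * d13\<^sup>2 + n3 * d12\<^sup>2 \<le> n1 * (c/3)\<^sup>2 + n2 * (c/3)\<^sup>2 + n3 * (c/3)\<^sup>2"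
    using sq nc c by (intro add_mono mult_left_mono) auto
  then have up: "n1 * n2 * n3 \<le> (n1 + n2 + n3) * (c/3)\<^sup>2 + 2 * (c/3 * (c/3) * (c/3))"
    using gram d by (simp add: algebra_simps)
  \<comment> \<open>Each squared norm times \<open>c * c\<close> is at most the product of all
    three; summing bounds that product from below by more than \<open>up\<close> allows.\<close>
  have "n1 * (c * c) \<le> n1 * (n2 * n3)" "n2 * (c * c) \<le> n2 * (n1 * n3)" "n3 * (c * c) \<le> n3 * (n1 * n2)"
    using nc c by (intro mult_left_mono mult_mono; simp)+
  then have lo: "(n1 + n2 + n3) * (c * c) \<le> 3 * (n1 * n2 * n3)" by (simp add: algebra_simps)
  have "(n1 + n2 + n3) * (c * c) \<le> 3 * ((n1 + n2 + n3) * (c/3)\<^sup>2 + 2 * (c/3 * (c/3) * (c/3)))"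
    by (rule order_trans[OF lo mult_left_mono[OF up]]) simp
  also have "\<dots> = (n1 + n2 + n3) * (c * c) / 3 + 2 * (c * (c * c)) / 9"
    by (simp add: power2_eq_square field_simps)
  finally have "(3 * (n1 + n2 + n3)) * (c * c) \<le> c * (c * c)"
    by linarith
  then have "3 * (n1 + n2 + n3) \<le> c" using c by (simp add: mult_le_cancel_right)
  moreover have "3 * (c + c + c) \<le> 3 * (n1 + n2 + n3)"
    using nc by (intro mult_left_mono add_mono) auto
  ultimately show False using c(1) by simp
qed

section \<open>Close zeros of the characteristic function\<close>

text \<open>\<open>D\<close> is negative at both ends: at \<open>l\<close> all three terms are
  negative, at \<open>r\<close> this is \<open>Dr\<close>. At the last zero \<open>z\<close> of
  \<open>min x y\<close> it is nonnegative, as the product \<open>x y\<close> vanishes there. If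
  \<open>D z > 0\<close>, each side of \<open>z\<close> contains a zero. If \<open>D z = 0\<close>,
  then \<open>x\<close> and \<open>y\<close> vanish together, \<open>z\<close> is one zero, and
  \<open>D\<close> becomes positive right after it, which yields the other.\<close>

lemma two_zeros_between:
  fixes x x' y y' :: "real \<Rightarrow> real"
  assumes lr: "0 < l" "l < r" and \<beta>: "0 < \<beta>" and m: "0 < m1" "0 < m2" "0 < M"
    and cont: "continuous_on {l..r} x" "continuous_on {l..r} x'" "continuous_on {l..r} y" "continuous_on {l..r} y'"
    and left: "x l \<le> - \<beta>" "y l \<le> - \<beta>" and right: "\<beta> \<le> x r" "\<beta> \<le> y r"
    and pos: "\<And>s. s \<in> {l..r} \<Longrightarrow> \<beta> \<le> x' s" "\<And>s. s \<in> {l..r} \<Longrightarrow> \<beta> \<le> y' s"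
    and Dr: "m1 * x' r * y r + m2 * y' r * x r < r * M * x r * y r"
  defines "D \<equiv> \<lambda>s. m1 * x' s * y s + m2 * y' s * x s - s * M * x s * y s"
  shows "\<exists>s1 s2. l \<le> s1 \<and> s1 < s2 \<and> s2 \<le> r \<and> D s1 = 0 \<and> D s2 = 0"
proof -
  have cD: "continuous_on {l..r} D" unfolding D_def by (intro continuous_intros cont)
  have lI: "l \<in> {l..r}" and rI: "r \<in> {l..r}" using lr by auto
  have Dl: "D l < 0"
  proof -
    have "x' l * y l < 0" "y' l * x l < 0" using pos[OF lI] left \<beta> by (auto intro!: mult_pos_neg)
    then have "m1 * (x' l * y l) < 0" "m2 * (y' l * x l) < 0" using m by (auto intro!: mult_pos_neg)
    moreover have "0 < x l * y l" using left \<beta> by (auto intro!: mult_neg_neg)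
    then have "0 < l * M * (x l * y l)" using lr m by auto
    ultimately show ?thesis unfolding D_def by (simp add: mult.assoc)
  qed
  have Dr0: "D r < 0" using Dr unfolding D_def by simp
  \<comment> \<open>Its maximum \<open>z\<close> is the last point where \<open>x\<close> or
    \<open>y\<close> is nonpositive; after \<open>z\<close> both are positive.\<close>
  define Z where "Z = {s \<in> {l..r}. min (x s) (y s) \<le> 0}"
  have cm: "continuous_on {l..r} (\<lambda>s. min (x s) (y s))" by (intro continuous_intros cont)
  have "closed Z" unfolding Z_def
    using continuous_closed_preimage[OF cm closed_atLeastAtMost closed_atMost[of 0]]
    by (simp add: vimage_def Int_def)
  then have "compact Z" unfolding compact_eq_bounded_closed
    by (auto simp: Z_def intro: bounded_subset[OF bounded_closed_interval])
  moreover have "l \<in> Z" using lr left \<beta> by (auto simp: Z_def)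
  ultimately obtain z where z: "z \<in> Z" "\<And>s. s \<in> Z \<Longrightarrow> s \<le> z"
    using compact_attains_sup[of Z] by blast
  have zI: "z \<in> {l..r}" using z(1) by (simp add: Z_def)
  have after: "0 < x s" "0 < y s" if "z < s" "s \<le> r" for s
    using z(2)[of s] that zI by (auto simp: Z_def min_le_iff_disj not_le[symmetric])
  have zr: "z < r"
  proof -
    have "r \<notin> Z" using right \<beta> by (auto simp: Z_def)
    then show ?thesis using z(1) zI by (cases "z = r") auto
  qed
  have mz: "min (x z) (y z) = 0"
  proof -
    have "\<exists>t\<ge>z. t \<le> r \<and> min (x t) (y t) = 0"
      using z(1) zr right \<beta> zI
      by (intro IVT' continuous_on_subset[OF cm]) (auto simp: Z_def)
    then obtain t where t: "z \<le> t" "t \<le> r" "min (x t) (y t) = 0" by blast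
    then have "t \<in> Z" using zI by (simp add: Z_def)
    then have "t = z" using z(2) t by force
    then show ?thesis using t by simp
  qed
  have Dz: "D z \<ge> 0 \<and> (D z = 0 \<longrightarrow> x z = 0 \<and> y z = 0)"
  proof -
    have p: "0 < m1 * x' z" "0 < m2 * y' z" using pos[OF zI] m \<beta> by (auto intro!: mult_pos_pos)
    consider "x z = 0" "0 \<le> y z" | "y z = 0" "0 \<le> x z" using mz by (auto simp: min_def split: if_splits)
    then show ?thesis
    proof cases
      case 1
      then show ?thesis using p by (auto simp: D_def)
    next
      case 2
      then show ?thesis using p by (auto simp: D_def)
    qed
  qed
  show ?thesis
  proof (cases "D z = 0")
    case False
    then have Dz0: "D z > 0" using Dz by simp
    obtain s1 where s1: "l \<le> s1" "s1 \<le> z" "D s1 = 0"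
      using IVT'[of D l 0 z] Dl Dz0 zI continuous_on_subset[OF cD, of "{l..z}"] by auto
    obtain s2 where s2: "z \<le> s2" "s2 \<le> r" "D s2 = 0"
      using IVT2'[of D r 0 z] Dr0 Dz0 zI continuous_on_subset[OF cD, of "{z..r}"] by auto
    have "s1 \<noteq> z" using s1 Dz0 by auto
    then show ?thesis using s1 s2 by (intro exI[of _ s1] exI[of _ s2]) auto
  next
    case True
    then have x0: "x z = 0" using Dz by simp
    \<comment> \<open>Below this threshold for \<open>x\<close> the term \<open>t * M * x t\<close>
      is less than \<open>m1 * \<beta> \<le> m1 * x' t\<close>, so the first term of
      \<open>D\<close> outweighs the last.\<close>
    have "m1 * \<beta> / (r * M) > 0" using m \<beta> lr by auto
    then obtain d where d: "d > 0" "\<And>s. s \<in> {l..r} \<Longrightarrow> \<bar>s - z\<bar> < d \<Longrightarrow> \<bar>x s - x z\<bar> < m1 * \<beta> / (r * M)"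
      using cont(1) zI unfolding continuous_on_iff dist_real_def by metis
    define t where "t = min r (z + d / 2)"
    have t: "z < t" "t \<le> r" "\<bar>t - z\<bar> < d" "t \<in> {l..r}" using zr d(1) zI by (auto simp: t_def min_def)
    have xt: "x t < m1 * \<beta> / (r * M)" using d(2)[OF t(4) t(3)] x0 by linarith
    have "D t > 0"
    proof -
      note xy = after[OF t(1,2)]
      have "t * M * x t \<le> r * M * x t" using t(2) m xy by (intro mult_right_mono) auto
      also have "\<dots> < m1 * \<beta>" using xt lr m by (simp add: pos_less_divide_eq mult.commute)
      also have "\<dots> \<le> m1 * x' t" using pos(1)[OF t(4)] m by simp
      finally have "0 < (m1 * x' t - t * M * x t) * y t" using xy by simp
      moreover have "0 < m2 * y' t * x t" using pos(2)[OF t(4)] \<beta> m xy by (auto intro!: mult_pos_pos)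
      ultimately show ?thesis unfolding D_def by (simp add: algebra_simps)
    qed
    then obtain s2 where "t \<le> s2" "s2 \<le> r" "D s2 = 0"
      using IVT2'[of D r 0 t] Dr0 t continuous_on_subset[OF cD, of "{t..r}"] by auto
    then show ?thesis using True t zI by (intro exI[of _ z] exI[of _ s2]) auto
  qed
qed

text \<open>Dirichlet's theorem alone gives a positive multiplier of unknown size. Applied to
  \<open>real (Suc m) * \<theta>\<close> in place of \<theta>, it yields a multiplier divisible by
  \<open>Suc m\<close>, hence at least \<open>m\<close>.\<close>

lemma simultaneous_multiples:
  fixes \<theta> \<eta> :: real and m :: nat
  assumes "\<eta> > 0"
  obtains k j :: int where "int m \<le> k" "\<bar>of_int k * \<theta> - of_int j\<bar> < \<eta>"
proof -
  obtain N :: nat where N: "N > 0" "1 / real N < \<eta>"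
    using assms by (metis gr_zeroI inverse_eq_divide real_arch_inverse)
  obtain h k where hk: "0 < k" "\<bar>of_int k * (real (Suc m) * \<theta>) - of_int h\<bar> < 1 / real N"
    using Dirichlet_approx[OF N(1), of "real (Suc m) * \<theta>"] by metis
  have "int m \<le> k * int (Suc m)"
  proof -
    have "int m \<le> 1 * int (Suc m)" by simp
    also have "\<dots> \<le> k * int (Suc m)" using hk(1) by (intro mult_right_mono) auto
    finally show ?thesis .
  qed
  moreover have "\<bar>of_int (k * int (Suc m)) * \<theta> - of_int h\<bar> < \<eta>"
    using hk(2) N(2) by (simp add: algebra_simps)
  ultimately show thesis using that by blast
qed

lemma sin_cos_shift_int:
  fixes j :: int and z :: real
  defines "\<epsilon> \<equiv> if even j then 1 else -1 :: real"
  shows "sin (of_int j * pi + z) = \<epsilon> * sin z" "cos (of_int j * pi + z) = \<epsilon> * cos z"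
  unfolding \<epsilon>_def by (simp_all add: sin_add cos_add mult.commute[of _ pi] sin_npi_int cos_npi_int)

text \<open>Around \<open>p = k * pi / T1\<close> with \<open>p * T2\<close> close to a multiple of
  pi, both sines change sign within distance \<open>d\<close> while both cosines stay away from
  zero. After a change of signs \<open>two_zeros_between\<close> applies there.\<close>

lemma close_zeros:
  fixes x x' y y' :: "real \<Rightarrow> real"
  assumes T: "0 < T1" "0 < T2" and C: "0 < C" and S: "1 \<le> S" and m: "0 < m1" "0 < m2" "0 < M"
    and cont: "continuous_on {S..} x" "continuous_on {S..} x'" "continuous_on {S..} y" "continuous_on {S..} y'"
    and x: "\<And>s. s \<ge> S \<Longrightarrow> \<bar>x s - sin (s * T1)\<bar> \<le> C / s" "\<And>s. s \<ge> S \<Longrightarrow> \<bar>x' s - cos (s * T1)\<bar> \<le> C / s"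
    and y: "\<And>s. s \<ge> S \<Longrightarrow> \<bar>y s - sin (s * T2)\<bar> \<le> C / s" "\<And>s. s \<ge> S \<Longrightarrow> \<bar>y' s - cos (s * T2)\<bar> \<le> C / s"
    and e: "0 < e"
  shows "\<exists>s1 s2. R \<le> s1 \<and> S \<le> s1 \<and> s1 < s2 \<and> s2 < s1 + e \<and>
    m1 * x' s1 * y s1 + m2 * y' s1 * x s1 - s1 * M * x s1 * y s1 = 0 \<and>
    m1 * x' s2 * y s2 + m2 * y' s2 * x s2 - s2 * M * x s2 * y s2 = 0"
proof -
  \<comment> \<open>The bound \<open>e / 3\<close> keeps an interval of length \<open>2 * d\<close>
    shorter than \<open>e\<close>; the other two keep the phases \<open>d * T1\<close> and
    \<open>d * T2\<close> at most 1.\<close>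
  define d where "d = min (e / 3) (min (1 / T1) (1 / T2))"
  have d: "0 < d" "d \<le> e / 3" "d * T1 \<le> 1" "d * T2 \<le> 1"
  proof -
    show "0 < d" "d \<le> e / 3" using e T by (auto simp: d_def)
    have "d \<le> 1 / T1" "d \<le> 1 / T2" by (auto simp: d_def)
    then show "d * T1 \<le> 1" "d * T2 \<le> 1" using T by (simp_all add: pos_le_divide_eq)
  qed
  \<comment> \<open>Half of the smallest trigonometric value that occurs, so that an error \<beta>
    still leaves \<beta>. The angle 3/2 is the phase bound 1 plus 1/2 for the shift \<delta> below;
    it is less than \<open>pi / 2\<close>.\<close>
  define \<beta> where "\<beta> = min (sin (d * T1)) (min (sin (d * T2 / 2)) (cos (3/2))) / 2"
  have pi32: "3 / 2 < pi / 2" using pi_gt3 by simp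
  have \<beta>: "0 < \<beta>"
  proof -
    have "0 < sin (d * T1)" "0 < sin (d * T2 / 2)" using d T pi_gt3 by (auto intro!: sin_gt_zero)
    moreover have "0 < cos (3/2 :: real)" using pi32 by (intro cos_gt_zero) auto
    ultimately show ?thesis by (simp add: \<beta>_def)
  qed
  have bs: "2 * \<beta> \<le> sin (d * T1)" "2 * \<beta> \<le> sin (d * T2 / 2)" "2 * \<beta> \<le> cos (3/2)" by (auto simp: \<beta>_def)
  \<comment> \<open>From \<open>C / \<beta>\<close> on the asymptotic error is at most \<beta>, and
    \<open>C\<close> keeps the parameter positive. The last entry makes
    \<open>r * (M * \<beta>\<^sup>2)\<close> exceed \<open>4 * (m1 + m2)\<close>, which settles the
    sign at the right end.\<close>
  define B where "B = max (max R S) (max (C / \<beta>) (max C (4 * (m1 + m2) / (M * \<beta>\<^sup>2) + 1)))"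
  define mm where "mm = nat \<lceil>(B + d) * T1 / pi\<rceil>"
  have "0 < d * T2 / (2 * pi)" using d T by simp
  then obtain k j :: int where kj: "int mm \<le> k" "\<bar>of_int k * (T2 / T1) - of_int j\<bar> < d * T2 / (2 * pi)"
    using simultaneous_multiples by metis
  define p where "p = of_int k * pi / T1"
  have pB: "B \<le> p - d"
  proof -
    have "(B + d) * T1 / pi \<le> real mm" unfolding mm_def by linarith
    also have "\<dots> \<le> of_int k" using kj(1) by linarith
    finally show ?thesis using T unfolding p_def by (simp add: field_simps)
  qed
  \<comment> \<open>The difference between \<open>p * T2\<close> and \<open>j * pi\<close>. As it is
    below \<open>d * T2 / 2\<close> in size, the phase of the second sine is at least
    \<open>d * T2 / 2\<close> away from its zero at both ends.\<close>
  define \<delta> where "\<delta> = pi * (of_int k * (T2 / T1) - of_int j)"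
  have \<delta>: "\<bar>\<delta>\<bar> < d * T2 / 2"
  proof -
    have "\<bar>\<delta>\<bar> = pi * \<bar>of_int k * (T2 / T1) - of_int j\<bar>" by (simp add: \<delta>_def abs_mult)
    also have "\<dots> < pi * (d * T2 / (2 * pi))" using kj(2) by (intro mult_strict_left_mono) auto
    finally show ?thesis by simp
  qed
  have a1: "(p + t) * T1 = of_int k * pi + t * T1" for t using T by (simp add: p_def field_simps)
  have a2: "(p + t) * T2 = of_int j * pi + (t * T2 + \<delta>)" for t using T by (simp add: p_def \<delta>_def field_simps)
  \<comment> \<open>Signs picked up by shifts through \<open>k * pi\<close> and
    \<open>j * pi\<close>. Multiplying by them makes the cosines positive and changes the
    characteristic function only by the factor \<open>\<epsilon>1 * \<epsilon>2\<close>.\<close>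
  define \<epsilon>1 \<epsilon>2 :: real where "\<epsilon>1 = (if even k then 1 else -1)" and "\<epsilon>2 = (if even j then 1 else -1)"
  have ee: "\<epsilon>1 * \<epsilon>1 = 1" "\<epsilon>2 * \<epsilon>2 = 1" "\<bar>\<epsilon>1\<bar> = 1" "\<bar>\<epsilon>2\<bar> = 1" by (auto simp: \<epsilon>1_def \<epsilon>2_def)
  have mult: "\<bar>\<epsilon> * u - v\<bar> \<le> \<beta>" if "\<bar>u - \<epsilon> * v\<bar> \<le> C / s" "\<epsilon> * \<epsilon> = 1" "\<bar>\<epsilon>\<bar> = 1" "B \<le> s" for \<epsilon> u v s
  proof -
    have sB: "C / \<beta> \<le> s" "C \<le> s" using that by (auto simp: B_def)
    have "s > 0" using sB C by linarith
    have "\<epsilon> * u - v = \<epsilon> * (u - \<epsilon> * v)" using that(2) by (simp add: right_diff_distrib flip: mult.assoc)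
    then have "\<bar>\<epsilon> * u - v\<bar> = \<bar>u - \<epsilon> * v\<bar>" using that(3) by (simp add: abs_mult)
    also have "\<dots> \<le> C / s" by (rule that)
    also have "\<dots> \<le> \<beta>" using sB \<open>s > 0\<close> \<beta> by (simp add: field_simps)
    finally show ?thesis .
  qed
  have SB: "S \<le> s" if "B \<le> s" for s using that by (simp add: B_def)
  define X X' Y Y' where "X = (\<lambda>s. \<epsilon>1 * x s)" and "X' = (\<lambda>s. \<epsilon>1 * x' s)" and "Y = (\<lambda>s. \<epsilon>2 * y s)" and "Y' = (\<lambda>s. \<epsilon>2 * y' s)"
  have near: "\<bar>X (p + t) - sin (t * T1)\<bar> \<le> \<beta>" "\<bar>X' (p + t) - cos (t * T1)\<bar> \<le> \<beta>"
    "\<bar>Y (p + t) - sin (t * T2 + \<delta>)\<bar> \<le> \<beta>" "\<bar>Y' (p + t) - cos (t * T2 + \<delta>)\<bar> \<le> \<beta>" if "B \<le> p + t" for t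
  proof -
    note ss = sin_cos_shift_int[of k "t * T1", folded \<epsilon>1_def] sin_cos_shift_int[of j "t * T2 + \<delta>", folded \<epsilon>2_def]
    note xx = x[OF SB[OF that], unfolded a1 ss] and yy = y[OF SB[OF that], unfolded a2 ss]
    show "\<bar>X (p + t) - sin (t * T1)\<bar> \<le> \<beta>" "\<bar>X' (p + t) - cos (t * T1)\<bar> \<le> \<beta>"
      "\<bar>Y (p + t) - sin (t * T2 + \<delta>)\<bar> \<le> \<beta>" "\<bar>Y' (p + t) - cos (t * T2 + \<delta>)\<bar> \<le> \<beta>"
      unfolding X_def X'_def Y_def Y'_def using xx yy ee that by (auto intro!: mult)
  qed
  have cosb: "2 * \<beta> \<le> cos z" if "\<bar>z\<bar> \<le> 3 / 2" for z
  proof -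
    have "cos (3/2) \<le> cos \<bar>z\<bar>" using that pi32 by (intro cos_monotone_0_pi_le) auto
    then show ?thesis using bs(3) by simp
  qed
  have sinb: "2 * \<beta> \<le> sin z" if "d * T2 / 2 \<le> z" "z \<le> 3 / 2" for z
  proof -
    have "sin (d * T2 / 2) \<le> sin z" using that d T pi32 by (intro sin_monotone_2pi_le) (auto intro: order_trans[of _ 0])
    then show ?thesis using bs(2) by simp
  qed
  define l r where "l = p - d" and "r = p + d"
  have lr: "l < r" "B \<le> l" "B \<le> r" using d pB by (auto simp: l_def r_def)
  have l0: "0 < l" using SB[OF lr(2)] S by linarith
  have "\<exists>s1 s2. l \<le> s1 \<and> s1 < s2 \<and> s2 \<le> r \<and>
      m1 * X' s1 * Y s1 + m2 * Y' s1 * X s1 - s1 * M * X s1 * Y s1 = 0 \<and>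
      m1 * X' s2 * Y s2 + m2 * Y' s2 * X s2 - s2 * M * X s2 * Y s2 = 0"
  proof (rule two_zeros_between[OF l0 lr(1) \<beta> m])
    have sub: "{l..r} \<subseteq> {S..}" using SB[OF lr(2)] by auto
    show "continuous_on {l..r} X" "continuous_on {l..r} X'" "continuous_on {l..r} Y" "continuous_on {l..r} Y'"
      unfolding X_def X'_def Y_def Y'_def by (intro continuous_intros continuous_on_subset[OF _ sub] cont)+
    have L: "B \<le> p + - d" "B \<le> p + d" using lr by (auto simp: l_def r_def)
    have s1: "2 * \<beta> \<le> sin (d * T1)" by (rule bs)
    have s2: "2 * \<beta> \<le> sin (d * T2 - \<delta>)" "2 * \<beta> \<le> sin (d * T2 + \<delta>)"
      using \<delta> d(4) by (intro sinb; linarith)+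
    have neg: "sin (- d * T2 + \<delta>) = - sin (d * T2 - \<delta>)"
      using sin_minus[of "d * T2 - \<delta>"] by simp
    show "X l \<le> - \<beta>" using near(1)[OF L(1)] s1 by (simp add: l_def abs_le_iff)
    show "Y l \<le> - \<beta>" using near(3)[OF L(1)] s2(1) neg by (simp add: l_def abs_le_iff)
    show Xr: "\<beta> \<le> X r" using near(1)[OF L(2)] s1 by (simp add: r_def abs_le_iff)
    show Yr: "\<beta> \<le> Y r" using near(3)[OF L(2)] s2(2) by (simp add: r_def abs_le_iff)
    show "\<beta> \<le> X' s" "\<beta> \<le> Y' s" if s: "s \<in> {l..r}" for s
    proof -
      define t where "t = s - p"
      have t: "s = p + t" "\<bar>t\<bar> \<le> d" using s by (auto simp: t_def l_def r_def abs_le_iff)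
      have Bt: "B \<le> p + t" using s lr t by auto
      have "\<bar>t * T1\<bar> \<le> d * T1" "\<bar>t * T2\<bar> \<le> d * T2"
        using t(2) T by (auto simp: abs_mult intro!: mult_right_mono)
      then have "\<bar>t * T1\<bar> \<le> 3/2" "\<bar>t * T2 + \<delta>\<bar> \<le> 3/2" using \<delta> d by linarith+
      then have "2 * \<beta> \<le> cos (t * T1)" "2 * \<beta> \<le> cos (t * T2 + \<delta>)" by (simp_all add: cosb)
      then show "\<beta> \<le> X' s" "\<beta> \<le> Y' s"
        using near(2)[OF Bt] near(4)[OF Bt] unfolding t(1) abs_le_iff by linarith+
    qed
    have b1: "\<beta> \<le> 1" using bs(3) cos_le_one[of "3/2"] \<beta> by linarith
    have up: "z \<le> 2" if "\<bar>z - u\<bar> \<le> \<beta>" "u \<le> 1" for z u using that b1 unfolding abs_le_iff by linarith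
    have u2: "X r \<le> 2" "X' r \<le> 2" "Y r \<le> 2" "Y' r \<le> 2"
      using near[OF L(2)] by (auto simp: r_def intro: up)
    have "X' r * Y r \<le> 2 * 2" using u2 Yr \<beta> by (intro mult_mono) auto
    moreover have "Y' r * X r \<le> 2 * 2" using u2 Xr \<beta> by (intro mult_mono) auto
    ultimately have "m1 * (X' r * Y r) + m2 * (Y' r * X r) \<le> m1 * (2 * 2) + m2 * (2 * 2)"
      using m by (intro add_mono mult_left_mono) auto
    also have "\<dots> = 4 * (m1 + m2)" by simp
    also have "\<dots> < r * (M * \<beta>\<^sup>2)"
    proof -
      have "4 * (m1 + m2) / (M * \<beta>\<^sup>2) + 1 \<le> r" using lr(3) by (simp add: B_def)
      then have "4 * (m1 + m2) / (M * \<beta>\<^sup>2) < r" by linarith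
      then show ?thesis using m \<beta> by (simp add: pos_divide_less_eq)
    qed
    also have "\<dots> = r * M * (\<beta> * \<beta>)" by (simp add: power2_eq_square)
    also have "\<dots> \<le> r * M * (X r * Y r)"
      using Xr Yr \<beta> m l0 lr by (intro mult_left_mono mult_mono) auto
    finally show "m1 * X' r * Y r + m2 * Y' r * X r < r * M * X r * Y r" by (simp add: mult.assoc)
  qed
  then obtain s1 s2 where s12: "l \<le> s1" "s1 < s2" "s2 \<le> r"
    "m1 * X' s1 * Y s1 + m2 * Y' s1 * X s1 - s1 * M * X s1 * Y s1 = 0"
    "m1 * X' s2 * Y s2 + m2 * Y' s2 * X s2 - s2 * M * X s2 * Y s2 = 0" by blast
  have fact: "m1 * X' s * Y s + m2 * Y' s * X s - s * M * X s * Y s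
    = (\<epsilon>1 * \<epsilon>2) * (m1 * x' s * y s + m2 * y' s * x s - s * M * x s * y s)" for s
    by (simp add: X_def X'_def Y_def Y'_def algebra_simps)
  have "\<epsilon>1 * \<epsilon>2 \<noteq> 0" by (auto simp: \<epsilon>1_def \<epsilon>2_def)
  then have "m1 * x' s1 * y s1 + m2 * y' s1 * x s1 - s1 * M * x s1 * y s1 = 0"
    "m1 * x' s2 * y s2 + m2 * y' s2 * x s2 - s2 * M * x s2 * y s2 = 0"
    using s12(4,5) unfolding fact by simp_all
  moreover have "R \<le> s1" "S \<le> s1" using s12(1) lr(2) by (auto simp: B_def)
  moreover have "s2 < s1 + e" using s12 d e by (simp add: l_def r_def)
  ultimately show ?thesis using s12(2) by blast
qed

section \<open>The transmission problem\<close>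

lemma AC_on_reflect:
  assumes F: "AC_on a b F f" and ab: "a \<le> b"
  shows "AC_on (-b) (-a) (\<lambda>x. F (-x)) (\<lambda>x. - f (-x))"
  unfolding AC_on_def
proof (intro conjI ballI)
  have "(\<lambda>x. f (-x)) absolutely_integrable_on {-b..-a}"
    using AC_onD(1)[OF F] by simp
  from set_integrable_mult_right[of "-1", OF this]
  show "(\<lambda>x. - f (-x)) absolutely_integrable_on {-b..-a}" by simp
  fix x assume x: "x \<in> {-b..-a}"
  have "integral {-b..-(-x)} (\<lambda>t. f (-t)) = integral {-x..b} f" by (rule Henstock_Kurzweil_Integration.integral_reflect_real)
  also have "\<dots> = F b - F (-x)"
    using x by (intro AC_on_increment[OF F, symmetric]) auto
  finally show "F (-x) = F (- (-b)) + integral {-b..x} (\<lambda>t. - f (-t))" by simp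
qed

lemma H2_on_reflect:
  assumes "H2_on a b f" "a \<le> b"
  shows "H2_on (-b) (-a) (\<lambda>x. f (-x))"
proof -
  obtain g h where gh: "h absolutely_integrable_on {a..b}" "(\<lambda>x. (h x)\<^sup>2) absolutely_integrable_on {a..b}"
      "\<forall>x\<in>{a..b}. g x = g a + integral {a..x} h" "\<forall>x\<in>{a..b}. f x = f a + integral {a..x} g"
    using assms(1) unfolding H2_on_def by blast
  then have g: "AC_on a b g h" unfolding AC_on_def by blast
  have "g absolutely_integrable_on {a..b}"
    by (intro absolutely_integrable_continuous_real AC_on_continuous[OF g])
  then have f: "AC_on a b f g" using gh(4) unfolding AC_on_def by blast
  have "AC_on (-b) (-a) (\<lambda>x. - g (-x)) (\<lambda>x. h (-x))"
    using AC_on_cmult[OF AC_on_reflect[OF g assms(2)], of "-1"] by simp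
  moreover have "AC_on (-b) (-a) (\<lambda>x. f (-x)) (\<lambda>x. - g (-x))"
    by (rule AC_on_reflect[OF f assms(2)])
  moreover have "(\<lambda>x. (h (-x))\<^sup>2) absolutely_integrable_on {-b..-a}"
    using gh(2) absolutely_integrable_reflect_real[where f = "\<lambda>x. (h x)\<^sup>2"] by simp
  ultimately show ?thesis
    unfolding AC_on_def H2_on_def
    by (intro exI[of _ "\<lambda>x. - g (-x)"] exI[of _ "\<lambda>x. h (-x)"]) blast
qed

lemma unif_pos_on_reflect: "unif_pos_on a b f \<Longrightarrow> unif_pos_on (-b) (-a) (\<lambda>x. f (-x))"
  unfolding unif_pos_on_def by force

lemma SL_sol_reflect:
  assumes "SL_sol a b \<sigma> q \<rho> \<mu> v z" "a \<le> b"
  shows "SL_sol (-b) (-a) (\<lambda>x. \<sigma> (-x)) (\<lambda>x. q (-x)) (\<lambda>x. \<rho> (-x)) \<mu> (\<lambda>x. v (-x)) (\<lambda>x. - z (-x))"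
proof -
  have "AC_on a b v (\<lambda>t. z t / \<sigma> t)" "AC_on a b z (\<lambda>t. q t * v t - \<mu> * \<rho> t * v t)"
    using assms(1) by (auto simp: SL_sol_iff_AC_on)
  from AC_on_reflect[OF this(1) assms(2)] AC_on_cmult[OF AC_on_reflect[OF this(2) assms(2)], of "-1"]
  show ?thesis by (simp add: SL_sol_iff_AC_on)
qed

lemma SL_sol_cmult:
  assumes "SL_sol a b \<sigma> q \<rho> \<mu> u w"
  shows "SL_sol a b \<sigma> q \<rho> \<mu> (\<lambda>x. c * u x) (\<lambda>x. c * w x)"
proof -
  have "AC_on a b u (\<lambda>t. w t / \<sigma> t)" "AC_on a b w (\<lambda>t. q t * u t - \<mu> * \<rho> t * u t)"
    using assms by (auto simp: SL_sol_iff_AC_on)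
  from AC_on_cmult[OF this(1), of c] AC_on_cmult[OF this(2), of c]
  show ?thesis by (simp add: SL_sol_iff_AC_on algebra_simps)
qed

text \<open>The transmission problem with the right half folded onto \<open>[-1, 0]\<close>; the reflection
  flips the sign of the second quasi-derivative.\<close>

definition folded_eigenvalue ::
  "(real \<Rightarrow> real) \<Rightarrow> (real \<Rightarrow> real) \<Rightarrow> (real \<Rightarrow> real) \<Rightarrow>
   (real \<Rightarrow> real) \<Rightarrow> (real \<Rightarrow> real) \<Rightarrow> (real \<Rightarrow> real) \<Rightarrow> real \<Rightarrow> real \<Rightarrow> bool" where
  "folded_eigenvalue \<sigma>1 q1 \<rho>1 \<sigma>2 q2 \<rho>2 M \<mu> \<longleftrightarrow>
     (\<exists>u w v z. SL_sol (-1) 0 \<sigma>1 q1 \<rho>1 \<mu> u w \<and> SL_sol (-1) 0 \<sigma>2 q2 \<rho>2 \<mu> v z \<and>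
        u (-1) = 0 \<and> v (-1) = 0 \<and> u 0 = v 0 \<and> w 0 + z 0 = \<mu> * M * u 0 \<and>
        (\<exists>x\<in>{-1..0}. u x \<noteq> 0 \<or> v x \<noteq> 0))"

text \<open>Reflection is an involution, so the witnesses \<open>v (- x)\<close> and
  \<open>- z (- x)\<close> serve in both directions.\<close>

lemma is_eigenvalue_iff_folded:
  "is_eigenvalue \<sigma>1 q1 \<rho>1 \<sigma>2 q2 \<rho>2 M \<mu> \<longleftrightarrow>
   folded_eigenvalue \<sigma>1 q1 \<rho>1 (\<lambda>x. \<sigma>2 (-x)) (\<lambda>x. q2 (-x)) (\<lambda>x. \<rho>2 (-x)) M \<mu>"
proof
  assume "is_eigenvalue \<sigma>1 q1 \<rho>1 \<sigma>2 q2 \<rho>2 M \<mu>"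
  then obtain u w v z where *: "SL_sol (-1) 0 \<sigma>1 q1 \<rho>1 \<mu> u w" "SL_sol 0 1 \<sigma>2 q2 \<rho>2 \<mu> v z"
    "u (-1) = 0" "v 1 = 0" "u 0 = v 0" "w 0 - z 0 = \<mu> * M * u 0"
    "(\<exists>x\<in>{-1..0}. u x \<noteq> 0) \<or> (\<exists>x\<in>{0..1}. v x \<noteq> 0)" unfolding is_eigenvalue_def by blast
  have "\<exists>x\<in>{-1..0}. u x \<noteq> 0 \<or> v (-x) \<noteq> 0"
    using *(7)
  proof
    assume "\<exists>x\<in>{0..1}. v x \<noteq> 0"
    then obtain x where "x \<in> {0..1}" "v x \<noteq> 0" by blast
    then show ?thesis by (intro bexI[of _ "-x"]) auto
  qed blast
  then show "folded_eigenvalue \<sigma>1 q1 \<rho>1 (\<lambda>x. \<sigma>2 (-x)) (\<lambda>x. q2 (-x)) (\<lambda>x. \<rho>2 (-x)) M \<mu>"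
    unfolding folded_eigenvalue_def using * SL_sol_reflect[OF *(2)]
    by (intro exI[of _ u] exI[of _ w] exI[of _ "\<lambda>x. v (-x)"] exI[of _ "\<lambda>x. - z (-x)"]) simp
next
  assume "folded_eigenvalue \<sigma>1 q1 \<rho>1 (\<lambda>x. \<sigma>2 (-x)) (\<lambda>x. q2 (-x)) (\<lambda>x. \<rho>2 (-x)) M \<mu>"
  then obtain u w v z where *: "SL_sol (-1) 0 \<sigma>1 q1 \<rho>1 \<mu> u w"
    "SL_sol (-1) 0 (\<lambda>x. \<sigma>2 (-x)) (\<lambda>x. q2 (-x)) (\<lambda>x. \<rho>2 (-x)) \<mu> v z"
    "u (-1) = 0" "v (-1) = 0" "u 0 = v 0" "w 0 + z 0 = \<mu> * M * u 0"
    "\<exists>x\<in>{-1..0}. u x \<noteq> 0 \<or> v x \<noteq> 0" unfolding folded_eigenvalue_def by blast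
  from *(7) obtain x where "x \<in> {-1..0}" "u x \<noteq> 0 \<or> v x \<noteq> 0" by blast
  then have "(\<exists>x\<in>{-1..0}. u x \<noteq> 0) \<or> (\<exists>x\<in>{0..1}. v (-x) \<noteq> 0)"
  proof (cases "u x = 0")
    case True
    then show ?thesis using \<open>x \<in> {-1..0}\<close> \<open>u x \<noteq> 0 \<or> v x \<noteq> 0\<close>
      by (intro disjI2 bexI[of _ "-x"]) auto
  qed blast
  then show "is_eigenvalue \<sigma>1 q1 \<rho>1 \<sigma>2 q2 \<rho>2 M \<mu>"
    unfolding is_eigenvalue_def using * SL_sol_reflect[OF *(2)]
    by (intro exI[of _ u] exI[of _ w] exI[of _ "\<lambda>x. v (-x)"] exI[of _ "\<lambda>x. - z (-x)"]) simp
qed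

section \<open>Eigenvalues through the matching conditions\<close>

lemma (in fundamental_family) U_nontrivial:
  assumes "s \<ge> S"
  shows "\<exists>x\<in>{a..b}. U s x \<noteq> 0"
proof (rule ccontr)
  assume "\<not> ?thesis"
  then have "integral {a..b} (\<lambda>t. \<rho> t * U s t * U s t) = integral {a..b} (\<lambda>t. 0)"
    by (intro integral_cong) auto
  then show False using mass_lower[OF assms] params by simp
qed

locale transmission =
  one: fundamental_family "-1" 0 \<sigma>1 q1 \<rho>1 U1 W1 h1 T1 C c S +
  two: fundamental_family "-1" 0 \<sigma>2 q2 \<rho>2 U2 W2 h2 T2 C c S
  for \<sigma>1 q1 \<rho>1 U1 W1 h1 T1 \<sigma>2 q2 \<rho>2 U2 W2 h2 T2 C c S +
  fixes M :: real
  assumes M: "M > 0"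
begin

abbreviation "eig \<equiv> folded_eigenvalue \<sigma>1 q1 \<rho>1 \<sigma>2 q2 \<rho>2 M"

text \<open>The equation \<open>char\<close> says that the 2 by 2 matching system for the
  coefficients of the two halves is singular. A kernel vector is \<open>(U2, U1)\<close> at 0; if
  both values vanish, continuity is automatic and \<open>(W2, - W1)\<close> or \<open>(1, 0)\<close>
  serves.\<close>

lemma eigI:
  assumes s: "s \<ge> S" and char: "W1 s 0 * U2 s 0 + W2 s 0 * U1 s 0 = s\<^sup>2 * M * (U1 s 0 * U2 s 0)"
  shows "eig (s\<^sup>2)"
proof -
  have "\<exists>\<alpha> \<beta>. (\<alpha> \<noteq> 0 \<or> \<beta> \<noteq> 0) \<and> \<alpha> * U1 s 0 = \<beta> * U2 s 0 \<and> \<alpha> * W1 s 0 + \<beta> * W2 s 0 = s\<^sup>2 * M * (\<alpha> * U1 s 0)"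
  proof (cases "U1 s 0 = 0 \<and> U2 s 0 = 0")
    case False
    then show ?thesis using char
      by (intro exI[of _ "U2 s 0"] exI[of _ "U1 s 0"]) (auto simp: algebra_simps)
  next
    case zero: True
    show ?thesis
    proof (cases "W1 s 0 = 0 \<and> W2 s 0 = 0")
      case True
      then show ?thesis using zero by (intro exI[of _ 1] exI[of _ 0]) auto
    next
      case False
      then show ?thesis using zero by (intro exI[of _ "W2 s 0"] exI[of _ "- W1 s 0"]) auto
    qed
  qed
  then obtain \<alpha> \<beta> where ab: "\<alpha> \<noteq> 0 \<or> \<beta> \<noteq> 0" "\<alpha> * U1 s 0 = \<beta> * U2 s 0"
    "\<alpha> * W1 s 0 + \<beta> * W2 s 0 = s\<^sup>2 * M * (\<alpha> * U1 s 0)" by blast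
  have "\<exists>x\<in>{-1..0}. \<alpha> * U1 s x \<noteq> 0 \<or> \<beta> * U2 s x \<noteq> 0"
    using ab(1) one.U_nontrivial[OF s] two.U_nontrivial[OF s] by auto
  then show ?thesis
    unfolding folded_eigenvalue_def
    using SL_sol_cmult[OF one.sol(1)[OF s], of \<alpha>] SL_sol_cmult[OF two.sol(1)[OF s], of \<beta>]
      one.sol(2)[OF s] two.sol(2)[OF s] ab
    by (intro exI[of _ "\<lambda>x. \<alpha> * U1 s x"] exI[of _ "\<lambda>x. \<alpha> * W1 s x"]
        exI[of _ "\<lambda>x. \<beta> * U2 s x"] exI[of _ "\<lambda>x. \<beta> * W2 s x"]) simp
qed

text \<open>Uniqueness writes the halves of an eigenfunction as multiples of \<open>U1 s\<close> and
  \<open>U2 s\<close>. The coefficient vector is normalised for the comparison of several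
  eigenfunctions in one plane.\<close>

lemma eigE:
  assumes s: "s \<ge> S" and eig: "eig (s\<^sup>2)"
  obtains \<alpha> \<beta> where "\<alpha>\<^sup>2 + \<beta>\<^sup>2 = 1" "\<alpha> * U1 s 0 = \<beta> * U2 s 0"
    "\<alpha> * W1 s 0 + \<beta> * W2 s 0 = s\<^sup>2 * M * (\<alpha> * U1 s 0)"
proof -
  obtain u w v z where *: "SL_sol (-1) 0 \<sigma>1 q1 \<rho>1 (s\<^sup>2) u w" "SL_sol (-1) 0 \<sigma>2 q2 \<rho>2 (s\<^sup>2) v z"
    "u (-1) = 0" "v (-1) = 0" "u 0 = v 0" "w 0 + z 0 = s\<^sup>2 * M * u 0"
    "\<exists>x\<in>{-1..0}. u x \<noteq> 0 \<or> v x \<noteq> 0" using eig unfolding folded_eigenvalue_def by blast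
  obtain \<alpha> where \<alpha>: "\<And>x. x \<in> {-1..0} \<Longrightarrow> u x = \<alpha> * U1 s x \<and> w x = \<alpha> * W1 s x"
    using one.unique[OF s *(1,3)] by blast
  obtain \<beta> where \<beta>: "\<And>x. x \<in> {-1..0} \<Longrightarrow> v x = \<beta> * U2 s x \<and> z x = \<beta> * W2 s x"
    using two.unique[OF s *(2,4)] by blast
  have ne: "\<alpha> \<noteq> 0 \<or> \<beta> \<noteq> 0" using *(7) \<alpha> \<beta> by auto
  define n where "n = sqrt (\<alpha>\<^sup>2 + \<beta>\<^sup>2)"
  have p: "\<alpha>\<^sup>2 + \<beta>\<^sup>2 > 0" using ne by (simp add: sum_power2_gt_zero_iff)
  then have n: "n > 0" "n\<^sup>2 = \<alpha>\<^sup>2 + \<beta>\<^sup>2" by (simp_all add: n_def)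
  have e: "\<alpha> * U1 s 0 = \<beta> * U2 s 0" "\<alpha> * W1 s 0 + \<beta> * W2 s 0 = s\<^sup>2 * M * (\<alpha> * U1 s 0)"
    using \<alpha>[of 0] \<beta>[of 0] *(5,6) by simp_all
  show thesis
  proof (rule that[of "\<alpha> / n" "\<beta> / n"])
    show "(\<alpha> / n)\<^sup>2 + (\<beta> / n)\<^sup>2 = 1" using p ne by (simp add: power_divide n(2) flip: add_divide_distrib)
    show "\<alpha> / n * U1 s 0 = \<beta> / n * U2 s 0" using e(1) by simp
    show "\<alpha> / n * W1 s 0 + \<beta> / n * W2 s 0 = s\<^sup>2 * M * (\<alpha> / n * U1 s 0)"
      using e(2) by (simp flip: add_divide_distrib)
  qed
qed

text \<open>After multiplication by \<open>h1 * h2 / s\<close> the characteristic function is the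
  one in \<open>close_zeros\<close>, with \<open>m1 = h1\<^sup>2\<close> and
  \<open>m2 = h2\<^sup>2\<close>.\<close>

lemma close_eigenvalues:
  assumes e: "e > 0"
  shows "\<exists>s1 s2. R \<le> s1 \<and> S \<le> s1 \<and> s1 < s2 \<and> s2 < s1 + e \<and> eig (s1\<^sup>2) \<and> eig (s2\<^sup>2)"
proof -
  have h: "h1 > 0" "h2 > 0" using one.params two.params by auto
  have S: "S \<ge> 1" using one.params by auto
  have "\<exists>s1 s2. R \<le> s1 \<and> S \<le> s1 \<and> s1 < s2 \<and> s2 < s1 + e \<and>
    h1\<^sup>2 * (W1 s1 0 / (s1 * h1)) * (h2 * U2 s1 0) + h2\<^sup>2 * (W2 s1 0 / (s1 * h2)) * (h1 * U1 s1 0) - s1 * M * (h1 * U1 s1 0) * (h2 * U2 s1 0) = 0 \<and>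
    h1\<^sup>2 * (W1 s2 0 / (s2 * h1)) * (h2 * U2 s2 0) + h2\<^sup>2 * (W2 s2 0 / (s2 * h2)) * (h1 * U1 s2 0) - s2 * M * (h1 * U1 s2 0) * (h2 * U2 s2 0) = 0"
  proof (rule close_zeros[where C = C and S = S and ?T1.0 = T1 and ?T2.0 = T2 and x = "\<lambda>s. h1 * U1 s 0" and y = "\<lambda>s. h2 * U2 s 0"
        and x' = "\<lambda>s. W1 s 0 / (s * h1)" and y' = "\<lambda>s. W2 s 0 / (s * h2)"])
    show "continuous_on {S..} (\<lambda>s. h1 * U1 s 0)" "continuous_on {S..} (\<lambda>s. h2 * U2 s 0)"
      by (intro continuous_intros one.U_cont two.U_cont)+
    show "continuous_on {S..} (\<lambda>s. W1 s 0 / (s * h1))" "continuous_on {S..} (\<lambda>s. W2 s 0 / (s * h2))"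
      using h S by (intro continuous_intros one.W_cont two.W_cont; force)+
  qed (use one.params two.params M e one.U_asymp two.U_asymp one.W_asymp two.W_asymp in auto)
  moreover have "eig (s\<^sup>2)" if "s \<ge> S"
    "h1\<^sup>2 * (W1 s 0 / (s * h1)) * (h2 * U2 s 0) + h2\<^sup>2 * (W2 s 0 / (s * h2)) * (h1 * U1 s 0) - s * M * (h1 * U1 s 0) * (h2 * U2 s 0) = 0"
    for s
  proof (rule eigI[OF that(1)])
    have s: "s > 0" using that(1) S by simp
    have "h1\<^sup>2 * (W1 s 0 / (s * h1)) * (h2 * U2 s 0) + h2\<^sup>2 * (W2 s 0 / (s * h2)) * (h1 * U1 s 0) - s * M * (h1 * U1 s 0) * (h2 * U2 s 0)
      = h1 * h2 / s * (W1 s 0 * U2 s 0 + W2 s 0 * U1 s 0 - s\<^sup>2 * M * (U1 s 0 * U2 s 0))"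
      using s h by (simp add: field_simps power2_eq_square)
    moreover have "h1 * h2 / s \<noteq> 0" using s h by simp
    ultimately have "W1 s 0 * U2 s 0 + W2 s 0 * U1 s 0 - s\<^sup>2 * M * (U1 s 0 * U2 s 0) = 0"
      using that(2) by simp
    then show "W1 s 0 * U2 s 0 + W2 s 0 * U1 s 0 = s\<^sup>2 * M * (U1 s 0 * U2 s 0)" by simp
  qed
  ultimately show ?thesis by (meson less_imp_le order_trans)
qed

lemma W_bound:
  assumes s: "s \<ge> S"
  shows "\<bar>W1 s 0\<bar> \<le> s * (h1 * (1 + C))" "\<bar>W2 s 0\<bar> \<le> s * (h2 * (1 + C))"
proof -
  have bound: "\<bar>w\<bar> \<le> s * (h * (1 + C))" if "\<bar>w / (s * h) - cos y\<bar> \<le> C / s" "h > 0" for w h y :: real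
  proof -
    have s1: "s \<ge> 1" using s one.params by simp
    have "C / s \<le> C" using s1 one.params by (simp add: pos_divide_le_eq mult_le_cancel_left1)
    then have "\<bar>w / (s * h)\<bar> \<le> 1 + C" using that(1) abs_cos_le_one[of y] by linarith
    then show ?thesis using s1 that(2) by (simp add: abs_mult pos_divide_le_eq mult_ac)
  qed
  show "\<bar>W1 s 0\<bar> \<le> s * (h1 * (1 + C))" "\<bar>W2 s 0\<bar> \<le> s * (h2 * (1 + C))"
    using bound[OF one.W_asymp[OF s]] bound[OF two.W_asymp[OF s]] one.params two.params by auto
qed

text \<open>Lagrange's identity and the matching conditions make the coefficient vectors of two
  eigenvalues orthogonal up to the point term at 0. Within distance \<delta> the masses may be
  frozen at \<open>s1\<close>, so three eigenvalues would contradict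
  \<open>no_three_almost_orthogonal\<close>.\<close>

lemma no_three_close:
  "\<exists>\<delta>>0. \<exists>S'\<ge>S. \<forall>s1 s2 s3. S' \<le> s1 \<longrightarrow> s1 < s2 \<longrightarrow> s2 < s3 \<longrightarrow> s3 \<le> s1 + \<delta> \<longrightarrow>
     eig (s1\<^sup>2) \<longrightarrow> eig (s2\<^sup>2) \<longrightarrow> \<not> eig (s3\<^sup>2)"
proof -
  \<comment> \<open>Bounds \<open>s\<close> times the value of a normalised eigenfunction at 0: the
    flux condition equates \<open>s\<^sup>2 * M\<close> times that value with fluxes of order
    \<open>s\<close>.\<close>
  define B where "B = (h1 + h2) * (1 + C) / M"
  have par: "h1 > 0" "h2 > 0" "C > 0" "c > 0" "S \<ge> 1" using one.params two.params by auto
  have B: "B > 0" using par M by (simp add: B_def)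
  \<comment> \<open>Freezing the masses costs \<open>2 * C * \<delta>\<close> in each half, together
    \<open>c / 6\<close>. The choice of \<open>S'\<close> leaves the other \<open>c / 6\<close> of
    the tolerance \<open>c / 3\<close> for the point term.\<close>
  define \<delta> where "\<delta> = c / (24 * C)"
  define S' where "S' = max S (6 * (M * B\<^sup>2) / c)"
  have \<delta>: "\<delta> > 0" "4 * C * \<delta> = c / 6" using par by (simp_all add: \<delta>_def)
  have "False" if s: "S' \<le> s1" "s1 < s2" "s2 < s3" "s3 \<le> s1 + \<delta>"
      and eig: "eig (s1\<^sup>2)" "eig (s2\<^sup>2)" "eig (s3\<^sup>2)" for s1 s2 s3
  proof -
    have S': "S \<le> S'" "1 \<le> S'" "6 * (M * B\<^sup>2) / c \<le> S'" using par by (auto simp: S'_def)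
    define V where "V = (\<lambda>s \<alpha> \<beta>. \<alpha>\<^sup>2 + \<beta>\<^sup>2 = 1 \<and> \<alpha> * U1 s 0 = \<beta> * U2 s 0 \<and>
      \<alpha> * W1 s 0 + \<beta> * W2 s 0 = s\<^sup>2 * M * (\<alpha> * U1 s 0))"
    have ex: "\<exists>\<alpha> \<beta>. V s \<alpha> \<beta>" if "S' \<le> s" "eig (s\<^sup>2)" for s
    proof -
      have "S \<le> s" using that S' by simp
      then show ?thesis by (rule eigE[OF _ that(2)]) (unfold V_def, blast)
    qed
    obtain x1 y1 where v1: "V s1 x1 y1" using ex[OF s(1) eig(1)] by blast
    obtain x2 y2 where v2: "V s2 x2 y2" using ex[OF _ eig(2)] s by force
    obtain x3 y3 where v3: "V s3 x3 y3" using ex[OF _ eig(3)] s by force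
    define n1 where "n1 = (\<lambda>s r. integral {-1..0} (\<lambda>t. \<rho>1 t * U1 s t * U1 r t))"
    define n2 where "n2 = (\<lambda>s r. integral {-1..0} (\<lambda>t. \<rho>2 t * U2 s t * U2 r t))"
    have unit: "\<bar>x\<bar> \<le> 1" "\<bar>y\<bar> \<le> 1" if "x\<^sup>2 + y\<^sup>2 = 1" for x y :: real
    proof -
      have "x\<^sup>2 \<le> 1" "y\<^sup>2 \<le> 1" using that zero_le_power2[of x] zero_le_power2[of y] by linarith+
      then show "\<bar>x\<bar> \<le> 1" "\<bar>y\<bar> \<le> 1" by (simp_all add: abs_square_le_1)
    qed
    have e: "\<bar>x * U1 s 0\<bar> \<le> B / s" if "S' \<le> s" "V s x y" for s x y
    proof -
      have s1: "s \<ge> 1" "s \<ge> S" using that S' by auto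
      have u: "\<bar>x\<bar> \<le> 1" "\<bar>y\<bar> \<le> 1" using unit that(2) by (auto simp: V_def)
      have "s\<^sup>2 * M * \<bar>x * U1 s 0\<bar> = \<bar>x * W1 s 0 + y * W2 s 0\<bar>" using that(2) M s1
        by (simp add: V_def abs_mult)
      also have "\<dots> \<le> \<bar>x * W1 s 0\<bar> + \<bar>y * W2 s 0\<bar>" by (rule abs_triangle_ineq)
      also have "\<dots> \<le> 1 * (s * (h1 * (1 + C))) + 1 * (s * (h2 * (1 + C)))"
        unfolding abs_mult using u W_bound[OF s1(2)] par s1 by (intro add_mono mult_mono) auto
      also have "\<dots> = s * (M * B)" using M by (simp add: B_def field_simps)
      finally have "(s * M) * (s * \<bar>x * U1 s 0\<bar>) \<le> (s * M) * B" by (simp add: power2_eq_square mult_ac)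
      then have "s * \<bar>x * U1 s 0\<bar> \<le> B" using s1 M by simp
      then show ?thesis using s1 by (simp add: pos_le_divide_eq mult.commute)
    qed
    have orth: "\<bar>n1 s1 s1 * (x * x') + n2 s1 s1 * (y * y')\<bar> \<le> c / 3"
      if r: "s1 \<le> r" "r \<le> s3" "s1 \<le> r'" "r' \<le> s3" "r \<noteq> r'" and v: "V r x y" "V r' x' y'" for r r' x y x' y'
    proof -
      have rS: "S' \<le> r" "S' \<le> r'" using r s by auto
      have rS': "S \<le> r" "S \<le> r'" "S \<le> s1" using rS S' s by auto
      have r0: "r \<ge> 1" "r' \<ge> 1" using rS S' by auto
      have L1: "U1 r 0 * W1 r' 0 - U1 r' 0 * W1 r 0 = (r\<^sup>2 - r'\<^sup>2) * n1 r r'"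
        unfolding n1_def using one.sol rS' by (intro wronskian) auto
      have L2: "U2 r 0 * W2 r' 0 - U2 r' 0 * W2 r 0 = (r\<^sup>2 - r'\<^sup>2) * n2 r r'"
        unfolding n2_def using two.sol rS' by (intro wronskian) auto
      have V: "x * U1 r 0 = y * U2 r 0" "x * W1 r 0 + y * W2 r 0 = r\<^sup>2 * M * (x * U1 r 0)"
        "x' * U1 r' 0 = y' * U2 r' 0" "x' * W1 r' 0 + y' * W2 r' 0 = r'\<^sup>2 * M * (x' * U1 r' 0)"
        using v by (auto simp: V_def)
      define E E' where "E = x * U1 r 0" and "E' = x' * U1 r' 0"
      \<comment> \<open>Lagrange's identity turns the masses into boundary terms at 0, which the
        matching conditions reduce to a multiple of \<open>E * E'\<close>; the factor
        \<open>r\<^sup>2 - r'\<^sup>2\<close> then divides out.\<close>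
      have "(r\<^sup>2 - r'\<^sup>2) * (n1 r r' * (x * x') + n2 r r' * (y * y'))
        = x * x' * ((r\<^sup>2 - r'\<^sup>2) * n1 r r') + y * y' * ((r\<^sup>2 - r'\<^sup>2) * n2 r r')"
        by (simp add: algebra_simps)
      also have "\<dots> = x * x' * (U1 r 0 * W1 r' 0 - U1 r' 0 * W1 r 0) + y * y' * (U2 r 0 * W2 r' 0 - U2 r' 0 * W2 r 0)"
        unfolding L1 L2 ..
      also have "\<dots> = (x * U1 r 0) * (x' * W1 r' 0) - (x' * U1 r' 0) * (x * W1 r 0)
          + ((y * U2 r 0) * (y' * W2 r' 0) - (y' * U2 r' 0) * (y * W2 r 0))"
        by (simp add: algebra_simps)
      also have "\<dots> = E * (x' * W1 r' 0 + y' * W2 r' 0) - E' * (x * W1 r 0 + y * W2 r 0)"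
        unfolding V(1)[symmetric] V(3)[symmetric] E_def E'_def by (simp add: algebra_simps)
      also have "\<dots> = (r\<^sup>2 - r'\<^sup>2) * (- (M * (E * E')))"
        unfolding V(2,4) E_def E'_def by (simp add: algebra_simps)
      finally have "(r\<^sup>2 - r'\<^sup>2) * (n1 r r' * (x * x') + n2 r r' * (y * y')) = (r\<^sup>2 - r'\<^sup>2) * (- (M * (E * E')))" .
      moreover have "r\<^sup>2 - r'\<^sup>2 \<noteq> 0" using r0 r(5) by (simp add: power2_eq_iff)
      ultimately have ort: "n1 r r' * (x * x') + n2 r r' * (y * y') = - (M * (E * E'))"
        by (metis mult_left_cancel)
      have EE: "\<bar>M * (E * E')\<bar> \<le> c / 6"
      proof -
        \<comment> \<open>The decay of one factor already makes the point term small; the other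
          factor is bounded crudely by \<open>B\<close>.\<close>
        have "\<bar>E\<bar> \<le> B / S'" "\<bar>E'\<bar> \<le> B / 1"
        proof -
          have "\<bar>E\<bar> \<le> B / r" unfolding E_def by (rule e[OF rS(1) v(1)])
          also have "\<dots> \<le> B / S'" using B S' rS by (intro divide_left_mono) auto
          finally show "\<bar>E\<bar> \<le> B / S'" .
          have "\<bar>E'\<bar> \<le> B / r'" unfolding E'_def by (rule e[OF rS(2) v(2)])
          also have "\<dots> \<le> B / 1" using B r0 by (intro divide_left_mono) auto
          finally show "\<bar>E'\<bar> \<le> B / 1" .
        qed
        then have "\<bar>E * E'\<bar> \<le> B / S' * (B / 1)" unfolding abs_mult using B S' by (intro mult_mono) auto
        then have "M * \<bar>E * E'\<bar> \<le> M * (B / S' * (B / 1))" using M by (intro mult_left_mono) auto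
        also have "\<dots> = M * B\<^sup>2 / S'" by (simp add: power2_eq_square)
        also have "\<dots> \<le> c / 6" using S' par by (simp add: field_simps)
        finally show ?thesis using M by (simp add: abs_mult)
      qed
      have vu: "\<bar>x\<bar> \<le> 1" "\<bar>y\<bar> \<le> 1" "\<bar>x'\<bar> \<le> 1" "\<bar>y'\<bar> \<le> 1" using v unit by (auto simp: V_def)
      have xx: "\<bar>x * x'\<bar> \<le> 1" "\<bar>y * y'\<bar> \<le> 1" unfolding abs_mult using vu by (auto intro!: mult_le_one)
      have dd: "C * (\<bar>r - s1\<bar> + \<bar>r' - s1\<bar>) \<le> C * (2 * \<delta>)" using r s par by (intro mult_left_mono) auto
      have c1: "\<bar>(n1 r r' - n1 s1 s1) * (x * x')\<bar> \<le> C * (2 * \<delta>) * 1"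
        unfolding abs_mult[of "n1 r r' - n1 s1 s1"]
        using xx(1) one.mass_close[OF rS'] dd by (intro mult_mono) (auto simp: n1_def)
      have c2: "\<bar>(n2 r r' - n2 s1 s1) * (y * y')\<bar> \<le> C * (2 * \<delta>) * 1"
        unfolding abs_mult[of "n2 r r' - n2 s1 s1"]
        using xx(2) two.mass_close[OF rS'] dd by (intro mult_mono) (auto simp: n2_def)
      have "n1 s1 s1 * (x * x') + n2 s1 s1 * (y * y') = - (M * (E * E'))
         - (n1 r r' - n1 s1 s1) * (x * x') - (n2 r r' - n2 s1 s1) * (y * y')"
        unfolding ort[symmetric] by (simp add: algebra_simps)
      moreover have "C * (2 * \<delta>) * 1 = c / 12" using \<delta>(2) by simp
      ultimately show ?thesis using EE c1 c2 by linarith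
    qed
    have m: "c \<le> n1 s1 s1" "c \<le> n2 s1 s1"
      using one.mass_lower[of s1] two.mass_lower[of s1] s(1) S' by (auto simp: n1_def n2_def)
    show False
    proof (rule no_three_almost_orthogonal[OF par(4) m, of x1 y1 x2 y2 x3 y3])
      show "x1\<^sup>2 + y1\<^sup>2 = 1" "x2\<^sup>2 + y2\<^sup>2 = 1" "x3\<^sup>2 + y3\<^sup>2 = 1" using v1 v2 v3 by (auto simp: V_def)
      show "\<bar>n1 s1 s1 * (x1 * x2) + n2 s1 s1 * (y1 * y2)\<bar> \<le> c / 3"
        by (rule orth[OF _ _ _ _ _ v1 v2]) (use s in auto)
      show "\<bar>n1 s1 s1 * (x1 * x3) + n2 s1 s1 * (y1 * y3)\<bar> \<le> c / 3"
        by (rule orth[OF _ _ _ _ _ v1 v3]) (use s in auto)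
      show "\<bar>n1 s1 s1 * (x2 * x3) + n2 s1 s1 * (y2 * y3)\<bar> \<le> c / 3"
        by (rule orth[OF _ _ _ _ _ v2 v3]) (use s in auto)
    qed
  qed
  moreover have "S' \<ge> S" by (simp add: S'_def)
  ultimately show ?thesis using \<delta>(1) by blast
qed

end

section \<open>Gaps between the ordered eigenvalues\<close>

theorem theorem3p1:
  fixes \<rho>1 \<sigma>1 q1 \<rho>2 \<sigma>2 q2 :: "real \<Rightarrow> real" and M :: real and lam :: "nat \<Rightarrow> real"
  assumes "H2_on (-1) 0 \<rho>1" and "H2_on (-1) 0 \<sigma>1"
    and "H2_on 0 1 \<rho>2" and "H2_on 0 1 \<sigma>2"
    and "unif_pos_on (-1) 0 \<rho>1" and "unif_pos_on (-1) 0 \<sigma>1"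
    and "unif_pos_on 0 1 \<rho>2" and "unif_pos_on 0 1 \<sigma>2"
    and "q1 absolutely_integrable_on {-1..0}" and "\<forall>x\<in>{-1..0}. q1 x \<ge> 0"
    and "q2 absolutely_integrable_on {0..1}" and "\<forall>x\<in>{0..1}. q2 x \<ge> 0"
    and "M > 0"
    and "lam 0 > 0" and "strict_mono lam"
    and "range lam = {\<mu>. is_eigenvalue \<sigma>1 q1 \<rho>1 \<sigma>2 q2 \<rho>2 M \<mu>}"
  shows "(\<exists>\<phi>::nat \<Rightarrow> nat. strict_mono \<phi> \<and>
            (\<lambda>n. sqrt (lam (\<phi> n + 1)) - sqrt (lam (\<phi> n))) \<in> O(\<lambda>n. 1 / real n))
       \<and> (\<exists>\<delta>>0. \<forall>n. sqrt (lam (n + 2)) - sqrt (lam n) > 2 * \<delta>)"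
proof -
  have neg: "- 1 < (0 :: real)" by simp
  obtain U1 W1 h1 T1 C1 c1 S1 where f1: "fundamental_family (-1) 0 \<sigma>1 q1 \<rho>1 U1 W1 h1 T1 C1 c1 S1"
    by (rule fundamental_family_exists[OF neg assms(1,5,2,6,9)])
  have r1: "H2_on (-1) 0 (\<lambda>x. \<rho>2 (-x))" "H2_on (-1) 0 (\<lambda>x. \<sigma>2 (-x))"
    using H2_on_reflect[OF assms(3)] H2_on_reflect[OF assms(4)] by simp_all
  have r2: "unif_pos_on (-1) 0 (\<lambda>x. \<rho>2 (-x))" "unif_pos_on (-1) 0 (\<lambda>x. \<sigma>2 (-x))"
    using unif_pos_on_reflect[OF assms(7)] unif_pos_on_reflect[OF assms(8)] by simp_all
  have r3: "(\<lambda>x. q2 (-x)) absolutely_integrable_on {-1..0}"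
    using assms(11) absolutely_integrable_reflect_real[where f = q2 and a = 0 and b = 1] by simp
  obtain U2 W2 h2 T2 C2 c2 S2
    where f2: "fundamental_family (-1) 0 (\<lambda>x. \<sigma>2 (-x)) (\<lambda>x. q2 (-x)) (\<lambda>x. \<rho>2 (-x)) U2 W2 h2 T2 C2 c2 S2"
    by (rule fundamental_family_exists[OF neg r1(1) r2(1) r1(2) r2(2) r3])
  define C c S where "C = max C1 C2" and "c = min c1 c2" and "S = max S1 S2"
  have "c > 0" using fundamental_family.params[OF f1] fundamental_family.params[OF f2] by (simp add: c_def)
  then have "fundamental_family (-1) 0 \<sigma>1 q1 \<rho>1 U1 W1 h1 T1 C c S"
    "fundamental_family (-1) 0 (\<lambda>x. \<sigma>2 (-x)) (\<lambda>x. q2 (-x)) (\<lambda>x. \<rho>2 (-x)) U2 W2 h2 T2 C c S"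
    by (auto intro!: fundamental_family_mono[OF f1] fundamental_family_mono[OF f2] simp: C_def c_def S_def)
  then interpret transmission \<sigma>1 q1 \<rho>1 U1 W1 h1 T1 "\<lambda>x. \<sigma>2 (-x)" "\<lambda>x. q2 (-x)" "\<lambda>x. \<rho>2 (-x)" U2 W2 h2 T2 C c S M
    using assms(13) by (intro transmission.intro transmission_axioms.intro)
  have ran: "range lam = {\<mu>. eig \<mu>}"
    using assms(16) by (simp add: is_eigenvalue_iff_folded)
  define s where "s = (\<lambda>n. sqrt (lam n))"
  have lam_pos: "lam n > 0" for n
    using assms(14) strict_mono_less_eq[OF assms(15), of 0 n] by linarith
  have s_mono: "s i < s j \<longleftrightarrow> i < j" for i j
    using strict_mono_less[OF assms(15), of i j] by (simp add: s_def)
  have s_sq: "(s n)\<^sup>2 = lam n" for n using lam_pos[of n] by (simp add: s_def)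
  have eig_s: "eig ((s n)\<^sup>2)" for n using ran by (auto simp: s_sq)
  have index: "\<exists>i. z = s i" if "eig (z\<^sup>2)" "z \<ge> S" for z
  proof -
    have "z\<^sup>2 \<in> range lam" unfolding ran using that(1) by simp
    then obtain i where "lam i = z\<^sup>2" by auto
    then have "z = s i" using that(2) one.params by (simp add: s_def)
    then show ?thesis ..
  qed
  \<comment> \<open>The two close parameters need not be neighbours in the enumeration, but the
    successor of the first is at least as close to it. Starting above \<open>s m + 1\<close> forces
    an index beyond \<open>m\<close>.\<close>
  have close: "\<exists>i. m < i \<and> s (i + 1) - s i < e" if e: "e > 0" for e m
  proof -
    obtain s1 s2 where s12: "s m + 1 \<le> s1" "S \<le> s1" "s1 < s2" "s2 < s1 + e" "eig (s1\<^sup>2)" "eig (s2\<^sup>2)"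
      using close_eigenvalues[OF e, of "s m + 1"] by blast
    obtain i j where ij: "s1 = s i" "s2 = s j" using index[of s1] index[of s2] s12 by fastforce
    have "m < i" using s12(1) ij s_mono[of m i] by simp
    moreover have "i < j" using s12(3) ij s_mono by simp
    then have "s (i + 1) \<le> s j" using s_mono[of j "i + 1"] by linarith
    ultimately show ?thesis using s12(4) ij by (intro exI[of _ i]) auto
  qed
  have unbounded: "\<exists>N. R \<le> s N" for R
  proof -
    obtain s1 where "R \<le> s1" "S \<le> s1" "eig (s1\<^sup>2)" using close_eigenvalues[of 1 R] by auto
    then show ?thesis using index[of s1] by auto
  qed
  have "\<exists>\<phi>. strict_mono \<phi> \<and> (\<lambda>n. s (\<phi> n + 1) - s (\<phi> n)) \<in> O(\<lambda>n. 1 / real n)"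
  proof -
    \<comment> \<open>Arbitrarily small gaps occur beyond every index, so the prescribed rate is
      obtained by choosing indices one after another.\<close>
    have "\<exists>\<phi>. \<forall>n. (s (\<phi> n + 1) - s (\<phi> n) < 1 / (real n + 1)) \<and> \<phi> n < \<phi> (Suc n)"
    proof (rule dependent_nat_choice)
      show "\<exists>i. s (i + 1) - s i < 1 / (real 0 + 1)" using close[of 1 0] by auto
      show "\<exists>j. s (j + 1) - s j < 1 / (real (Suc n) + 1) \<and> i < j" for i n
        using close[of "1 / (real (Suc n) + 1)" i] by auto
    qed
    then obtain \<phi> where \<phi>: "\<And>n. s (\<phi> n + 1) - s (\<phi> n) < 1 / (real n + 1)" "\<And>n. \<phi> n < \<phi> (Suc n)" by blast
    have "(\<lambda>n. s (\<phi> n + 1) - s (\<phi> n)) \<in> O(\<lambda>n. 1 / real n)"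
    proof (rule bigoI[of _ 1])
      show "\<forall>\<^sub>F n in sequentially. norm (s (\<phi> n + 1) - s (\<phi> n)) \<le> 1 * norm (1 / real n)"
        \<comment> \<open>At \<open>n = 0\<close> the value \<open>1 / real n\<close> is 0 by
          convention, so the comparison is made for positive \<open>n\<close>.\<close>
        using eventually_gt_at_top[of 0]
      proof eventually_elim
        case (elim n)
        have "s (\<phi> n) < s (\<phi> n + 1)" by (simp add: s_mono)
        moreover have "1 / (real n + 1) \<le> 1 / real n" using elim by (intro divide_left_mono) auto
        ultimately show ?case using \<phi>(1)[of n] by simp
      qed
    qed
    then show ?thesis using \<phi>(2) by (auto simp: strict_mono_Suc_iff)
  qed
  moreover have "\<exists>\<delta>>0. \<forall>n. s (n + 2) - s n > 2 * \<delta>"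
  proof -
    obtain d S' where d: "d > 0" "\<And>s1 s2 s3. S' \<le> s1 \<Longrightarrow> s1 < s2 \<Longrightarrow> s2 < s3 \<Longrightarrow> s3 \<le> s1 + d \<Longrightarrow>
       eig (s1\<^sup>2) \<Longrightarrow> eig (s2\<^sup>2) \<Longrightarrow> \<not> eig (s3\<^sup>2)"
      using no_three_close by blast
    obtain N where N: "S' \<le> s N" using unbounded by blast
    \<comment> \<open>From \<open>N\<close> on the gap exceeds \<open>d\<close>; the finitely many
      earlier gaps are collected and positive by monotonicity.\<close>
    define A where "A = insert d ((\<lambda>n. s (n + 2) - s n) ` {..<N})"
    have A: "finite A" "A \<noteq> {}" by (auto simp: A_def)
    have pos: "a > 0" if "a \<in> A" for a using that d(1) s_mono by (auto simp: A_def)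
    \<comment> \<open>Division by 3 makes \<open>2 * \<delta>\<close> strictly smaller than the
      minimum.\<close>
    define \<delta> where "\<delta> = Min A / 3"
    have "\<delta> > 0" using Min_in[OF A] pos by (auto simp: \<delta>_def)
    moreover have "2 * \<delta> < s (n + 2) - s n" for n
    proof -
      have "Min A \<le> s (n + 2) - s n"
      proof (cases "n < N")
        case True
        then show ?thesis using A by (intro Min_le) (auto simp: A_def)
      next
        case False
        then have "S' \<le> s n" using N s_mono[of n N] by linarith
        then have "\<not> s (n + 2) \<le> s n + d"
          using d(2)[of "s n" "s (n + 1)" "s (n + 2)"] eig_s s_mono by auto
        moreover have "Min A \<le> d" using A by (intro Min_le) (auto simp: A_def)
        ultimately show ?thesis by linarith
      qed
      then show ?thesis using \<open>\<delta> > 0\<close> by (simp add: \<delta>_def)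
    qed
    ultimately show ?thesis by blast
  qed
  ultimately show ?thesis unfolding s_def by blast
qed

end
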